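(* The closed unit ball $\mathcal{B}_M$ of every JBW$^*$-triple $M$ satisfies the strong Mankiewicz property. Consequently, every convex body in a JBW$^*$-triple satisfies the same property. Furthermore, if $L$ is a convex subset of a normed space $Y$, then every surjective isometry $\Delta:\mathcal{B}_M\to L$ can be uniquely extended to an affine isometry from $M$ onto a norm closed subspace of $Y$.
   Context: A convex subset $K$ of a normed space $X$ satisfies the strong Mankiewicz property if every surjective isometry $\Delta$ from $K$ onto an arbitrary convex subset $L$ of a normed space $Y$ is affine (preserves convex combinations). A convex body in a normed space is a convex subset with non-empty interior. A complex Banach space is identified with its underlying real Banach space where affine maps are concerned. A JB$^*$-triple is a complex Banach space $E$ with a continuous triple product $\{\cdot,\cdot,\cdot\}:E\times E\times E\to E$ which is symmetric and linear in the first and third variables, conjugate linear in the second variable, and satisfies, for all $a,b,x,y\in E$ and writing $L(a,b)x=\{a,b,x\}$: (a) $L(a,b)L(x,y)=L(x,y)L(a,b)+L(L(a,b)x,y)-L(x,L(b,a)y)$; (b) $L(a,a)$ is a hermitian operator with non-negative spectrum; (c) $\|\{a,a,a\}\|=\|a\|^3$. A JBW$^*$-triple is a JB$^*$-triple which is also a dual Banach space.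
   Formalization: "Norm closed subspace of Y" is taken to mean norm closed affine subspace: for M the complex numbers and Δ(z) = (z,1) into C², the image of the extension does not contain 0, so it cannot be a linear subspace. *)

theory Defs
  imports "HOL-Analysis.Analysis"
begin

section \<open>Complex normed spaces\<close>

text \<open>
  The topology, the norm and the real scalar multiplication are those of the underlying real
  space, so real notions (affine maps, convexity) apply to a complex space directly.
\<close>

class complex_normed_vector = real_normed_vector +
  fixes scaleC :: "complex \<Rightarrow> 'a \<Rightarrow> 'a"
  assumes scaleC_add_right: "scaleC c (x + y) = scaleC c x + scaleC c y"
    and scaleC_add_left: "scaleC (c + d) x = scaleC c x + scaleC d x"
    and scaleC_scaleC: "scaleC c (scaleC d x) = scaleC (c * d) x"
    and scaleC_of_real: "scaleC (complex_of_real r) x = scaleR r x"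
    and norm_scaleC: "norm (scaleC c x) = cmod c * norm x"

class complex_banach = complex_normed_vector + banach

instantiation complex :: complex_banach
begin

definition scaleC_complex :: "complex \<Rightarrow> complex \<Rightarrow> complex"
  where "scaleC_complex c z = c * z"

instance
  by standard (simp_all add: scaleC_complex_def algebra_simps scaleR_conv_of_real norm_mult)

end

definition clinear :: "('a::complex_normed_vector \<Rightarrow> 'b::complex_normed_vector) \<Rightarrow> bool"
  where "clinear f \<longleftrightarrow>
    (\<forall>x y. f (x + y) = f x + f y) \<and> (\<forall>c x. f (scaleC c x) = scaleC c (f x))"

definition conj_linear :: "('a::complex_normed_vector \<Rightarrow> 'b::complex_normed_vector) \<Rightarrow> bool"
  where "conj_linear f \<longleftrightarrow>
    (\<forall>x y. f (x + y) = f x + f y) \<and> (\<forall>c x. f (scaleC c x) = scaleC (cnj c) (f x))"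

definition bounded_clinear :: "('a::complex_normed_vector \<Rightarrow> 'b::complex_normed_vector) \<Rightarrow> bool"
  where "bounded_clinear f \<longleftrightarrow> clinear f \<and> (\<exists>K. \<forall>x. norm (f x) \<le> norm x * K)"


section \<open>Operators on a complex Banach space\<close>

definition op_spectrum :: "('a::complex_banach \<Rightarrow> 'a) \<Rightarrow> complex set"
  where "op_spectrum A = {z. \<not> (\<exists>B. bounded_clinear B \<and>
    (\<forall>x. B (scaleC z x - A x) = x) \<and> (\<forall>x. scaleC z (B x) - A (B x) = x))}"

text \<open>The operator exponential \<open>exp (z A)\<close>, as its power series evaluated at a vector.\<close>

definition op_exp :: "complex \<Rightarrow> ('a::complex_banach \<Rightarrow> 'a) \<Rightarrow> 'a \<Rightarrow> 'a"
  where "op_exp z A x = (\<Sum>n. scaleC (z ^ n / fact n) ((A ^^ n) x))"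

text \<open>
  A bounded operator \<open>A\<close> is hermitian if \<open>exp (i t A)\<close> is isometric for all real \<open>t\<close>.  On a
  nonzero space this says that these exponentials all have norm one; the isometric form
  also covers the zero space.
\<close>

definition hermitian_op :: "('a::complex_banach \<Rightarrow> 'a) \<Rightarrow> bool"
  where "hermitian_op A \<longleftrightarrow> bounded_clinear A \<and>
    (\<forall>t::real. \<forall>x. norm (op_exp (\<i> * complex_of_real t) A x) = norm x)"


section \<open>JB*-triples and JBW*-triples\<close>

text \<open>\<open>T a b c\<close> is the triple product, so that \<open>L(a,b)\<close> is the partial application \<open>T a b\<close>.\<close>

locale jb_triple =
  fixes T :: "'a::complex_banach \<Rightarrow> 'a \<Rightarrow> 'a \<Rightarrow> 'a"
  assumes continuous: "continuous_on UNIV (\<lambda>(a, b, c). T a b c)"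
    and symmetric: "T a b c = T c b a"
    and linear_first: "clinear (\<lambda>a. T a b c)"
    and conj_linear_second: "conj_linear (\<lambda>b. T a b c)"
    and linear_third: "clinear (\<lambda>c. T a b c)"
    and jordan_identity:
      "T a b (T x y z) = T x y (T a b z) + T (T a b x) y z - T x (T b a y) z"
    and hermitian: "hermitian_op (T a a)"
    and nonneg_spectrum: "op_spectrum (T a a) \<subseteq> complex_of_real ` {0..}"
    and norm_cube: "norm (T a a a) = norm a ^ 3"

text \<open>
  \<open>'a\<close> is isometrically and complex-linearly isomorphic to the Banach space of bounded complex
  linear functionals on \<open>'p\<close> with the operator norm.
\<close>

definition is_dual_of :: "'a::complex_banach itself \<Rightarrow> 'p::complex_banach itself \<Rightarrow> bool"
  where "is_dual_of _ _ \<longleftrightarrow> (\<exists>J :: 'a \<Rightarrow> 'p \<Rightarrow> complex.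
    bij_betw J UNIV {f. bounded_clinear f} \<and>
    (\<forall>x y p. J (x + y) p = J x p + J y p) \<and>
    (\<forall>c x p. J (scaleC c x) p = c * J x p) \<and>
    (\<forall>x. onorm (J x) = norm x))"

text \<open>
  The predual is a type parameter.  As a hypothesis with \<open>'p\<close> free, this amounts to the existence
  of some predual.
\<close>

locale jbw_triple = jb_triple T
  for T :: "'a::complex_banach \<Rightarrow> 'a \<Rightarrow> 'a \<Rightarrow> 'a" and P :: "'p::complex_banach itself" +
  assumes dual: "is_dual_of TYPE('a) P"


section \<open>The strong Mankiewicz property\<close>

definition affine_map_on :: "'a::real_vector set \<Rightarrow> ('a \<Rightarrow> 'b::real_vector) \<Rightarrow> bool"
  where "affine_map_on K f \<longleftrightarrow> (\<forall>x\<in>K. \<forall>y\<in>K. \<forall>t\<in>{0..1::real}.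
    f ((1 - t) *\<^sub>R x + t *\<^sub>R y) = (1 - t) *\<^sub>R f x + t *\<^sub>R f y)"

definition surj_isometry :: "'a::metric_space set \<Rightarrow> 'b::metric_space set \<Rightarrow> ('a \<Rightarrow> 'b) \<Rightarrow> bool"
  where "surj_isometry K L f \<longleftrightarrow>
    (\<forall>x\<in>K. \<forall>y\<in>K. dist (f x) (f y) = dist x y) \<and> f ` K = L"

text \<open>
  HOL cannot quantify over the target space inside a formula, so it is a type parameter;
  a theorem in which \<open>'b\<close> is free asserts the property for all normed spaces.
\<close>

definition strong_mankiewicz ::
    "'b::real_normed_vector itself \<Rightarrow> 'a::real_normed_vector set \<Rightarrow> bool"
  where "strong_mankiewicz _ K \<longleftrightarrow> convex K \<and>
    (\<forall>(L :: 'b set) f. convex L \<longrightarrow> surj_isometry K L f \<longrightarrow> affine_map_on K f)"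

definition convex_body :: "'a::real_normed_vector set \<Rightarrow> bool"
  where "convex_body K \<longleftrightarrow> convex K \<and> interior K \<noteq> {}"

end

theory Submission
  imports Defs
begin

text \<open>
  Call \<open>E\<close> the set of extreme points of the closed unit ball of a Banach space.  By a theorem of Mori and
  Ozawa (\<open>strong_mankiewicz_if_hull\<close>), if the closed convex hull of \<open>E\<close> contains a ball around the
  origin, then all convex bodies have the strong Mankiewicz property.  An isometry \<open>f\<close> onto a convex
  set preserves midpoints in the directions of \<open>E\<close>, because there a metric midpoint is unique.  This
  forces a bound of second order on \<open>f (y + v) - f y - f (x + v) + f x\<close>, first for \<open>v\<close> in a direction from \<open>E\<close> and then,
  by the hypothesis, for all small \<open>v\<close> (\<open>second_diff_lipschitz\<close>).  A contraction argument
  in the domain then shows that the image, although it may have empty interior in the target, is locally closed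
  under reflections (\<open>image_parallelogram\<close>), which is what the Mazur--Ulam argument needs
  in order to give local, and hence global, preservation of midpoints.

  It remains to verify the hypothesis for a JBW*-triple.  As a dual space it has some extreme point
  \<open>u\<close> (\<open>dual_ball_extreme_point\<close>).  Such a \<open>u\<close> is a tripotent: otherwise
  \<open>u + c (u - {u,u,u})\<close> and \<open>u - c (u - {u,u,u})\<close> are two different points of the ball with midpoint \<open>u\<close>.  That the first
  of them lies in the ball is \<open>norm_push_le\<close>.  In place of the functional calculus of \<open>u\<close>, its proof uses the growth of
  \<open>exp (z L(u,u)) u\<close>, which is controlled since \<open>L(u,u)\<close> is hermitian with nonnegative spectrum, and
  passes to high iterated cubes, under which the norm is multiplicative.  Peirce theory and
  extremality show that \<open>L(u,u)\<close> is invertible (\<open>extreme_point_L_surj\<close>).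

  The isometries \<open>exp (i t L(c,c))\<close> map \<open>u\<close> to extreme points.  Difference quotients at
  \<open>t = 0\<close> approximate all vectors \<open>L(c,c) u\<close>, and by polarization the range of \<open>L(u,u)\<close>, by bounded multiples of convex
  combinations of extreme points, uniformly on the unit ball.  Since \<open>L(u,u)\<close> is invertible, a geometric series shows
  that the closed hull contains a ball (\<open>extreme_hull_contains_ball\<close>).
\<close>

section \<open>Extreme points and symmetric sets\<close>

text \<open>
  Extremality in the unit ball, tested by midpoints: \<open>e\<close> is extreme when no nonzero \<open>d\<close> keeps both
  \<open>e + d\<close> and \<open>e - d\<close> in the ball.
\<close>

lemma extreme_point_of_cballI:
  fixes e :: "'a::real_normed_vector"
  assumes "norm e \<le> 1"
    and "\<And>d. norm (e + d) \<le> 1 \<Longrightarrow> norm (e - d) \<le> 1 \<Longrightarrow> d = 0"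
  shows "e extreme_point_of cball 0 1"
  unfolding extreme_point_of_def
proof (intro conjI ballI notI)
  show "e \<in> cball 0 1" using assms(1) by simp
next
  fix a b assume a: "a \<in> cball (0::'a) 1" and b: "b \<in> cball (0::'a) 1" and "e \<in> open_segment a b"
  then obtain t where t: "0 < t" "t < 1" and e: "e = (1 - t) *\<^sub>R a + t *\<^sub>R b" and "a \<noteq> b"
    by (auto simp: in_segment)
  define s where "s = min t (1 - t)"
  have s: "0 < s" "s \<le> t" "s \<le> 1 - t" using t by (auto simp: s_def)
  have "norm (e + s *\<^sub>R (b - a)) \<le> 1"
  proof -
    have "e + s *\<^sub>R (b - a) = (1 - (t + s)) *\<^sub>R a + (t + s) *\<^sub>R b"
      by (simp add: e algebra_simps)
    moreover have "\<dots> \<in> cball 0 1"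
      using a b s t by (intro convexD_alt convex_cball) auto
    ultimately show ?thesis by simp
  qed
  moreover have "norm (e - s *\<^sub>R (b - a)) \<le> 1"
  proof -
    have "e - s *\<^sub>R (b - a) = (1 - (t - s)) *\<^sub>R a + (t - s) *\<^sub>R b"
      by (simp add: e algebra_simps)
    moreover have "\<dots> \<in> cball 0 1"
      using a b s t by (intro convexD_alt convex_cball) auto
    ultimately show ?thesis by simp
  qed
  ultimately have "s *\<^sub>R (b - a) = 0" by (rule assms(2))
  then show False using s \<open>a \<noteq> b\<close> by simp
qed

lemma extreme_point_of_cballD:
  fixes e :: "'a::real_normed_vector"
  assumes "e extreme_point_of cball 0 1" "norm (e + d) \<le> 1" "norm (e - d) \<le> 1"
  shows "d = 0"
proof (rule ccontr)
  assume "d \<noteq> 0"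
  have "e \<in> open_segment (e - d) (e + d)"
    unfolding in_segment
  proof (intro conjI exI[of _ "1/2"])
    show "e - d \<noteq> e + d"
    proof
      assume "e - d = e + d"
      then have "2 *\<^sub>R d = 0" by (simp add: algebra_simps scaleR_2 flip: add_eq_0_iff)
      then show False using \<open>d \<noteq> 0\<close> by simp
    qed
    show "e = (1 - 1 / 2) *\<^sub>R (e - d) + (1 / 2) *\<^sub>R (e + d)"
      by (simp add: algebra_simps flip: scaleR_add_left)
  qed auto
  then show False
    using assms by (auto simp: extreme_point_of_def)
qed

lemma extreme_point_cball_norm_le:
  "e extreme_point_of cball (0::'a::real_normed_vector) 1 \<Longrightarrow> norm e \<le> 1"
  by (auto simp: extreme_point_of_def)

lemma convex_midpoint:
  assumes "convex S" "a \<in> S" "b \<in> S"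
  shows "(1/2) *\<^sub>R (a + b) \<in> S"
  using convexD[OF assms, of "1/2" "1/2"] by (simp add: scaleR_add_right)

text \<open>
  Vaisala's form of the Mazur--Ulam argument.  If \<open>r\<close> is the reflection in \<open>c\<close>, then \<open>r g\<^sup>-\<^sup>1 r g\<close> is
  again an isometry of \<open>S\<close>, and it moves \<open>c\<close> twice as far as \<open>g\<close> does; iteration contradicts
  boundedness unless \<open>c\<close> is fixed.
\<close>

lemma isometry_fixes_centre:
  fixes S :: "'a::real_normed_vector set"
  assumes "bounded S" "c \<in> S" and sym: "\<And>x. x \<in> S \<Longrightarrow> 2 *\<^sub>R c - x \<in> S"
    and "bij_betw g S S" "\<And>x y. x \<in> S \<Longrightarrow> y \<in> S \<Longrightarrow> dist (g x) (g y) = dist x y"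
  shows "g c = c"
proof -
  obtain D where D: "\<And>x y. x \<in> S \<Longrightarrow> y \<in> S \<Longrightarrow> dist x y \<le> D"
    using \<open>bounded S\<close> by (auto simp: bounded_two_points)
  have bound: "2 ^ n * dist (g c) c \<le> D"
    if "bij_betw g S S" "\<And>x y. x \<in> S \<Longrightarrow> y \<in> S \<Longrightarrow> dist (g x) (g y) = dist x y" for g n
    using that
  proof (induction n arbitrary: g)
    case 0
    then show ?case using D \<open>c \<in> S\<close> by (auto dest: bij_betwE)
  next
    case (Suc n)
    define r where "r = (\<lambda>x. 2 *\<^sub>R c - x)"
    define h where "h = inv_into S g"
    have rS: "\<And>x. x \<in> S \<Longrightarrow> r x \<in> S" and rr: "\<And>x. r (r x) = x"
      and rd: "\<And>x y. dist (r x) (r y) = dist x y" and rc: "r c = c"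
      using sym by (auto simp: r_def dist_norm norm_minus_commute scaleR_2)
    have gS: "\<And>x. x \<in> S \<Longrightarrow> g x \<in> S" using Suc.prems(1) by (auto dest: bij_betwE)
    have h: "bij_betw h S S" unfolding h_def by (rule bij_betw_inv_into[OF Suc.prems(1)])
    have hS: "\<And>x. x \<in> S \<Longrightarrow> h x \<in> S" using h by (auto dest: bij_betwE)
    have gh: "\<And>x. x \<in> S \<Longrightarrow> g (h x) = x" and hg: "\<And>x. x \<in> S \<Longrightarrow> h (g x) = x"
      unfolding h_def using Suc.prems(1)
      by (auto simp: bij_betw_inv_into_left bij_betw_inv_into_right)
    have hd: "dist (h x) (h y) = dist x y" if "x \<in> S" "y \<in> S" for x y
      using Suc.prems(2)[of "h x" "h y"] that by (simp add: hS gh)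
    have r: "bij_betw r S S"
      by (rule bij_betw_byWitness[where f' = r]) (auto simp: rr rS)
    define g' where "g' = r \<circ> h \<circ> r \<circ> g"
    have "bij_betw g' S S"
      unfolding g'_def using Suc.prems(1) h r by (intro bij_betw_trans) auto
    moreover have "dist (g' x) (g' y) = dist x y" if "x \<in> S" "y \<in> S" for x y
      using that by (simp add: g'_def rd hd rS gS Suc.prems(2))
    ultimately have "2 ^ n * dist (g' c) c \<le> D" by (rule Suc.IH)
    moreover have "dist (g' c) c = 2 * dist (g c) c"
    proof -
      have "dist (g' c) c = dist (h (r (g c))) (h (g c))"
        using rd[of "h (r (g c))" c] \<open>c \<in> S\<close> by (simp add: g'_def rc hg)
      also have "\<dots> = dist (r (g c)) (g c)" using \<open>c \<in> S\<close> by (simp add: hd rS gS)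
      also have "\<dots> = norm (2 *\<^sub>R (c - g c))"
        by (simp add: r_def dist_norm algebra_simps scaleR_2)
      finally show ?thesis by (simp only: norm_scaleR) (simp add: dist_norm norm_minus_commute)
    qed
    ultimately show ?case by simp
  qed
  show ?thesis
  proof (rule ccontr)
    assume "g c \<noteq> c"
    then obtain n where "D / dist (g c) c < 2 ^ n"
      using real_arch_pow[of 2 "D / dist (g c) c"] by auto
    then show False
      using bound[OF assms(4,5), of n] \<open>g c \<noteq> c\<close> by (simp add: divide_less_eq)
  qed
qed

section \<open>Isometries onto convex sets\<close>

text \<open>
  An isometric map on a convex set with convex image.  The image may have empty interior, and the
  target space need not be complete; completeness is only used in the domain.
\<close>

locale isometry_onto_convex =
  fixes K :: "'a::banach set" and f :: "'a \<Rightarrow> 'b::real_normed_vector"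
  assumes convex_dom: "convex K" and convex_image: "convex (f ` K)"
    and isom: "\<And>x y. x \<in> K \<Longrightarrow> y \<in> K \<Longrightarrow> dist (f x) (f y) = dist x y"
begin

lemma norm_isom: "x \<in> K \<Longrightarrow> y \<in> K \<Longrightarrow> norm (f x - f y) = norm (x - y)"
  using isom by (simp add: dist_norm)

text \<open>
  The preimage of the midpoint of \<open>f x\<close> and \<open>f y\<close> is a metric midpoint of \<open>x\<close> and \<open>y\<close>.
\<close>

lemma image_midpoint:
  assumes "x \<in> K" "y \<in> K"
  obtains q where "q \<in> K" "f q = (1/2) *\<^sub>R (f x + f y)"
    "norm (q - x) = norm (x - y) / 2" "norm (q - y) = norm (x - y) / 2"
proof -
  have "(1/2) *\<^sub>R f x + (1/2) *\<^sub>R f y \<in> f ` K"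
    using assms by (intro convexD[OF convex_image]) auto
  then obtain q where q: "q \<in> K" "f q = (1/2) *\<^sub>R (f x + f y)"
    by (auto simp: scaleR_add_right)
  have "f q - f x = (1/2) *\<^sub>R (f y - f x)" "f q - f y = (1/2) *\<^sub>R (f x - f y)"
    unfolding q(2) by (simp_all add: algebra_simps flip: scaleR_add_left)
  then have "norm (f q - f x) = norm (f y - f x) / 2" "norm (f q - f y) = norm (f x - f y) / 2"
    by simp_all
  then show ?thesis
    using q assms norm_isom[of q x] norm_isom[of q y] norm_isom[of x y] norm_isom[of y x]
      norm_minus_commute[of y x]
    by (intro that[of q]) linarith+
qed

text \<open>
  In the direction of an extreme point of the unit ball metric midpoints are unique, so \<open>f\<close> maps the
  midpoint to the midpoint.
\<close>

lemma extreme_direction_midpoint: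
  assumes e: "e extreme_point_of cball 0 1" and "t > 0" "x \<in> K" "x + (2 * t) *\<^sub>R e \<in> K"
  shows "f (x + (2 * t) *\<^sub>R e) - f x = 2 *\<^sub>R (f (x + t *\<^sub>R e) - f x)"
proof -
  let ?y = "x + (2 * t) *\<^sub>R e"
  obtain q where q: "q \<in> K" "f q = (1/2) *\<^sub>R (f x + f ?y)"
    "norm (q - x) = norm (x - ?y) / 2" "norm (q - ?y) = norm (x - ?y) / 2"
    using image_midpoint[OF assms(3,4)] .
  have "norm (x - ?y) = 2 * t * norm e" using \<open>t > 0\<close> by simp
  also have "\<dots> \<le> 2 * t" using extreme_point_cball_norm_le[OF e] \<open>t > 0\<close> by simp
  finally have le: "norm (x - ?y) / 2 \<le> t" by simp
  define d where "d = (1 / t) *\<^sub>R (q - (x + t *\<^sub>R e))"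
  have "e + d = (1 / t) *\<^sub>R (q - x)"
    using \<open>t > 0\<close> by (simp add: d_def algebra_simps)
  moreover have "e - d = (1 / t) *\<^sub>R (?y - q)"
  proof -
    have "?y - q = t *\<^sub>R e - (q - (x + t *\<^sub>R e))" by (simp add: algebra_simps flip: scaleR_add_left)
    then show ?thesis using \<open>t > 0\<close> by (simp only: d_def scaleR_diff_right) simp
  qed
  ultimately have "norm (e + d) \<le> 1" "norm (e - d) \<le> 1"
    using le q(3,4) \<open>t > 0\<close> norm_minus_commute[of ?y q] by simp_all
  then have "d = 0" by (rule extreme_point_of_cballD[OF e])
  then have "q = x + t *\<^sub>R e" using \<open>t > 0\<close> by (simp add: d_def)
  then have "2 *\<^sub>R f (x + t *\<^sub>R e) = f x + f ?y" using q(2) by simp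
  then show ?thesis by (simp add: algebra_simps scaleR_2)
qed

text \<open>
  The mixed second difference of \<open>f\<close> at \<open>x\<close> and \<open>y\<close> with increment \<open>v\<close>.
\<close>

definition second_diff :: "'a \<Rightarrow> 'a \<Rightarrow> 'a \<Rightarrow> 'b"
  where "second_diff v x y = (f (y + v) - f y) - (f (x + v) - f x)"

lemma second_diff_add:
  "second_diff (v + w) x y = second_diff v x y + second_diff w (x + v) (y + v)"
  by (simp add: second_diff_def algebra_simps)

lemma norm_second_diff_le:
  assumes "x \<in> K" "y \<in> K" "x + v \<in> K" "y + v \<in> K"
  shows "norm (second_diff v x y) \<le> 2 * norm (y - x)"
proof -
  have "second_diff v x y = (f (y + v) - f (x + v)) - (f y - f x)"
    by (simp add: second_diff_def)
  also have "norm \<dots> \<le> norm (f (y + v) - f (x + v)) + norm (f y - f x)"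
    by (rule norm_triangle_ineq4)
  also have "\<dots> = 2 * norm (y - x)" using assms by (simp add: norm_isom)
  finally show ?thesis .
qed

text \<open>
  In an extreme direction the second difference doubles when the increment doubles, while it never
  exceeds \<open>2 * norm (y - x)\<close>; so it is proportionally small for a small increment.
\<close>

lemma second_diff_extreme:
  assumes e: "e extreme_point_of cball 0 1" and K: "cball x0 (4 * \<delta>) \<subseteq> K"
    and s: "0 \<le> s" "s \<le> \<delta>" and "0 < \<delta>"
    and x: "x \<in> cball x0 (2 * \<delta>)" and y: "y \<in> cball x0 (2 * \<delta>)"
  shows "norm (second_diff (s *\<^sub>R e) x y) \<le> 4 * s / \<delta> * norm (y - x)"
proof (cases "s = 0")
  case True
  then show ?thesis by (simp add: second_diff_def)
next
  case False
  with s have "s > 0" by simp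
  have inK: "z + r *\<^sub>R e \<in> K" if "z \<in> cball x0 (2 * \<delta>)" "0 \<le> r" "r \<le> \<delta>" for z r
  proof -
    have "norm (r *\<^sub>R e) \<le> \<delta>"
      using that extreme_point_cball_norm_le[OF e] mult_mono[of r \<delta> "norm e" 1] by simp
    moreover have "norm (z - x0) \<le> 2 * \<delta>" using that by (simp add: dist_norm norm_minus_commute)
    moreover have "norm ((z + r *\<^sub>R e) - x0) \<le> norm (z - x0) + norm (r *\<^sub>R e)"
      using norm_triangle_ineq[of "z - x0" "r *\<^sub>R e"] by (simp add: algebra_simps)
    ultimately have "norm ((z + r *\<^sub>R e) - x0) \<le> 4 * \<delta>" using \<open>0 < \<delta>\<close> by linarith
    then show ?thesis
      using K by (auto simp: dist_norm norm_minus_commute)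
  qed
  have double: "second_diff ((2 * r) *\<^sub>R e) x y = 2 *\<^sub>R second_diff (r *\<^sub>R e) x y"
    if "0 < r" "2 * r \<le> \<delta>" for r
    using extreme_direction_midpoint[OF e \<open>0 < r\<close>, of x] extreme_direction_midpoint[OF e \<open>0 < r\<close>, of y]
      inK[OF x, of 0] inK[OF x, of "2 * r"] inK[OF y, of 0] inK[OF y, of "2 * r"] that \<open>0 < \<delta>\<close>
    by (simp add: second_diff_def scaleR_diff_right)
  have iter: "second_diff ((2 ^ n * s) *\<^sub>R e) x y = 2 ^ n *\<^sub>R second_diff (s *\<^sub>R e) x y"
    if "2 ^ n * s \<le> \<delta>" for n
    using that
  proof (induction n)
    case (Suc n)
    have "2 ^ Suc n * s = 2 * (2 ^ n * s)" "0 \<le> 2 ^ n * s" using \<open>s > 0\<close> by simp_all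
    then have "2 ^ n * s \<le> \<delta>" using Suc.prems by linarith
    moreover have "second_diff ((2 * (2 ^ n * s)) *\<^sub>R e) x y = 2 *\<^sub>R second_diff ((2 ^ n * s) *\<^sub>R e) x y"
      using Suc.prems \<open>s > 0\<close> by (intro double) (auto simp: mult.assoc)
    ultimately show ?case using Suc.IH by (simp add: mult.assoc)
  qed simp
  \<comment> \<open>the last doubling of \<open>s\<close> that stays within \<open>\<delta>\<close>\<close>
  obtain n where n: "2 ^ n * s \<le> \<delta>" "\<delta> < 2 ^ Suc n * s"
  proof -
    obtain m where "\<delta> / s < 2 ^ m" using real_arch_pow[of 2 "\<delta> / s"] by auto
    then have m: "\<delta> < 2 ^ m * s" using \<open>s > 0\<close> by (simp add: field_simps)
    define m0 where "m0 = (LEAST m. \<delta> < 2 ^ m * s)"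
    have m0: "\<delta> < 2 ^ m0 * s" unfolding m0_def using m by (rule LeastI)
    moreover have "m0 \<noteq> 0" using m0 s by (intro notI) simp
    then obtain n where "m0 = Suc n" by (cases m0) auto
    moreover from this have "\<not> \<delta> < 2 ^ n * s"
      using not_less_Least[of n "\<lambda>m. \<delta> < 2 ^ m * s"] by (simp add: m0_def)
    ultimately show ?thesis using that[of n] by (simp add: not_less)
  qed
  have "2 ^ n * norm (second_diff (s *\<^sub>R e) x y) = norm (second_diff ((2 ^ n * s) *\<^sub>R e) x y)"
    by (simp add: iter[OF n(1)])
  also have "\<dots> \<le> 2 * norm (y - x)"
    using inK[OF x, of 0] inK[OF y, of 0] inK[OF x, of "2 ^ n * s"] inK[OF y, of "2 ^ n * s"]
      n(1) \<open>s > 0\<close> \<open>0 < \<delta>\<close> by (intro norm_second_diff_le) auto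
  finally have "norm (second_diff (s *\<^sub>R e) x y) \<le> 2 / 2 ^ n * norm (y - x)"
    by (simp add: field_simps)
  also have "\<dots> \<le> 4 * s / \<delta> * norm (y - x)"
  proof (rule mult_right_mono)
    show "2 / 2 ^ n \<le> 4 * s / \<delta>" using n(2) \<open>0 < \<delta>\<close> by (simp add: field_simps)
  qed simp
  finally show ?thesis .
qed

text \<open>
  The estimate passes to the closed convex hull of the extreme points: an increment along a convex
  combination is taken in two steps, and the balls for \<open>x\<close> and \<open>y\<close> shrink with \<open>s\<close> to leave room
  for the intermediate points.
\<close>

lemma second_diff_hull:
  assumes K: "cball x0 (4 * \<delta>) \<subseteq> K" and "0 < \<delta>"
    and w: "w \<in> closure (convex hull {e. e extreme_point_of cball 0 1})"
    and s: "0 \<le> s" "s \<le> \<delta>"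
    and x: "x \<in> cball x0 (2 * \<delta> - s)" and y: "y \<in> cball x0 (2 * \<delta> - s)"
  shows "norm (second_diff (s *\<^sub>R w) x y) \<le> 4 * s / \<delta> * norm (y - x)"
proof -
  define Q where "Q = {w. norm w \<le> 1 \<and> (\<forall>s\<in>{0..\<delta>}. \<forall>x\<in>cball x0 (2 * \<delta> - s). \<forall>y\<in>cball x0 (2 * \<delta> - s).
     norm (second_diff (s *\<^sub>R w) x y) \<le> 4 * s / \<delta> * norm (y - x))}"
  have shift: "x + s *\<^sub>R w \<in> cball x0 r" if "x \<in> cball x0 (r - s)" "0 \<le> s" "norm w \<le> 1" for x w :: 'a and s r
  proof -
    have "norm (s *\<^sub>R w) \<le> s" using that mult_left_mono[of "norm w" 1 s] by simp
    then show ?thesis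
      using that norm_triangle_ineq[of "x - x0" "s *\<^sub>R w"]
      by (simp add: dist_norm norm_minus_commute algebra_simps)
  qed
  have "{e. e extreme_point_of cball 0 1} \<subseteq> Q"
    using second_diff_extreme[OF _ K _ _ \<open>0 < \<delta>\<close>] extreme_point_cball_norm_le
    by (auto simp: Q_def)
  moreover have "convex Q"
    unfolding convex_alt
  proof (intro ballI allI impI)
    fix w w' and t :: real assume w: "w \<in> Q" "w' \<in> Q" and t: "0 \<le> t \<and> t \<le> 1"
    show "(1 - t) *\<^sub>R w + t *\<^sub>R w' \<in> Q"
      unfolding Q_def
    proof (intro CollectI conjI ballI)
      have "(1 - t) *\<^sub>R w + t *\<^sub>R w' \<in> cball 0 1"
        using w t by (intro convexD_alt convex_cball) (auto simp: Q_def)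
      then show "norm ((1 - t) *\<^sub>R w + t *\<^sub>R w') \<le> 1" by simp
    next
      fix s x y assume s: "s \<in> {0..\<delta>}" and x: "x \<in> cball x0 (2 * \<delta> - s)" and y: "y \<in> cball x0 (2 * \<delta> - s)"
      let ?a = "s * (1 - t)" and ?b = "s * t"
      have ab: "0 \<le> ?a" "0 \<le> ?b" "?a \<le> s" "?b \<le> s" "?a + ?b = s"
        using s t by (auto simp: algebra_simps mult_left_le)
      have "second_diff (s *\<^sub>R ((1 - t) *\<^sub>R w + t *\<^sub>R w')) x y
          = second_diff (?a *\<^sub>R w) x y + second_diff (?b *\<^sub>R w') (x + ?a *\<^sub>R w) (y + ?a *\<^sub>R w)"
        by (simp add: scaleR_add_right flip: second_diff_add)
      also have "norm \<dots> \<le> 4 * ?a / \<delta> * norm (y - x) + 4 * ?b / \<delta> * norm ((y + ?a *\<^sub>R w) - (x + ?a *\<^sub>R w))"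
      proof (rule norm_triangle_mono)
        show "norm (second_diff (?a *\<^sub>R w) x y) \<le> 4 * ?a / \<delta> * norm (y - x)"
          using w(1) s x y ab unfolding Q_def by fastforce
        have eq: "2 * \<delta> - ?b - ?a = 2 * \<delta> - s" using ab(5) by linarith
        have "x + ?a *\<^sub>R w \<in> cball x0 (2 * \<delta> - ?b)" "y + ?a *\<^sub>R w \<in> cball x0 (2 * \<delta> - ?b)"
          using shift[of _ "2 * \<delta> - ?b" ?a w, unfolded eq] x y w(1) ab(1) unfolding Q_def by blast+
        then show "norm (second_diff (?b *\<^sub>R w') (x + ?a *\<^sub>R w) (y + ?a *\<^sub>R w))
           \<le> 4 * ?b / \<delta> * norm ((y + ?a *\<^sub>R w) - (x + ?a *\<^sub>R w))"
          using w(2) s ab unfolding Q_def by fastforce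
      qed
      also have "\<dots> = 4 * s / \<delta> * norm (y - x)"
        using \<open>0 < \<delta>\<close> by (simp add: field_simps)
      finally show "norm (second_diff (s *\<^sub>R ((1 - t) *\<^sub>R w + t *\<^sub>R w')) x y) \<le> 4 * s / \<delta> * norm (y - x)" .
    qed
  qed
  ultimately have hullQ: "convex hull {e. e extreme_point_of cball 0 1} \<subseteq> Q"
    by (rule hull_minimal)
  have "closed Q"
    unfolding closed_sequential_limits
  proof (intro allI impI)
    fix W l assume "(\<forall>n. W n \<in> Q) \<and> W \<longlonglongrightarrow> l"
    then have WQ: "\<And>n. W n \<in> Q" and W: "W \<longlonglongrightarrow> l" by auto
    have W1: "norm (W n) \<le> 1" for n using WQ by (simp add: Q_def)
    have l1: "norm l \<le> 1"
      by (rule Lim_norm_ubound[OF _ W]) (auto simp: W1)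
    show "l \<in> Q"
      unfolding Q_def
    proof (intro CollectI conjI ballI l1)
      fix s x y assume s: "s \<in> {0..\<delta>}" and x: "x \<in> cball x0 (2 * \<delta> - s)" and y: "y \<in> cball x0 (2 * \<delta> - s)"
      have lim: "(\<lambda>n. f (z + s *\<^sub>R W n)) \<longlonglongrightarrow> f (z + s *\<^sub>R l)"
        if "z \<in> cball x0 (2 * \<delta> - s)" for z
      proof -
        have inK: "z + s *\<^sub>R w \<in> K" if "norm w \<le> 1" for w
        proof -
          have "cball x0 (2 * \<delta>) \<subseteq> K" using K \<open>0 < \<delta>\<close> by (auto simp: subset_iff)
          then show ?thesis using shift[OF \<open>z \<in> _\<close> _ that] s by auto
        qed
        have "(\<lambda>n. dist (z + s *\<^sub>R W n) (z + s *\<^sub>R l)) \<longlonglongrightarrow> dist (z + s *\<^sub>R l) (z + s *\<^sub>R l)"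
          by (intro tendsto_intros W)
        then show ?thesis
          unfolding tendsto_dist_iff[of "\<lambda>n. f (z + s *\<^sub>R W n)"]
          by (simp add: isom[OF inK[OF W1] inK[OF l1]])
      qed
      have "(\<lambda>n. norm (second_diff (s *\<^sub>R W n) x y)) \<longlonglongrightarrow> norm (second_diff (s *\<^sub>R l) x y)"
        unfolding second_diff_def by (intro tendsto_intros lim x y)
      then show "norm (second_diff (s *\<^sub>R l) x y) \<le> 4 * s / \<delta> * norm (y - x)"
        using WQ s x y by (intro LIMSEQ_le_const2) (auto simp: Q_def)
    qed
  qed
  then have "closure (convex hull {e. e extreme_point_of cball 0 1}) \<subseteq> Q"
    using hullQ by (rule closure_minimal[rotated])
  with w s x y show ?thesis unfolding Q_def by auto
qed

text \<open>
  If the hull contains a ball, every small increment obeys the estimate.  Morally, \<open>f\<close> is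
  continuously differentiable with Lipschitz derivative.
\<close>

lemma second_diff_lipschitz:
  assumes hull: "cball 0 \<rho> \<subseteq> closure (convex hull {e::'a. e extreme_point_of cball 0 1})"
    and "0 < \<rho>" "0 < \<delta>" and K: "cball x0 (4 * \<delta>) \<subseteq> K" and v: "norm v \<le> \<rho> * \<delta>"
    and x: "x \<in> cball x0 \<delta>" and y: "y \<in> cball x0 \<delta>"
  shows "norm (second_diff v x y) \<le> 4 / (\<rho> * \<delta>) * norm v * norm (y - x)"
proof (cases "v = 0")
  case True
  then show ?thesis by (simp add: second_diff_def)
next
  case False
  define s where "s = norm v / \<rho>"
  define w where "w = (1 / s) *\<^sub>R v"
  have s: "0 < s" "s \<le> \<delta>" using v False \<open>0 < \<rho>\<close> by (auto simp: s_def field_simps)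
  have "norm w = \<rho>" using False \<open>0 < \<rho>\<close> by (simp add: w_def s_def)
  then have "w \<in> closure (convex hull {e. e extreme_point_of cball 0 1})"
    using hull by auto
  then have "norm (second_diff (s *\<^sub>R w) x y) \<le> 4 * s / \<delta> * norm (y - x)"
    using K s x y \<open>0 < \<delta>\<close> by (intro second_diff_hull) auto
  moreover have "s *\<^sub>R w = v" using s by (simp add: w_def)
  moreover have "4 * s / \<delta> = 4 / (\<rho> * \<delta>) * norm v" by (simp add: s_def)
  ultimately show ?thesis by simp
qed

text \<open>
  Near an interior point the image of \<open>f\<close> is closed under completing parallelograms.  The fourth
  vertex \<open>w\<close> is found by Newton's iteration: with \<open>\<mu> x y\<close> the preimage of the midpoint of
  \<open>f x\<close> and \<open>f y\<close>, the equation \<open>f w + f z = f a + f b\<close> says \<open>\<mu> w z = \<mu> a b\<close>.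
  By the estimate on second differences the map \<open>\<mu>\<close> differs from the algebraic midpoint to second order, so the iteration
  contracts a small ball of the domain.
\<close>

lemma image_parallelogram:
  assumes hull: "cball 0 \<rho> \<subseteq> closure (convex hull {e::'a. e extreme_point_of cball 0 1})"
    and \<rho>: "0 < \<rho>" "\<rho> \<le> 1" and "0 < \<delta>" and K: "cball x0 (4 * \<delta>) \<subseteq> K"
    and \<eta>: "\<eta> = \<rho> * \<delta> / 128"
    and abz: "a \<in> cball x0 \<eta>" "b \<in> cball x0 \<eta>" "z \<in> cball x0 \<eta>"
  shows "\<exists>w\<in>K. f w = f a + f b - f z"
proof -
  define c where "c = 4 / (\<rho> * \<delta>)"
  define \<kappa> where "\<kappa> = \<rho> * \<delta> / 32"
  have "\<rho> * \<delta> > 0" "\<rho> * \<delta> \<le> \<delta>" using \<rho> \<open>0 < \<delta>\<close> by (auto simp: mult_le_cancel_right1)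
  then have c\<kappa>: "c * \<kappa> = 1/8" "0 < \<kappa>" "\<kappa> \<le> \<rho> * \<delta>" "2 * \<kappa> \<le> \<delta>" "\<eta> = \<kappa> / 4" "0 < c" "0 < \<eta>"
    by (auto simp: c_def \<kappa>_def \<eta> zero_less_mult_iff)
  have lip: "norm (second_diff v x y) \<le> c * norm v * norm (y - x)"
    if "norm v \<le> \<kappa>" "x \<in> cball x0 (2 * \<kappa>)" "y \<in> cball x0 (2 * \<kappa>)" for v x y
    unfolding c_def using that c\<kappa>(3,4) \<rho> \<open>0 < \<delta>\<close> K
    by (intro second_diff_lipschitz[OF hull]) auto
  have inK: "x \<in> K" if "x \<in> cball x0 (2 * \<kappa>)" for x
    using that K c\<kappa>(4) \<open>0 < \<delta>\<close> by (auto simp: subset_iff)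
  have small: "x \<in> cball x0 \<kappa>" "x \<in> cball x0 (2 * \<kappa>)" if "x \<in> cball x0 \<eta>" for x
    using that c\<kappa> by auto
  have ball: "norm (x - y) \<le> 2 * r" if "x \<in> cball x0 r" "y \<in> cball x0 r" for x y r
    using that dist_triangle_le[of x x0 y "2 * r"] by (simp add: dist_norm norm_minus_commute)
  define \<mu> where "\<mu> x y = (SOME q. q \<in> K \<and> f q = (1/2) *\<^sub>R (f x + f y))" for x y
  have \<mu>: "\<mu> x y \<in> K" "f (\<mu> x y) = (1/2) *\<^sub>R (f x + f y)" "norm (\<mu> x y - x) = norm (x - y) / 2"
    if xyK: "x \<in> K" "y \<in> K" for x y
  proof -
    obtain q where "q \<in> K" "f q = (1/2) *\<^sub>R (f x + f y)"
      using image_midpoint[OF xyK] by blast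
    then have "\<exists>q. q \<in> K \<and> f q = (1/2) *\<^sub>R (f x + f y)" by blast
    then have *: "\<mu> x y \<in> K \<and> f (\<mu> x y) = (1/2) *\<^sub>R (f x + f y)"
      unfolding \<mu>_def by (rule someI_ex)
    then show "\<mu> x y \<in> K" "f (\<mu> x y) = (1/2) *\<^sub>R (f x + f y)" by auto
    have "f (\<mu> x y) - f x = (1/2) *\<^sub>R (f y - f x)"
      unfolding conjunct2[OF *] by (simp add: algebra_simps flip: scaleR_add_left)
    then have "norm (f (\<mu> x y) - f x) = norm (f y - f x) / 2" by simp
    then show "norm (\<mu> x y - x) = norm (x - y) / 2"
      using norm_isom[of "\<mu> x y" x] norm_isom[of y x] * that by (simp add: norm_minus_commute)
  qed
  have \<mu>_ball: "\<mu> x y \<in> cball x0 (2 * \<kappa>)" if "x \<in> cball x0 \<kappa>" "y \<in> cball x0 \<kappa>" for x y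
  proof -
    have "x \<in> K" "y \<in> K" using that c\<kappa>(2) by (auto intro!: inK)
    then have "norm (\<mu> x y - x) \<le> \<kappa>" using \<mu>(3)[of x y] ball[OF that] by simp
    then show ?thesis
      using that(1) dist_triangle_le[of x0 x "\<mu> x y" "2 * \<kappa>"] by (simp add: dist_norm norm_minus_commute)
  qed
  have mid: "norm (x + y - 2 *\<^sub>R \<mu> x y) \<le> c / 4 * (norm (x - y))\<^sup>2"
    if xy: "x \<in> cball x0 \<kappa>" "y \<in> cball x0 \<kappa>" for x y
  proof -
    define v where "v = (1/2) *\<^sub>R (x - y)"
    have xyK: "x \<in> K" "y \<in> K" using that c\<kappa>(2) by (auto intro!: inK)
    have "norm v \<le> \<kappa>" using ball[OF xy] by (simp add: v_def)
    have yv: "y + v = (1 - 1/2) *\<^sub>R y + (1/2) *\<^sub>R x"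
      by (simp add: v_def algebra_simps flip: scaleR_add_left)
    have yvv: "y + v + v = x" by (simp add: v_def add.assoc flip: scaleR_add_left)
    have "y + v \<in> cball x0 \<kappa>"
      unfolding yv using xy by (intro convexD_alt convex_cball) auto
    then have yvb: "y + v \<in> cball x0 (2 * \<kappa>)" "y \<in> cball x0 (2 * \<kappa>)" using xy c\<kappa>(2) by auto
    have "x + y - 2 *\<^sub>R \<mu> x y = 2 *\<^sub>R (y + v - \<mu> x y)"
      using yvv by (simp add: scaleR_2 algebra_simps)
    then have "norm (x + y - 2 *\<^sub>R \<mu> x y) = 2 * norm (y + v - \<mu> x y)"
      by simp
    also have "norm (y + v - \<mu> x y) = norm (f (y + v) - f (\<mu> x y))"
      using norm_isom inK[OF yvb(1)] \<mu>(1)[OF xyK] by metis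
    also have "2 * \<dots> = norm (2 *\<^sub>R (f (y + v) - f (\<mu> x y)))" by simp
    also have "2 *\<^sub>R (f (y + v) - f (\<mu> x y)) = - second_diff v y (y + v)"
      using arg_cong[OF yvv, of f]
      by (simp add: second_diff_def \<mu>(2)[OF xyK] algebra_simps scaleR_2)
    also have "norm \<dots> \<le> c * norm v * norm (y + v - y)"
      using lip[OF \<open>norm v \<le> \<kappa>\<close> yvb(2,1)] by simp
    also have "\<dots> = c / 4 * (norm (x - y))\<^sup>2"
      by (simp add: v_def power2_eq_square)
    finally show ?thesis .
  qed
  define m where "m = \<mu> a b"
  define \<Theta> where "\<Theta> w = w - 2 *\<^sub>R (\<mu> w z - m)" for w
  have "\<exists>!w. w \<in> cball x0 \<kappa> \<and> \<Theta> w = w"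
  proof (rule Banach_fix[where c = "1/4"])
    show "complete (cball x0 \<kappa>)" by (simp add: complete_eq_closed)
    show "cball x0 \<kappa> \<noteq> {}" using c\<kappa>(2) by simp
    show "\<Theta> ` cball x0 \<kappa> \<subseteq> cball x0 \<kappa>"
    proof (intro image_subsetI)
      fix w assume w: "w \<in> cball x0 \<kappa>"
      have sq: "c / 4 * n\<^sup>2 \<le> \<kappa> / 8" if "0 \<le> n" "n \<le> 2 * \<kappa>" for n
      proof -
        have "n\<^sup>2 \<le> (2 * \<kappa>)\<^sup>2" using that by (intro power_mono) auto
        then have "c / 4 * n\<^sup>2 \<le> c / 4 * (2 * \<kappa>)\<^sup>2" using c\<kappa>(6) by (intro mult_left_mono) auto
        also have "\<dots> = (c * \<kappa>) * \<kappa>" by (simp add: power2_eq_square)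
        finally show ?thesis by (simp add: c\<kappa>(1))
      qed
      have 1: "norm (w + z - 2 *\<^sub>R \<mu> w z) \<le> \<kappa> / 8"
        using mid[OF w small(1)[OF abz(3)]] sq[OF _ ball[OF w small(1)[OF abz(3)]]] by simp
      have 2: "norm (a + b - 2 *\<^sub>R m) \<le> \<kappa> / 32"
      proof -
        have "(norm (a - b))\<^sup>2 \<le> (2 * \<eta>)\<^sup>2" using ball[OF abz(1,2)] by (intro power_mono) auto
        then have "c / 4 * (norm (a - b))\<^sup>2 \<le> c / 4 * (2 * \<eta>)\<^sup>2" using c\<kappa>(6) by (intro mult_left_mono) auto
        also have "\<dots> = (c * \<kappa>) * \<kappa> / 16" by (simp add: power2_eq_square c\<kappa>(5))
        also have "\<dots> \<le> \<kappa> / 32" using c\<kappa>(2) by (simp add: c\<kappa>(1))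
        finally show ?thesis
          using mid[OF small(1)[OF abz(1)] small(1)[OF abz(2)]] by (simp add: m_def)
      qed
      have "\<Theta> w - x0 = (w + z - 2 *\<^sub>R \<mu> w z) - (a + b - 2 *\<^sub>R m) + (a - x0) + (b - x0) - (z - x0)"
        by (simp add: \<Theta>_def algebra_simps)
      also have "norm \<dots> \<le> norm (w + z - 2 *\<^sub>R \<mu> w z) + norm (a + b - 2 *\<^sub>R m)
          + norm (a - x0) + norm (b - x0) + norm (z - x0)"
        by (intro order_trans[OF norm_triangle_ineq4] order_trans[OF norm_triangle_ineq]
            add_mono order_refl norm_triangle_ineq4)
      also have "\<dots> \<le> \<kappa> / 8 + \<kappa> / 32 + \<eta> + \<eta> + \<eta>"
        using 1 2 abz by (intro add_mono) (auto simp: dist_norm norm_minus_commute)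
      also have "\<dots> \<le> \<kappa>" using c\<kappa> by simp
      finally show "\<Theta> w \<in> cball x0 \<kappa>" by (simp add: dist_norm norm_minus_commute)
    qed
    fix w w' assume ww: "w \<in> cball x0 \<kappa>" "w' \<in> cball x0 \<kappa>"
    define v where "v = (1/2) *\<^sub>R (w - w')"
    have v: "norm v \<le> \<kappa>" "norm v = norm (w - w') / 2" using ball[OF ww] by (simp_all add: v_def)
    have zb: "z \<in> cball x0 \<kappa>" using small abz by auto
    have wK: "w \<in> K" "w' \<in> K" "z \<in> K" using ww zb c\<kappa>(2) by (auto intro!: inK)
    let ?q = "\<mu> w z" and ?q' = "\<mu> w' z"
    have qb: "?q \<in> cball x0 (2 * \<kappa>)" "?q' \<in> cball x0 (2 * \<kappa>)" using \<mu>_ball ww zb by auto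
    have w'v: "w' + v = (1 - 1/2) *\<^sub>R w' + (1/2) *\<^sub>R w"
      by (simp add: v_def algebra_simps flip: scaleR_add_left)
    have w'vv: "w' + v + v = w" by (simp add: v_def add.assoc flip: scaleR_add_left)
    have "w' + v \<in> cball x0 \<kappa>"
      unfolding w'v using ww by (intro convexD_alt convex_cball) auto
    then have wb: "w' + v \<in> cball x0 (2 * \<kappa>)" "w' \<in> cball x0 (2 * \<kappa>)" using ww c\<kappa>(2) by auto
    have q'vK: "?q' + v \<in> K"
    proof -
      have "norm (?q' + v - x0) \<le> norm (?q' - x0) + norm v"
        using norm_triangle_ineq[of "?q' - x0" v] by (simp add: algebra_simps)
      also have "\<dots> \<le> 4 * \<delta>" using qb(2) v(1) c\<kappa>(2,4) by (simp add: dist_norm norm_minus_commute)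
      finally show ?thesis using K by (auto simp: dist_norm norm_minus_commute)
    qed
    have "2 *\<^sub>R (f (?q' + v) - f ?q) = 2 *\<^sub>R second_diff v w' ?q' - second_diff v w' (w' + v)"
      using arg_cong[OF w'vv, of f]
      by (simp add: second_diff_def \<mu>(2)[OF wK(1,3)] \<mu>(2)[OF wK(2,3)] algebra_simps scaleR_2)
    then have "2 * norm (f (?q' + v) - f ?q) = norm (2 *\<^sub>R second_diff v w' ?q' - second_diff v w' (w' + v))"
      by (metis norm_scaleR abs_numeral)
    also have "\<dots> \<le> norm (2 *\<^sub>R second_diff v w' ?q') + norm (second_diff v w' (w' + v))"
      by (rule norm_triangle_ineq4)
    also have "\<dots> \<le> 2 * (c * norm v * norm (?q' - w')) + c * norm v * norm (w' + v - w')"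
      using lip[OF v(1) wb(2) qb(2)] lip[OF v(1) wb(2) wb(1)] by simp
    also have "norm (?q' - w') = norm (w' - z) / 2" by (rule \<mu>(3)[OF wK(2,3)])
    also have "2 * (c * norm v * (norm (w' - z) / 2)) + c * norm v * norm (w' + v - w')
       = c * norm v * (norm (w' - z) + norm v)" by (simp add: algebra_simps)
    also have "\<dots> \<le> c * norm v * (2 * \<kappa> + \<kappa>)"
      using ball[OF ww(2) zb] v(1) c\<kappa>(6) by (intro mult_left_mono add_mono) auto
    also have "\<dots> = 3 * (c * \<kappa>) * norm v" by (simp add: algebra_simps)
    also have "\<dots> = 3 / 16 * norm (w - w')" by (simp add: c\<kappa>(1) v(2))
    finally have *: "2 * norm (f (?q' + v) - f ?q) \<le> 3 / 16 * norm (w - w')" .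
    have "\<Theta> w - \<Theta> w' = 2 *\<^sub>R (?q' + v - ?q)"
      by (simp add: \<Theta>_def v_def algebra_simps)
    then have "norm (\<Theta> w - \<Theta> w') = 2 * norm (?q' + v - ?q)" by simp
    also have "\<dots> \<le> 3 / 16 * norm (w - w')"
      using * norm_isom[OF q'vK \<mu>(1)[OF wK(1,3)]] by simp
    also have "\<dots> \<le> 1 / 4 * norm (w - w')" by simp
    finally show "dist (\<Theta> w) (\<Theta> w') \<le> 1/4 * dist w w'" by (simp add: dist_norm)
  qed auto
  then obtain w where w: "w \<in> cball x0 \<kappa>" "\<Theta> w = w" by blast
  have K': "w \<in> K" "z \<in> K" "a \<in> K" "b \<in> K" using w abz small c\<kappa>(2) by (auto intro!: inK)
  have "\<mu> w z = \<mu> a b" using w(2) by (simp add: \<Theta>_def m_def)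
  then have "(1/2) *\<^sub>R (f w + f z) = (1/2) *\<^sub>R (f a + f b)"
    using \<mu>(2)[of w z] \<mu>(2)[of a b] K' by simp
  then have "f w + f z = f a + f b" by (simp only: scaleR_cancel_left) simp
  then have "f w = f a + f b - f z" by (simp add: algebra_simps)
  then show ?thesis using K' by blast
qed

text \<open>
  The map \<open>R\<close> that \<open>z \<mapsto> f a + f b - f z\<close> induces on the domain, composed with the reflection in the
  midpoint \<open>c\<close> of \<open>a\<close> and \<open>b\<close>, is an isometry of the set of metric midpoints of \<open>a\<close> and \<open>b\<close>.  It
  therefore fixes \<open>c\<close>, which says \<open>2 f c = f a + f b\<close>.
\<close>

lemma local_midpoint:
  assumes hull: "cball 0 \<rho> \<subseteq> closure (convex hull {e::'a. e extreme_point_of cball 0 1})"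
    and \<rho>: "0 < \<rho>" "\<rho> \<le> 1" and "0 < \<delta>" and K: "cball x0 (4 * \<delta>) \<subseteq> K"
    and ab: "a \<in> cball x0 (\<rho> * \<delta> / 256)" "b \<in> cball x0 (\<rho> * \<delta> / 256)"
  shows "f ((1/2) *\<^sub>R (a + b)) = (1/2) *\<^sub>R (f a + f b)"
proof -
  define \<eta> where "\<eta> = \<rho> * \<delta> / 128"
  define h where "h = dist a b / 2"
  define S where "S = {z. dist z a = h \<and> dist z b = h}"
  define c where "c = (1/2) *\<^sub>R (a + b)"
  have "\<rho> * \<delta> > 0" "\<rho> * \<delta> \<le> \<delta>" using \<rho> \<open>0 < \<delta>\<close> by (auto simp: mult_le_cancel_right1)
  then have \<eta>: "0 < \<eta>" "\<eta> \<le> 4 * \<delta>" "\<rho> * \<delta> / 256 = \<eta> / 2" using \<open>0 < \<delta>\<close> by (auto simp: \<eta>_def)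
  have "dist a b \<le> \<eta>" using ab dist_triangle_le[of a x0 b \<eta>] \<eta> by (simp add: dist_commute)
  then have S\<eta>: "z \<in> cball x0 \<eta>" if "z \<in> S" for z
    using that ab dist_triangle_le[of x0 a z \<eta>] \<eta> by (auto simp: S_def h_def dist_commute)
  have ab\<eta>: "a \<in> cball x0 \<eta>" "b \<in> cball x0 \<eta>" using ab \<eta> by auto
  have inK: "z \<in> K" if "z \<in> cball x0 \<eta>" for z
    using that K \<eta>(2) by auto
  define R where "R z = (SOME w. w \<in> K \<and> f w = f a + f b - f z)" for z
  have R: "R z \<in> K \<and> f (R z) = f a + f b - f z" if "z \<in> S" for z
  proof -
    have "\<exists>w. w \<in> K \<and> f w = f a + f b - f z"
      using image_parallelogram[OF hull \<rho> \<open>0 < \<delta>\<close> K \<eta>_def ab\<eta> S\<eta>[OF that]] by blast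
    then show ?thesis unfolding R_def by (rule someI_ex)
  qed
  have RS: "R z \<in> S" if z: "z \<in> S" for z
  proof -
    have zK: "z \<in> K" "a \<in> K" "b \<in> K" using inK S\<eta>[OF z] ab\<eta> by auto
    have "dist (R z) a = norm (f (R z) - f a)" using norm_isom[of "R z" a] R[OF z] zK by (simp add: dist_norm)
    also have "\<dots> = norm (f b - f z)" using R[OF z] by simp
    also have "\<dots> = h" using norm_isom[of b z] zK z by (simp add: S_def dist_norm norm_minus_commute)
    finally have 1: "dist (R z) a = h" .
    have "dist (R z) b = norm (f (R z) - f b)" using norm_isom[of "R z" b] R[OF z] zK by (simp add: dist_norm)
    also have "\<dots> = norm (f a - f z)" using R[OF z] by simp
    also have "\<dots> = h" using norm_isom[of a z] zK z by (simp add: S_def dist_norm norm_minus_commute)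
    finally show ?thesis using 1 by (simp add: S_def)
  qed
  have RR: "R (R z) = z" if z: "z \<in> S" for z
  proof -
    have "f (R (R z)) = f z" using R[OF z] R[OF RS[OF z]] by simp
    then have "norm (R (R z) - z) = 0"
      using norm_isom[of "R (R z)" z] R[OF RS[OF z]] inK[OF S\<eta>[OF z]] by simp
    then show ?thesis by simp
  qed
  have Rd: "dist (R x) (R y) = dist x y" if "x \<in> S" "y \<in> S" for x y
  proof -
    have "dist (R x) (R y) = dist (f (R x)) (f (R y))"
      using isom[of "R x" "R y"] R[OF that(1)] R[OF that(2)] by metis
    also have "\<dots> = dist (f x) (f y)"
      using R[OF that(1)] R[OF that(2)] by (simp add: dist_norm norm_minus_commute)
    also have "\<dots> = dist x y" using that by (intro isom inK S\<eta>)
    finally show ?thesis .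
  qed
  have flip: "2 *\<^sub>R c - z \<in> S" if "z \<in> S" for z
    using that by (auto simp: S_def c_def dist_norm norm_minus_commute)
  have "c \<in> S"
  proof -
    have "c - a = (1/2) *\<^sub>R (b - a)" "c - b = (1/2) *\<^sub>R (a - b)"
      by (simp_all add: c_def algebra_simps flip: scaleR_add_left)
    then show ?thesis by (simp add: S_def h_def dist_norm norm_minus_commute)
  qed
  define g where "g = R \<circ> (\<lambda>z. 2 *\<^sub>R c - z)"
  have "g c = c"
  proof (rule isometry_fixes_centre[where S = S])
    show "bounded S" by (rule bounded_subset[of "cball x0 \<eta>"]) (use S\<eta> in auto)
    show "c \<in> S" "\<And>z. z \<in> S \<Longrightarrow> 2 *\<^sub>R c - z \<in> S" by fact+
    have "bij_betw (\<lambda>z. 2 *\<^sub>R c - z) S S"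
      by (rule bij_betw_byWitness[where f' = "\<lambda>z. 2 *\<^sub>R c - z"]) (auto simp: flip)
    moreover have "bij_betw R S S"
      by (rule bij_betw_byWitness[where f' = R]) (auto simp: RR RS)
    ultimately show "bij_betw g S S" unfolding g_def by (rule bij_betw_trans)
    show "dist (g x) (g y) = dist x y" if "x \<in> S" "y \<in> S" for x y
      using Rd[OF flip flip] that by (simp add: g_def dist_norm norm_minus_commute)
  qed
  then have "R c = c" by (simp add: g_def scaleR_2)
  then have "f c = f a + f b - f c" using R[OF \<open>c \<in> S\<close>] by simp
  then have "2 *\<^sub>R f c = f a + f b" by (simp add: scaleR_2 algebra_simps)
  then have "(1/2) *\<^sub>R (2 *\<^sub>R f c) = (1/2) *\<^sub>R (f a + f b)" by simp
  then show ?thesis by (simp add: c_def)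
qed

end

text \<open>
  A continuous map that preserves midpoints of nearby points is affine.  On a segment the radius can
  be chosen uniformly; the values on a fine equidistant grid then form an arithmetic progression.
\<close>

lemma affine_map_onI_local_midpoint:
  fixes f :: "'a::real_normed_vector \<Rightarrow> 'b::real_normed_vector"
  assumes "open U" "convex U" and cont: "continuous_on U f"
    and "0 < k" and loc: "\<And>x0 \<delta> a b. 0 < \<delta> \<Longrightarrow> cball x0 \<delta> \<subseteq> U \<Longrightarrow>
      a \<in> cball x0 (k * \<delta>) \<Longrightarrow> b \<in> cball x0 (k * \<delta>) \<Longrightarrow>
      f ((1/2) *\<^sub>R (a + b)) = (1/2) *\<^sub>R (f a + f b)"
  shows "affine_map_on U f"
  unfolding affine_map_on_def
proof (intro ballI)
  fix a b and t :: real assume ab: "a \<in> U" "b \<in> U" and t: "t \<in> {0..1}"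
  define p where "p s = (1 - s) *\<^sub>R a + s *\<^sub>R b" for s :: real
  have pU: "p s \<in> U" if "0 \<le> s" "s \<le> 1" for s
    unfolding p_def using ab that \<open>convex U\<close> by (intro convexD_alt) auto
  have pd: "p s - p s' = (s - s') *\<^sub>R (b - a)" for s s' by (simp add: p_def algebra_simps)
  have cont_p: "continuous_on UNIV p" unfolding p_def by (intro continuous_intros)
  have "compact (p ` {0..1})"
    using cont_p by (intro compact_continuous_image continuous_on_subset[OF cont_p]) auto
  moreover have "p ` {0..1} \<subseteq> U" using pU by auto
  ultimately obtain \<epsilon> where "\<epsilon> > 0" and \<epsilon>: "(\<Union>x\<in>p ` {0..1}. cball x \<epsilon>) \<subseteq> U"
    using compact_subset_open_imp_cball_epsilon_subset \<open>open U\<close> by metis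
  have ball: "cball (p s) \<epsilon> \<subseteq> U" if "0 \<le> s" "s \<le> 1" for s
    using \<epsilon> that by fastforce
  obtain r where "r > 0" and mid: "\<And>s a b. 0 \<le> s \<Longrightarrow> s \<le> 1 \<Longrightarrow> a \<in> cball (p s) r \<Longrightarrow> b \<in> cball (p s) r
      \<Longrightarrow> f ((1/2) *\<^sub>R (a + b)) = (1/2) *\<^sub>R (f a + f b)"
  proof -
    have "k * \<epsilon> > 0" using \<open>0 < k\<close> \<open>\<epsilon> > 0\<close> by simp
    moreover have "f ((1/2) *\<^sub>R (a + b)) = (1/2) *\<^sub>R (f a + f b)"
      if "0 \<le> s" "s \<le> 1" "a \<in> cball (p s) (k * \<epsilon>)" "b \<in> cball (p s) (k * \<epsilon>)" for s a b
      by (rule loc[OF \<open>\<epsilon> > 0\<close> ball[OF that(1,2)] that(3,4)])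
    ultimately show ?thesis by (rule that)
  qed
  have grid: "f (p (real j / real N)) = f a + (real j / real N) *\<^sub>R (f b - f a)"
    if N: "norm (b - a) / r < real N" "j \<le> N" for j N
  proof -
    have "0 \<le> norm (b - a) / r" using \<open>r > 0\<close> by simp
    with N have "N > 0" by linarith
    define G where "G j = f (p (real j / real N))" for j
    have step: "G (j + 2) - G (j + 1) = G (j + 1) - G j" if "j + 2 \<le> N" for j
    proof -
      let ?s = "real (j + 1) / real N"
      have s: "0 \<le> ?s" "?s \<le> 1" using that \<open>N > 0\<close> by (auto simp: field_simps)
      have h: "norm ((1 / real N) *\<^sub>R (b - a)) \<le> r"
      proof -
        have "norm ((1 / real N) *\<^sub>R (b - a)) = norm (b - a) / real N" by simp
        also have "\<dots> \<le> r" using N \<open>N > 0\<close> \<open>r > 0\<close> by (simp add: field_simps)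
        finally show ?thesis .
      qed
      have "p ?s - p (real (j + 2) / real N) = (- 1 / real N) *\<^sub>R (b - a)"
        "p ?s - p (real j / real N) = (1 / real N) *\<^sub>R (b - a)"
        unfolding pd by (simp_all add: add_divide_distrib flip: diff_divide_distrib)
      then have "p (real (j + 2) / real N) \<in> cball (p ?s) r" "p (real j / real N) \<in> cball (p ?s) r"
        using h by (simp_all add: dist_norm)
      moreover have "p ?s = (1/2) *\<^sub>R (p (real (j + 2) / real N) + p (real j / real N))"
      proof -
        have "p (real (j + 2) / real N) - p ?s = p ?s - p (real j / real N)"
          unfolding pd by (simp add: add_divide_distrib)
        then have "2 *\<^sub>R p ?s = p (real (j + 2) / real N) + p (real j / real N)"
          by (simp add: scaleR_2 algebra_simps)
        then have "(1/2) *\<^sub>R (2 *\<^sub>R p ?s) = (1/2) *\<^sub>R (p (real (j + 2) / real N) + p (real j / real N))"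
          by (simp only:)
        then show ?thesis by simp
      qed
      ultimately have "f (p ?s) = (1/2) *\<^sub>R (G (j + 2) + G j)"
        using mid[OF s] by (simp add: G_def)
      then have "2 *\<^sub>R G (j + 1) = G (j + 2) + G j" by (simp add: G_def)
      then show ?thesis by (simp add: scaleR_2 algebra_simps)
    qed
    have diff: "G (Suc j) - G j = G 1 - G 0" if "Suc j \<le> N" for j
      using that by (induction j) (use step in auto)
    have G: "G j = G 0 + real j *\<^sub>R (G 1 - G 0)" if "j \<le> N" for j
      using that
    proof (induction j)
      case (Suc j)
      have "G (Suc j) = G j + (G 1 - G 0)" using diff[OF Suc.prems] by (metis add.commute diff_add_cancel)
      also have "G j = G 0 + real j *\<^sub>R (G 1 - G 0)" using Suc by simp
      also have "\<dots> + (G 1 - G 0) = G 0 + real (Suc j) *\<^sub>R (G 1 - G 0)"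
        by (simp add: scaleR_add_left)
      finally show ?case .
    qed simp
    have ends: "G 0 = f a" "G N = f b" using \<open>N > 0\<close> by (simp_all add: G_def p_def)
    have "real N *\<^sub>R (G 1 - G 0) = f b - f a" using G[of N] ends by simp
    then have "(1 / real N) *\<^sub>R (real N *\<^sub>R (G 1 - G 0)) = (1 / real N) *\<^sub>R (f b - f a)"
      by (simp only:)
    then have "G 1 - G 0 = (1 / real N) *\<^sub>R (f b - f a)"
      using \<open>N > 0\<close> by simp
    then show ?thesis using G[OF \<open>j \<le> N\<close>] ends(1) by (simp add: G_def)
  qed
  define s where "s n = real (nat \<lfloor>t * real n\<rfloor>) / real n" for n
  have s_le: "0 \<le> s n \<and> s n \<le> t" and s_ge: "n > 0 \<Longrightarrow> t - 1 / real n \<le> s n" for n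
  proof -
    have *: "real (nat \<lfloor>t * real n\<rfloor>) \<le> t * real n" "t * real n - 1 \<le> real (nat \<lfloor>t * real n\<rfloor>)"
      using t by (simp_all add: of_nat_nat)
    show "0 \<le> s n \<and> s n \<le> t"
      using *(1) t by (cases "n = 0") (auto simp: s_def field_simps)
    show "t - 1 / real n \<le> s n" if "n > 0"
    proof -
      have "t - 1 / real n = (t * real n - 1) / real n" using that by (simp add: diff_divide_distrib)
      also have "\<dots> \<le> s n" unfolding s_def using *(2) by (rule divide_right_mono) simp
      finally show ?thesis .
    qed
  qed
  have "s \<longlonglongrightarrow> t"
  proof (rule tendsto_sandwich)
    show "(\<lambda>n. t - 1 / real n) \<longlonglongrightarrow> t"
      using tendsto_diff[OF tendsto_const lim_1_over_n, of t] by simp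
    show "\<forall>\<^sub>F n in sequentially. t - 1 / real n \<le> s n"
      using eventually_gt_at_top[of 0] by eventually_elim (rule s_ge)
  qed (use s_le in auto)
  have s01: "s n \<in> {0..1}" for n using s_le[of n] t by auto
  have "(\<lambda>n. f (p (s n))) \<longlonglongrightarrow> f (p t)"
  proof (rule continuous_on_tendsto_compose[OF cont])
    have "isCont p t" using cont_p by (simp add: continuous_on_eq_continuous_at)
    then show "(\<lambda>n. p (s n)) \<longlonglongrightarrow> p t" using \<open>s \<longlonglongrightarrow> t\<close> by (rule isCont_tendsto_compose)
  qed (use pU t s01 in auto)
  moreover have "(\<lambda>n. f (p (s n))) \<longlonglongrightarrow> f a + t *\<^sub>R (f b - f a)"
  proof (rule Lim_transform_eventually)
    show "(\<lambda>n. f a + s n *\<^sub>R (f b - f a)) \<longlonglongrightarrow> f a + t *\<^sub>R (f b - f a)"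
      by (intro tendsto_intros \<open>s \<longlonglongrightarrow> t\<close>)
    obtain N0 where "norm (b - a) / r < real N0" using reals_Archimedean2 by blast
    then have "\<forall>\<^sub>F n in sequentially. norm (b - a) / r < real n"
      by (intro eventually_sequentiallyI[of N0]) linarith
    then show "\<forall>\<^sub>F n in sequentially. f a + s n *\<^sub>R (f b - f a) = f (p (s n))"
    proof eventually_elim
      case (elim n)
      have "t * real n \<le> real n" using t by (simp add: mult_left_le_one_le)
      then have "nat \<lfloor>t * real n\<rfloor> \<le> n" by linarith
      from grid[OF elim this] show ?case by (simp add: s_def)
    qed
  qed
  ultimately have "f (p t) = f a + t *\<^sub>R (f b - f a)" by (rule LIMSEQ_unique)
  then show "f ((1 - t) *\<^sub>R a + t *\<^sub>R b) = (1 - t) *\<^sub>R f a + t *\<^sub>R f b"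
    by (simp add: p_def algebra_simps)
qed

lemma convex_subset_closure_interior:
  fixes K :: "'a::real_normed_vector set"
  assumes "convex K" "interior K \<noteq> {}"
  shows "K \<subseteq> closure (interior K)"
proof
  fix x assume "x \<in> K"
  obtain a \<epsilon> where \<epsilon>: "0 < \<epsilon>" "ball a \<epsilon> \<subseteq> K"
    using assms(2) by (auto simp: mem_interior)
  have inner: "x + s *\<^sub>R (a - x) \<in> interior K" if s: "0 < s" "s \<le> 1" for s
    unfolding mem_interior
  proof (intro exI conjI subsetI)
    show "s * \<epsilon> > 0" using s \<epsilon> by simp
    fix y assume y: "y \<in> ball (x + s *\<^sub>R (a - x)) (s * \<epsilon>)"
    define b where "b = a + (1 / s) *\<^sub>R (y - (x + s *\<^sub>R (a - x)))"
    have "norm ((1 / s) *\<^sub>R (y - (x + s *\<^sub>R (a - x)))) < \<epsilon>"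
    proof -
      have "norm ((1 / s) *\<^sub>R (y - (x + s *\<^sub>R (a - x)))) = norm (y - (x + s *\<^sub>R (a - x))) / s"
        using s by simp
      also have "\<dots> < \<epsilon>"
        using y s by (simp only: mem_ball dist_norm norm_minus_commute) (simp add: divide_less_eq mult.commute)
      finally show ?thesis .
    qed
    then have "b \<in> K" using \<epsilon>(2) by (auto simp: b_def dist_norm)
    then have "(1 - s) *\<^sub>R x + s *\<^sub>R b \<in> K"
      using s \<open>x \<in> K\<close> by (intro convexD_alt[OF \<open>convex K\<close>]) auto
    moreover have "(1 - s) *\<^sub>R x + s *\<^sub>R b = y"
      using s by (simp add: b_def algebra_simps)
    ultimately show "y \<in> K" by simp
  qed
  show "x \<in> closure (interior K)"
    unfolding closure_sequential
  proof (intro exI conjI allI)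
    show "x + (1 / real (Suc n)) *\<^sub>R (a - x) \<in> interior K" for n
      by (intro inner) auto
    have "(\<lambda>n. x + (1 / real (Suc n)) *\<^sub>R (a - x)) \<longlonglongrightarrow> x + 0 *\<^sub>R (a - x)"
      by (intro tendsto_intros LIMSEQ_Suc[OF lim_1_over_n])
    then show "(\<lambda>n. x + (1 / real (Suc n)) *\<^sub>R (a - x)) \<longlonglongrightarrow> x" by simp
  qed
qed

lemma (in isometry_onto_convex) affine_map_on_if_hull:
  assumes hull: "cball 0 \<rho> \<subseteq> closure (convex hull {e::'a. e extreme_point_of cball 0 1})"
    and \<rho>: "0 < \<rho>" "\<rho> \<le> 1" and int: "interior K \<noteq> {}"
  shows "affine_map_on K f"
proof -
  have cont: "continuous_on K f"
    unfolding continuous_on_iff using isom by (metis)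
  have "affine_map_on (interior K) f"
  proof (rule affine_map_onI_local_midpoint)
    show "convex (interior K)" using convex_dom by (rule convex_interior)
    show "continuous_on (interior K) f" using cont interior_subset by (rule continuous_on_subset)
    show "0 < \<rho> / 1024" using \<rho>(1) by simp
    fix x0 a b \<delta>
    assume \<delta>: "0 < (\<delta>::real)" "cball x0 \<delta> \<subseteq> interior K"
      and ab: "a \<in> cball x0 (\<rho> / 1024 * \<delta>)" "b \<in> cball x0 (\<rho> / 1024 * \<delta>)"
    have "cball x0 (4 * (\<delta> / 4)) \<subseteq> K" using \<delta>(2) interior_subset[of K] by auto
    from local_midpoint[OF hull \<rho> _ this, of a b] \<delta>(1) ab
    show "f ((1/2) *\<^sub>R (a + b)) = (1/2) *\<^sub>R (f a + f b)" by simp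
  qed simp
  show ?thesis
    unfolding affine_map_on_def
  proof (intro ballI)
    fix x y and t :: real assume xy: "x \<in> K" "y \<in> K" and t: "t \<in> {0..1}"
    have "x \<in> closure (interior K)" "y \<in> closure (interior K)"
      using xy convex_subset_closure_interior[OF convex_dom int] by auto
    then obtain X Y where X: "\<And>n. X n \<in> interior K" "X \<longlonglongrightarrow> x" and Y: "\<And>n. Y n \<in> interior K" "Y \<longlonglongrightarrow> y"
      by (auto simp: closure_sequential)
    have XK: "X n \<in> K" "Y n \<in> K" for n using X Y interior_subset by auto
    let ?c = "\<lambda>x y. (1 - t) *\<^sub>R x + t *\<^sub>R y"
    have "(\<lambda>n. f (?c (X n) (Y n))) \<longlonglongrightarrow> f (?c x y)"
      using t xy XK
      by (intro continuous_on_tendsto_compose[OF cont] tendsto_intros X Y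
          convexD_alt[OF convex_dom] always_eventually allI) auto
    moreover have "f (?c (X n) (Y n)) = ?c (f (X n)) (f (Y n))" for n
      using \<open>affine_map_on (interior K) f\<close> X Y t by (simp add: affine_map_on_def)
    moreover have "(\<lambda>n. ?c (f (X n)) (f (Y n))) \<longlonglongrightarrow> ?c (f x) (f y)"
      using xy XK
      by (intro tendsto_intros continuous_on_tendsto_compose[OF cont X(2)] continuous_on_tendsto_compose[OF cont Y(2)]
          always_eventually allI) auto
    ultimately show "f (?c x y) = ?c (f x) (f y)"
      by (auto intro: LIMSEQ_unique)
  qed
qed

text \<open>
  The theorem of Mori and Ozawa.
\<close>

theorem strong_mankiewicz_if_hull:
  fixes K :: "'a::banach set"
  assumes hull: "cball 0 \<rho> \<subseteq> closure (convex hull {e::'a. e extreme_point_of cball 0 1})" "0 < \<rho>"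
    and K: "convex_body K"
  shows "strong_mankiewicz TYPE('b::real_normed_vector) K"
  unfolding strong_mankiewicz_def
proof (intro conjI allI impI)
  show "convex K" using K by (simp add: convex_body_def)
  fix L :: "'b set" and f assume "convex L" "surj_isometry K L f"
  then interpret isometry_onto_convex K f
    using \<open>convex K\<close> by unfold_locales (auto simp: surj_isometry_def)
  have "cball 0 (min \<rho> 1) \<subseteq> closure (convex hull {e::'a. e extreme_point_of cball 0 1})"
    using hull(1) by auto
  then show "affine_map_on K f"
    using hull(2) K by (intro affine_map_on_if_hull[of "min \<rho> 1"]) (auto simp: convex_body_def)
qed

lemma affine_map_on_UNIV_ball:
  assumes F: "affine_map_on UNIV (F :: 'a::real_normed_vector \<Rightarrow> 'b::real_normed_vector)"
    and r: "norm x \<le> r" "1 \<le> r"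
  shows "F x = F 0 + r *\<^sub>R (F ((1 / r) *\<^sub>R x) - F 0)"
proof -
  have "F ((1 - 1 / r) *\<^sub>R 0 + (1 / r) *\<^sub>R x) = (1 - 1 / r) *\<^sub>R F 0 + (1 / r) *\<^sub>R F x"
    using F r unfolding affine_map_on_def by fastforce
  then have "F ((1 / r) *\<^sub>R x) - F 0 = (1 / r) *\<^sub>R (F x - F 0)"
    by (simp add: algebra_simps)
  then show ?thesis using r by simp
qed

text \<open>
  An affine isometry on the unit ball is extended by homogeneity from its value at the centre.
\<close>

lemma affine_isometry_extension:
  fixes f :: "'a::banach \<Rightarrow> 'b::real_normed_vector"
  assumes aff: "affine_map_on (cball 0 1) f"
    and isom: "\<And>x y. x \<in> cball 0 1 \<Longrightarrow> y \<in> cball 0 1 \<Longrightarrow> dist (f x) (f y) = dist x y"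
  shows "\<exists>!F. affine_map_on UNIV F \<and> (\<exists>S. affine S \<and> closed S \<and> surj_isometry UNIV S F)
    \<and> (\<forall>x\<in>cball 0 1. F x = f x)"
proof -
  define g where "g r x = f 0 + r *\<^sub>R (f ((1 / r) *\<^sub>R x) - f 0)" for r and x :: 'a
  define F where "F x = g (max 1 (norm x)) x" for x
  have g_eq: "g r x = g s x" if "norm x \<le> r" "1 \<le> r" "r \<le> s" for r s x
  proof -
    have "f ((1 - r / s) *\<^sub>R 0 + (r / s) *\<^sub>R ((1 / r) *\<^sub>R x)) = (1 - r / s) *\<^sub>R f 0 + (r / s) *\<^sub>R f ((1 / r) *\<^sub>R x)"
    proof -
      have "(0::'a) \<in> cball 0 1" "(1 / r) *\<^sub>R x \<in> cball 0 1" "r / s \<in> {0..1}" using that by auto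
      then show ?thesis using aff unfolding affine_map_on_def by blast
    qed
    then have "f ((1 / s) *\<^sub>R x) - f 0 = (r / s) *\<^sub>R (f ((1 / r) *\<^sub>R x) - f 0)"
      using that by (simp add: algebra_simps)
    then show ?thesis using that by (simp add: g_def)
  qed
  have F_eq: "F x = g r x" if "norm x \<le> r" "1 \<le> r" for r x
    unfolding F_def using that by (intro g_eq) auto
  have Ff: "F x = f x" if "x \<in> cball 0 1" for x
    using F_eq[of x 1] that by (simp add: g_def)
  have Faff: "F ((1 - t) *\<^sub>R x + t *\<^sub>R y) = (1 - t) *\<^sub>R F x + t *\<^sub>R F y" if t: "t \<in> {0..1}" for x y t
  proof -
    define r where "r = max 1 (max (norm x) (norm y))"
    have r: "1 \<le> r" "norm x \<le> r" "norm y \<le> r" by (auto simp: r_def)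
    have "(1 - t) *\<^sub>R x + t *\<^sub>R y \<in> cball 0 r"
      using r t by (intro convexD_alt convex_cball) auto
    then have z: "norm ((1 - t) *\<^sub>R x + t *\<^sub>R y) \<le> r" by simp
    have "f ((1 - t) *\<^sub>R ((1 / r) *\<^sub>R x) + t *\<^sub>R ((1 / r) *\<^sub>R y))
        = (1 - t) *\<^sub>R f ((1 / r) *\<^sub>R x) + t *\<^sub>R f ((1 / r) *\<^sub>R y)"
    proof -
      have "(1 / r) *\<^sub>R x \<in> cball 0 1" "(1 / r) *\<^sub>R y \<in> cball 0 1" using r by auto
      then show ?thesis using aff t unfolding affine_map_on_def by blast
    qed
    moreover have "(1 / r) *\<^sub>R ((1 - t) *\<^sub>R x + t *\<^sub>R y) = (1 - t) *\<^sub>R ((1 / r) *\<^sub>R x) + t *\<^sub>R ((1 / r) *\<^sub>R y)"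
      by (simp add: scaleR_add_right mult.commute)
    ultimately show ?thesis
      unfolding F_eq[OF z r(1)] F_eq[OF r(2,1)] F_eq[OF r(3,1)] g_def
      by (simp only:) (simp add: algebra_simps)
  qed
  have Fisom: "dist (F x) (F y) = dist x y" for x y
  proof -
    define r where "r = max 1 (max (norm x) (norm y))"
    have r: "1 \<le> r" "norm x \<le> r" "norm y \<le> r" by (auto simp: r_def)
    have "F x - F y = r *\<^sub>R (f ((1 / r) *\<^sub>R x) - f ((1 / r) *\<^sub>R y))"
      unfolding F_eq[OF r(2,1)] F_eq[OF r(3,1)] g_def by (simp add: algebra_simps)
    then have "dist (F x) (F y) = r * dist (f ((1 / r) *\<^sub>R x)) (f ((1 / r) *\<^sub>R y))"
      using r by (simp add: dist_norm)
    also have "\<dots> = r * dist ((1 / r) *\<^sub>R x) ((1 / r) *\<^sub>R y)"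
      using r by (subst isom) auto
    also have "\<dots> = r * norm ((1 / r) *\<^sub>R (x - y))" by (simp only: dist_norm scaleR_diff_right)
    finally show ?thesis using r by (simp add: dist_norm)
  qed
  have Fall: "F ((1 - t) *\<^sub>R x + t *\<^sub>R y) = (1 - t) *\<^sub>R F x + t *\<^sub>R F y" for x y t
  proof -
    \<comment> \<open>solves the affine identity with weight \<open>r\<close> in \<open>[0, 1]\<close> for the outer point \<open>z\<close>\<close>
    have solve: "F z = (1 - s) *\<^sub>R F a + s *\<^sub>R F b"
      if "0 < r" "r \<le> 1" "b = (1 - r) *\<^sub>R a + r *\<^sub>R z" "s = 1 / r" for a b z r s
    proof -
      have "F b = (1 - r) *\<^sub>R F a + r *\<^sub>R F z" using Faff[of r a z] that by simp
      then have "(1 / r) *\<^sub>R F b = (1 / r) *\<^sub>R ((1 - r) *\<^sub>R F a) + F z" using that by (simp add: scaleR_add_right)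
      also have "(1 / r) *\<^sub>R ((1 - r) *\<^sub>R F a) = (s - 1) *\<^sub>R F a"
        using that by (simp add: diff_divide_distrib)
      finally show ?thesis using that(4) by (simp add: algebra_simps)
    qed
    consider "t \<in> {0..1}" | "t > 1" | "t < 0" by fastforce
    then show ?thesis
    proof cases
      case 1
      then show ?thesis by (rule Faff)
    next
      case 2
      have "(1 / t) *\<^sub>R ((1 - t) *\<^sub>R x + t *\<^sub>R y) = (1 / t - 1) *\<^sub>R x + y"
        using 2 by (simp add: scaleR_add_right diff_divide_distrib)
      then have "y = (1 - 1 / t) *\<^sub>R x + (1 / t) *\<^sub>R ((1 - t) *\<^sub>R x + t *\<^sub>R y)"
        by (simp add: scaleR_diff_left)
      from solve[OF _ _ this] show ?thesis using 2 by simp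
    next
      case 3
      define r where "r = 1 / (1 - t)"
      have r: "0 < r" "r \<le> 1" "r * (1 - t) = 1" "r * t = r - 1" "1 - t = 1 / r"
        using 3 by (auto simp: r_def field_simps)
      have "r *\<^sub>R ((1 - t) *\<^sub>R x + t *\<^sub>R y) = x + (r - 1) *\<^sub>R y"
        by (simp add: scaleR_add_right r(3,4))
      then have "x = (1 - r) *\<^sub>R y + r *\<^sub>R ((1 - t) *\<^sub>R x + t *\<^sub>R y)"
        by (simp add: scaleR_diff_left)
      from solve[OF r(1,2) this r(5)]
      have "F ((1 - t) *\<^sub>R x + t *\<^sub>R y) = (1 - (1 - t)) *\<^sub>R F y + (1 - t) *\<^sub>R F x" .
      then show ?thesis by simp
    qed
  qed
  have affS: "affine (range F)"
    unfolding affine_alt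
  proof (intro ballI allI)
    fix p q and t :: real assume "p \<in> range F" "q \<in> range F"
    then obtain x y where "p = F x" "q = F y" by auto
    then show "(1 - t) *\<^sub>R p + t *\<^sub>R q \<in> range F" using Fall[of t x y] by (metis rangeI)
  qed
  have clS: "closed (range F)"
    unfolding closed_sequential_limits
  proof (intro allI impI)
    fix Y l assume "(\<forall>n. Y n \<in> range F) \<and> Y \<longlonglongrightarrow> l"
    then have Y: "Y \<longlonglongrightarrow> l" and "\<forall>n. \<exists>x. Y n = F x" by (auto simp: image_iff)
    from choice[OF this(2)] obtain X where X: "\<And>n. Y n = F (X n)" by blast
    have "Cauchy X"
      using LIMSEQ_imp_Cauchy[OF Y] by (simp add: Cauchy_def X Fisom)
    then obtain x where "X \<longlonglongrightarrow> x" by (meson Cauchy_convergent convergent_def)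
    then have "(\<lambda>n. dist (X n) x) \<longlonglongrightarrow> 0" by (rule tendsto_dist_iff[THEN iffD1])
    then have "(\<lambda>n. dist (Y n) (F x)) \<longlonglongrightarrow> 0" by (simp add: X Fisom)
    then have "Y \<longlonglongrightarrow> F x" by (rule tendsto_dist_iff[THEN iffD2])
    then show "l \<in> range F" using LIMSEQ_unique[OF Y] by auto
  qed
  have surjS: "surj_isometry UNIV (range F) F" by (simp add: surj_isometry_def Fisom)
  have affF: "affine_map_on UNIV F" using Faff unfolding affine_map_on_def by blast
  have unique: "G = F" if G: "affine_map_on UNIV G" "\<forall>x\<in>cball 0 1. G x = f x" for G
  proof
    fix x :: 'a
    define r where "r = max 1 (norm x)"
    have r: "norm x \<le> r" "1 \<le> r" by (auto simp: r_def)
    have "(1 / r) *\<^sub>R x \<in> cball 0 1" "0 \<in> cball (0::'a) 1" using r by simp_all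
    then have Gf: "G ((1 / r) *\<^sub>R x) = f ((1 / r) *\<^sub>R x)" "G 0 = f 0" using G(2) by blast+
    have "G x = G 0 + r *\<^sub>R (G ((1 / r) *\<^sub>R x) - G 0)"
      by (rule affine_map_on_UNIV_ball[OF G(1) r])
    also have "\<dots> = F x" by (simp only: Gf) (simp only: F_def g_def r_def)
    finally show "G x = F x" .
  qed
  show ?thesis
  proof (rule ex1I[where a = F])
    show "affine_map_on UNIV F \<and> (\<exists>S. affine S \<and> closed S \<and> surj_isometry UNIV S F) \<and> (\<forall>x\<in>cball 0 1. F x = f x)"
      using affS clS surjS affF Ff by blast
  next
    fix G assume G: "affine_map_on UNIV G \<and> (\<exists>S. affine S \<and> closed S \<and> surj_isometry UNIV S G) \<and> (\<forall>x\<in>cball 0 1. G x = f x)"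
    show "G = F" by (rule unique[OF conjunct1[OF G] conjunct2[OF conjunct2[OF G]]])
  qed
qed

section \<open>Complex normed spaces and operator exponentials\<close>

lemma scaleC_zero_right [simp]: "scaleC c (0::'a::complex_normed_vector) = 0"
  using norm_scaleC[of c "0::'a"] by simp

lemma scaleC_zero_left [simp]: "scaleC 0 (x::'a::complex_normed_vector) = 0"
  using norm_scaleC[of 0 x] by simp

lemma scaleC_one [simp]: "scaleC 1 (x::'a::complex_normed_vector) = x"
  using scaleC_of_real[of 1 x] by simp

lemma scaleC_minus_right: "scaleC c (- x) = - scaleC c (x::'a::complex_normed_vector)"
  using scaleC_add_right[of c x "- x"] by (simp add: eq_neg_iff_add_eq_0 add.commute)

lemma scaleC_minus_left: "scaleC (- c) x = - scaleC c (x::'a::complex_normed_vector)"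
  using scaleC_add_left[of c "- c" x] by (simp add: eq_neg_iff_add_eq_0 add.commute)

lemma scaleC_diff_right: "scaleC c (x - y) = scaleC c x - scaleC c (y::'a::complex_normed_vector)"
  using scaleC_add_right[of c x "- y"] by (simp add: scaleC_minus_right)

lemma scaleC_scaleR: "scaleC c (r *\<^sub>R x) = r *\<^sub>R scaleC c (x::'a::complex_normed_vector)"
  by (simp add: scaleC_scaleC mult.commute flip: scaleC_of_real)

lemma bounded_linear_scaleC: "bounded_linear (scaleC c :: 'a::complex_normed_vector \<Rightarrow> 'a)"
  by (rule bounded_linear_intro[where K = "cmod c"])
    (auto simp: scaleC_add_right scaleC_scaleR norm_scaleC mult.commute)

lemma bounded_linear_scaleC_left: "bounded_linear (\<lambda>c. scaleC c (x::'a::complex_normed_vector))"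
proof (rule bounded_linear_intro[where K = "norm x"])
  show "scaleC (r *\<^sub>R c) x = r *\<^sub>R scaleC c x" for r c
    by (simp add: scaleR_conv_of_real scaleC_scaleC flip: scaleC_of_real)
qed (auto simp: scaleC_add_left norm_scaleC mult.commute)

lemma clinear_linear: "clinear f \<Longrightarrow> linear f"
  unfolding clinear_def by (intro linearI) (auto simp flip: scaleC_of_real)

lemma bounded_clinear_bounded_linear: "bounded_clinear f \<Longrightarrow> bounded_linear f"
  unfolding bounded_clinear_def
  by (auto simp: clinear_linear bounded_linear_def bounded_linear_axioms_def)

lemma bounded_clinear_scaleC: "bounded_clinear f \<Longrightarrow> f (scaleC c x) = scaleC c (f x)"
  by (simp add: bounded_clinear_def clinear_def)

lemma bounded_clinear_funpow:
  fixes f :: "'a::complex_normed_vector \<Rightarrow> 'a"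
  assumes "bounded_clinear f"
  shows "(f ^^ n) (x + y) = (f ^^ n) x + (f ^^ n) y" "(f ^^ n) (scaleC c x) = scaleC c ((f ^^ n) x)"
  using assms by (induction n) (simp_all add: bounded_clinear_def clinear_def)

text \<open>
  The Banach algebra of bounded real-linear operators, in which the general theory of \<open>exp\<close> applies.
  A complex coordinate is adjoined to each operator: it makes the norm of the unit equal to one also
  when the space is trivial, and lets complex scalars embed as a copy of \<open>\<complex>\<close>.
\<close>

context
  notes [[typedef_overloaded]]
begin

datatype 'a oper = Oper (oper_fun: "'a::real_normed_vector \<Rightarrow>\<^sub>L 'a") (oper_scalar: complex)

end

instantiation oper :: (real_normed_vector) ring_1
begin

definition "0 = Oper 0 0"
definition "1 = Oper id_blinfun 1"
definition "- a = Oper (- oper_fun a) (- oper_scalar a)"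
definition "a + b = Oper (oper_fun a + oper_fun b) (oper_scalar a + oper_scalar b)"
definition "a - b = Oper (oper_fun a - oper_fun b) (oper_scalar a - oper_scalar b)"
definition "a * b = Oper (oper_fun a o\<^sub>L oper_fun b) (oper_scalar a * oper_scalar b)"

instance
  by standard (auto simp: zero_oper_def one_oper_def uminus_oper_def plus_oper_def
      minus_oper_def times_oper_def algebra_simps intro!: oper.expand blinfun_eqI
      simp: blinfun.add_left blinfun.add_right blinfun.diff_left blinfun.minus_left)

end

instantiation oper :: (real_normed_vector) real_normed_algebra_1
begin

definition "r *\<^sub>R a = Oper (r *\<^sub>R oper_fun a) (r *\<^sub>R oper_scalar a)"
definition "norm a = max (norm (oper_fun a)) (norm (oper_scalar a))"
definition "sgn a = inverse (norm a) *\<^sub>R (a :: 'a oper)"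
definition "dist a b = norm (a - b :: 'a oper)"
definition "uniformity = (INF e\<in>{0<..}. principal {(x :: 'a oper, y). dist x y < e})"
definition "open (U :: 'a oper set) \<longleftrightarrow> (\<forall>x\<in>U. eventually (\<lambda>(x', y). x' = x \<longrightarrow> y \<in> U) uniformity)"

instance
proof
  fix a b :: "'a oper" and r s :: real
  show "r *\<^sub>R (a + b) = r *\<^sub>R a + r *\<^sub>R b" "(r + s) *\<^sub>R a = r *\<^sub>R a + s *\<^sub>R a"
    "r *\<^sub>R s *\<^sub>R a = (r * s) *\<^sub>R a" "1 *\<^sub>R a = a"
    by (auto simp: scaleR_oper_def plus_oper_def algebra_simps)
  show "(r *\<^sub>R a) * b = r *\<^sub>R (a * b)" "a * r *\<^sub>R b = r *\<^sub>R (a * b)"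
    by (auto simp: scaleR_oper_def times_oper_def blinfun.scaleR_left blinfun.scaleR_right intro!: blinfun_eqI)
  show "norm a = 0 \<longleftrightarrow> a = 0"
  proof
    assume "norm a = 0"
    then have "norm (oper_fun a) = 0" "norm (oper_scalar a) = 0"
      unfolding norm_oper_def by (smt (verit) norm_ge_zero max.cobounded1 max.cobounded2)+
    then show "a = 0" by (cases a) (simp add: zero_oper_def)
  qed (simp add: norm_oper_def zero_oper_def)
  show "norm (a + b) \<le> norm a + norm b"
    unfolding norm_oper_def plus_oper_def using norm_triangle_ineq[of "oper_fun a" "oper_fun b"]
      norm_triangle_ineq[of "oper_scalar a" "oper_scalar b"] by auto
  show "norm (r *\<^sub>R a) = \<bar>r\<bar> * norm a"
    by (simp add: norm_oper_def scaleR_oper_def max_mult_distrib_left)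
  show "norm (a * b) \<le> norm a * norm b"
  proof -
    have "norm (oper_fun a o\<^sub>L oper_fun b) \<le> norm a * norm b"
      by (rule order_trans[OF norm_blinfun_compose mult_mono]) (auto simp: norm_oper_def le_max_iff_disj)
    moreover have "norm (oper_scalar a * oper_scalar b) \<le> norm a * norm b"
      unfolding norm_mult by (rule mult_mono) (auto simp: norm_oper_def le_max_iff_disj)
    ultimately show ?thesis unfolding norm_oper_def[of "a * b"] by (simp add: times_oper_def)
  qed
  show "norm (1 :: 'a oper) = 1"
    by (simp add: norm_oper_def one_oper_def norm_blinfun_id_le max_absorb2)
qed (rule sgn_oper_def dist_oper_def uniformity_oper_def open_oper_def)+

end

instance oper :: (banach) banach
proof
  fix X :: "nat \<Rightarrow> 'a oper" assume X: "Cauchy X"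
  have "Cauchy (\<lambda>n. oper_fun (X n))" "Cauchy (\<lambda>n. oper_scalar (X n))"
    using X unfolding Cauchy_def dist_norm norm_oper_def by (fastforce simp: minus_oper_def)+
  then obtain A c where "(\<lambda>n. oper_fun (X n)) \<longlonglongrightarrow> A" "(\<lambda>n. oper_scalar (X n)) \<longlonglongrightarrow> c"
    by (meson Cauchy_convergent convergent_def)
  then have "(\<lambda>n. max (norm (oper_fun (X n) - A)) (norm (oper_scalar (X n) - c))) \<longlonglongrightarrow> max (norm (A - A)) (norm (c - c))"
    by (intro tendsto_intros)
  then have "(\<lambda>n. norm (X n - Oper A c)) \<longlonglongrightarrow> 0"
    by (simp add: norm_oper_def minus_oper_def)
  then have "X \<longlonglongrightarrow> Oper A c" by (simp add: tendsto_norm_zero_iff LIM_zero_iff)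
  then show "convergent X" by (auto simp: convergent_def)
qed

abbreviation oper_apply :: "'a::real_normed_vector oper \<Rightarrow> 'a \<Rightarrow> 'a"
  where "oper_apply a \<equiv> blinfun_apply (oper_fun a)"

lemma oper_apply_simps [simp]:
  "oper_apply (a + b) x = oper_apply a x + oper_apply b x"
  "oper_apply (a - b) x = oper_apply a x - oper_apply b x"
  "oper_apply (- a) x = - oper_apply a x"
  "oper_apply (a * b) x = oper_apply a (oper_apply b x)"
  "oper_apply 1 x = x" "oper_apply 0 x = 0"
  "oper_apply (r *\<^sub>R a) x = r *\<^sub>R oper_apply a x"
  by (simp_all add: plus_oper_def minus_oper_def uminus_oper_def times_oper_def one_oper_def
      zero_oper_def scaleR_oper_def blinfun.bilinear_simps)

lemma norm_oper_apply_le: "norm (oper_apply a x) \<le> norm a * norm x"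
  by (rule order_trans[OF norm_blinfun mult_right_mono]) (auto simp: norm_oper_def)

lemma bounded_linear_oper_apply: "bounded_linear (\<lambda>a. oper_apply a x)"
  by (rule bounded_linear_intro[where K = "norm x"]) (auto simp: norm_oper_apply_le)

lemma bounded_linear_oper_apply_right: "bounded_linear (oper_apply a)"
  by (rule blinfun.bounded_linear_right)

text \<open>
  Multiplication by a complex scalar, as an element of the algebra.  The second coordinate makes
  \<open>cscal\<close> a unital homomorphism.
\<close>

definition cscal :: "complex \<Rightarrow> 'a::complex_normed_vector oper"
  where "cscal c = Oper (Blinfun (scaleC c)) c"

text \<open>
  A bounded operator as an element of the algebra.
\<close>

definition to_oper :: "('a::real_normed_vector \<Rightarrow> 'a) \<Rightarrow> 'a oper"
  where "to_oper f = Oper (Blinfun f) 0"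

lemma cscal_apply [simp]: "oper_apply (cscal c) x = scaleC c x"
  by (simp add: cscal_def bounded_linear_Blinfun_apply bounded_linear_scaleC)

lemma to_oper_apply: "bounded_clinear f \<Longrightarrow> oper_apply (to_oper f) x = f x"
  by (simp add: to_oper_def bounded_linear_Blinfun_apply bounded_clinear_bounded_linear)

lemma oper_eqI: "(\<And>x. oper_apply a x = oper_apply b x) \<Longrightarrow> oper_scalar a = oper_scalar b \<Longrightarrow> a = b"
  by (intro oper.expand) (auto intro: blinfun_eqI)

lemma oper_scalar_simps [simp]:
  "oper_scalar (a + b) = oper_scalar a + oper_scalar b" "oper_scalar (a * b) = oper_scalar a * oper_scalar b"
  "oper_scalar 1 = 1" "oper_scalar (cscal c) = c" "oper_scalar (to_oper f) = 0"
  "oper_scalar (r *\<^sub>R a) = r *\<^sub>R oper_scalar a"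
  by (simp_all add: plus_oper_def times_oper_def one_oper_def cscal_def to_oper_def scaleR_oper_def)

lemma cscal_simps:
  "cscal (c + d) = cscal c + cscal d" "cscal (c * d) = cscal c * cscal d" "cscal 1 = 1"
  "cscal (r *\<^sub>R c) = r *\<^sub>R cscal c" "cscal (- c) = - cscal c"
proof -
  show "cscal (r *\<^sub>R c) = r *\<^sub>R cscal c"
    by (intro oper_eqI) (auto simp: linear_cmul[OF bounded_linear.linear[OF bounded_linear_scaleC_left]])
  show "cscal (- c) = - cscal c"
    by (intro oper_eqI) (simp_all only: oper_apply_simps cscal_apply scaleC_minus_left, simp add: cscal_def uminus_oper_def)
qed (auto intro!: oper_eqI simp: scaleC_add_left scaleC_scaleC)

lemma norm_cscal_le: "norm (cscal c :: 'a::complex_normed_vector oper) \<le> cmod c"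
proof -
  have "norm (Blinfun (scaleC c) :: 'a \<Rightarrow>\<^sub>L 'a) \<le> cmod c"
    by (rule norm_blinfun_bound) (auto simp: bounded_linear_Blinfun_apply bounded_linear_scaleC norm_scaleC)
  then show ?thesis by (simp add: norm_oper_def cscal_def)
qed

lemma exp_cscal: "exp (cscal c :: 'a::complex_banach oper) = cscal (exp c)"
proof -
  have lin: "bounded_linear (cscal :: complex \<Rightarrow> 'a oper)"
    by (rule bounded_linear_intro[where K = 1]) (auto simp: cscal_simps norm_cscal_le)
  have pow: "cscal c ^ n = cscal (c ^ n)" for n
    by (induction n) (auto simp: cscal_simps)
  have "(\<lambda>n. cscal (c ^ n /\<^sub>R fact n) :: 'a oper) sums cscal (exp c)"
    by (rule bounded_linear.sums[OF lin exp_converges])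
  then have "(\<lambda>n. (cscal c :: 'a oper) ^ n /\<^sub>R fact n) sums cscal (exp c)"
    by (simp add: pow cscal_simps(4))
  then show ?thesis using exp_converges sums_unique2 by blast
qed

lemma cscal_commute: 
  assumes "bounded_clinear f"
  shows "cscal c * to_oper f = to_oper f * cscal c"
  by (intro oper_eqI) (auto simp: to_oper_apply assms bounded_clinear_scaleC)

lemma cscal_commute_cscal: "cscal c * cscal d = cscal d * cscal c"
  by (simp add: mult.commute flip: cscal_simps)

lemma oper_power_apply:
  assumes "bounded_clinear f" "\<And>x. oper_apply a x = f x"
  shows "oper_apply ((cscal z * a) ^ n) x = scaleC (z ^ n) ((f ^^ n) x)"
  by (induction n)
    (auto simp: assms bounded_clinear_scaleC[OF assms(1)] scaleC_scaleC)

lemma op_exp_eq_exp: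
  fixes f :: "'a::complex_banach \<Rightarrow> 'a"
  assumes f: "bounded_clinear f" "\<And>x. oper_apply a x = f x"
  shows "op_exp z f x = oper_apply (exp (cscal z * a)) x"
    and "(\<lambda>n. scaleC (z ^ n / fact n) ((f ^^ n) x)) sums op_exp z f x"
    and "summable (\<lambda>n. norm (scaleC (z ^ n / fact n) ((f ^^ n) x)))"
proof -
  let ?a = "cscal z * a"
  have eq: "oper_apply (?a ^ n /\<^sub>R fact n) x = scaleC (z ^ n / fact n) ((f ^^ n) x)" for n
  proof -
    have "z ^ n / fact n = complex_of_real (inverse (fact n)) * z ^ n" by (simp add: field_simps)
    then show ?thesis by (simp add: oper_power_apply[OF f] scaleC_scaleC flip: scaleC_of_real)
  qed
  have "(\<lambda>n. oper_apply (?a ^ n /\<^sub>R fact n) x) sums oper_apply (exp ?a) x"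
    by (rule bounded_linear.sums[OF bounded_linear_oper_apply exp_converges])
  then have *: "(\<lambda>n. scaleC (z ^ n / fact n) ((f ^^ n) x)) sums oper_apply (exp ?a) x"
    by (simp only: eq)
  then show **: "op_exp z f x = oper_apply (exp ?a) x"
    unfolding op_exp_def by (rule sums_unique[symmetric])
  show "(\<lambda>n. scaleC (z ^ n / fact n) ((f ^^ n) x)) sums op_exp z f x"
    using * by (simp only: **)
  show "summable (\<lambda>n. norm (scaleC (z ^ n / fact n) ((f ^^ n) x)))"
    unfolding eq[symmetric]
  proof (rule summable_comparison_test'[where N = 0])
    show "summable (\<lambda>n. norm (?a ^ n /\<^sub>R fact n) * norm x)"
      by (intro summable_mult2 summable_norm_exp)
    show "norm (norm (oper_apply (?a ^ n /\<^sub>R fact n) x)) \<le> norm (?a ^ n /\<^sub>R fact n) * norm x" for n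
      using norm_oper_apply_le by simp
  qed
qed

lemmas op_exp_sums = op_exp_eq_exp(2)[OF _ to_oper_apply]
lemmas op_exp_summable = op_exp_eq_exp(3)[OF _ to_oper_apply]
lemmas op_exp_to_oper = op_exp_eq_exp(1)[OF _ to_oper_apply]

lemma op_exp_add:
  fixes f :: "'a::complex_banach \<Rightarrow> 'a"
  assumes f: "bounded_clinear f"
  shows "op_exp (z + w) f x = op_exp z f (op_exp w f x)"
proof -
  let ?F = "to_oper f"
  have "cscal z * ?F * (cscal w * ?F) = cscal z * (?F * cscal w) * ?F" by (simp add: mult.assoc)
  also have "\<dots> = cscal (z * w) * (?F * ?F)" by (simp add: mult.assoc cscal_simps flip: cscal_commute[OF f])
  finally have 1: "cscal z * ?F * (cscal w * ?F) = cscal (z * w) * (?F * ?F)" .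
  have "cscal w * ?F * (cscal z * ?F) = cscal w * (?F * cscal z) * ?F" by (simp add: mult.assoc)
  also have "\<dots> = cscal (w * z) * (?F * ?F)" by (simp add: mult.assoc cscal_simps flip: cscal_commute[OF f])
  finally have "exp (cscal z * ?F + cscal w * ?F) = exp (cscal z * ?F) * exp (cscal w * ?F)"
    using 1 by (intro exp_add_commuting) (simp add: mult.commute)
  then show ?thesis by (simp add: op_exp_to_oper[OF f f] cscal_simps distrib_right)
qed

lemma op_exp_0:
  fixes f :: "'a::complex_banach \<Rightarrow> 'a"
  assumes f: "bounded_clinear f"
  shows "op_exp 0 f x = x"
proof -
  have "cscal 0 * to_oper f = 0" by (intro oper_eqI) (auto simp: zero_oper_def)
  then show ?thesis by (simp add: op_exp_to_oper[OF f f])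
qed

lemma op_exp_minus_cancel:
  fixes f :: "'a::complex_banach \<Rightarrow> 'a"
  assumes f: "bounded_clinear f"
  shows "op_exp z f (op_exp (- z) f x) = x"
  using op_exp_add[OF f, of z "- z" x] op_exp_0[OF f] by simp

lemma bounded_linear_op_exp:
  fixes f :: "'a::complex_banach \<Rightarrow> 'a"
  assumes f: "bounded_clinear f"
  shows "bounded_linear (op_exp z f)"
  using bounded_linear_oper_apply_right by (subst ext[OF op_exp_to_oper[OF f f]])

lemma bounded_clinear_add_scaleC:
  assumes f: "bounded_clinear f"
  shows "bounded_clinear (\<lambda>x. scaleC c x + scaleC d (f x))"
proof -
  obtain K where K: "\<And>x. norm (f x) \<le> norm x * K" using f by (auto simp: bounded_clinear_def)
  have "norm (scaleC c x + scaleC d (f x)) \<le> norm x * (cmod c + cmod d * K)" for x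
    using norm_triangle_ineq[of "scaleC c x" "scaleC d (f x)"] mult_left_mono[OF K[of x] norm_ge_zero[of d]]
    by (simp add: norm_scaleC algebra_simps)
  moreover have "clinear (\<lambda>x. scaleC c x + scaleC d (f x))"
    using f unfolding bounded_clinear_def clinear_def
    by (simp add: scaleC_add_right scaleC_scaleC mult.commute)
  ultimately show ?thesis unfolding bounded_clinear_def by blast
qed

lemma op_exp_add_scaleC:
  fixes f :: "'a::complex_banach \<Rightarrow> 'a"
  assumes f: "bounded_clinear f"
  shows "op_exp z (\<lambda>x. scaleC c x + scaleC d (f x)) x = scaleC (exp (z * c)) (op_exp (z * d) f x)"
proof -
  let ?a = "cscal (z * d) * to_oper f"
  have "op_exp z (\<lambda>x. scaleC c x + scaleC d (f x)) x
      = oper_apply (exp (cscal z * (cscal c + cscal d * to_oper f))) x"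
    by (rule op_exp_eq_exp(1)[OF bounded_clinear_add_scaleC[OF f]]) (simp add: to_oper_apply f)
  also have "cscal z * (cscal c + cscal d * to_oper f) = cscal (z * c) + ?a"
    by (simp add: cscal_simps(1,2) distrib_left mult.assoc)
  also have "exp (cscal (z * c) + ?a) = exp (cscal (z * c)) * exp ?a"
  proof (rule exp_add_commuting)
    have "?a * cscal (z * c) = cscal (z * d) * (to_oper f * cscal (z * c))"
      by (rule mult.assoc)
    also have "to_oper f * cscal (z * c) = cscal (z * c) * to_oper f"
      by (rule cscal_commute[OF f, symmetric])
    finally have "?a * cscal (z * c) = cscal (z * d) * (cscal (z * c) * to_oper f)" .
    then show "cscal (z * c) * ?a = ?a * cscal (z * c)"
      by (simp add: cscal_commute_cscal[of "z * c"] flip: mult.assoc)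
  qed
  finally show ?thesis by (simp add: exp_cscal op_exp_to_oper[OF f f])
qed

lemma op_exp_commute:
  fixes f :: "'a::complex_banach \<Rightarrow> 'a"
  assumes f: "bounded_clinear f" and g: "bounded_clinear g" and comm: "\<And>x. f (g x) = g (f x)"
  shows "op_exp z f (g x) = g (op_exp z f x)"
proof -
  have pow: "(f ^^ n) (g x) = g ((f ^^ n) x)" for n
    by (induction n) (auto simp: comm)
  have "(\<lambda>n. g (scaleC (z ^ n / fact n) ((f ^^ n) x))) sums g (op_exp z f x)"
    by (rule bounded_linear.sums[OF bounded_clinear_bounded_linear[OF g] op_exp_sums[OF f f]])
  then have "(\<lambda>n. scaleC (z ^ n / fact n) ((f ^^ n) (g x))) sums g (op_exp z f x)"
    by (simp add: bounded_clinear_scaleC[OF g] pow)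
  then show ?thesis using op_exp_sums[OF f f] sums_unique2 by blast
qed

lemma norm_op_exp_remainder_le:
  fixes f :: "'a::complex_banach \<Rightarrow> 'a"
  assumes f: "bounded_clinear f" and K: "\<And>x. norm (f x) \<le> K * norm x" and z: "cmod z \<le> 1" and "0 \<le> K"
  shows "norm (op_exp z f x - x - scaleC z (f x)) \<le> (cmod z)\<^sup>2 * exp K * norm x"
proof -
  define a where "a n = scaleC (z ^ n / fact n) ((f ^^ n) x)" for n
  have Kn: "norm ((f ^^ n) x) \<le> K ^ n * norm x" for n
  proof (induction n)
    case (Suc n)
    have "norm ((f ^^ Suc n) x) \<le> K * norm ((f ^^ n) x)" using K by simp
    also have "\<dots> \<le> K * (K ^ n * norm x)" using Suc \<open>0 \<le> K\<close> by (intro mult_left_mono) auto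
    finally show ?case by (simp add: mult.assoc)
  qed simp
  have a: "a sums op_exp z f x" unfolding a_def by (rule op_exp_sums[OF f f])
  have "(\<lambda>n. a (n + 2)) sums (op_exp z f x - (\<Sum>n<2. a n))"
    using a by (rule sums_split_initial_segment)
  moreover have "(\<Sum>n<2. a n) = x + scaleC z (f x)"
    by (simp add: a_def numeral_2_eq_2)
  ultimately have tail: "(\<lambda>n. a (n + 2)) sums (op_exp z f x - x - scaleC z (f x))"
    by (simp add: algebra_simps)
  have bound: "norm (a (n + 2)) \<le> (cmod z)\<^sup>2 * norm x * (K ^ (n + 2) /\<^sub>R fact (n + 2))" for n
  proof -
    have "norm (a (n + 2)) = cmod z ^ n * ((cmod z)\<^sup>2 / fact (n + 2)) * norm ((f ^^ (n + 2)) x)"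
      unfolding a_def norm_scaleC norm_divide norm_power norm_fact by (simp add: power_add power2_eq_square)
    also have "\<dots> \<le> 1 * ((cmod z)\<^sup>2 / fact (n + 2)) * (K ^ (n + 2) * norm x)"
      using z Kn[of "n + 2"] \<open>0 \<le> K\<close> by (intro mult_mono power_le_one) auto
    finally show ?thesis by (simp add: field_simps)
  qed
  have expK: "(\<lambda>n. K ^ (n + 2) /\<^sub>R fact (n + 2)) sums (exp K - (\<Sum>n<2. K ^ n /\<^sub>R fact n))"
    by (rule sums_split_initial_segment[OF exp_converges])
  have "norm (op_exp z f x - x - scaleC z (f x)) = norm (\<Sum>n. a (n + 2))"
    using tail by (simp add: sums_iff)
  also have "\<dots> \<le> (\<Sum>n. (cmod z)\<^sup>2 * norm x * (K ^ (n + 2) /\<^sub>R fact (n + 2)))"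
    using bound by (intro norm_suminf_le summable_mult sums_summable[OF expK])
  also have "\<dots> = (cmod z)\<^sup>2 * norm x * (exp K - (\<Sum>n<2. K ^ n /\<^sub>R fact n))"
    using expK by (simp only: suminf_mult[OF sums_summable[OF expK]] sums_unique[OF expK, symmetric])
  also have "\<dots> \<le> (cmod z)\<^sup>2 * norm x * exp K"
    using \<open>0 \<le> K\<close> by (intro mult_left_mono) (auto simp: numeral_2_eq_2)
  finally show ?thesis by (simp add: mult_ac)
qed

section \<open>Coefficient estimates by averaging over roots of unity\<close>

lemma sum_cis_roots_unity:
  assumes "m > 0"
  shows "(\<Sum>j<m. cis (2 * pi * real_of_int d * real j / real m)) = (if int m dvd d then of_nat m else 0)"
proof -
  define z where "z = cis (2 * pi * real_of_int d / real m)"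
  have pow: "cis (2 * pi * real_of_int d * real j / real m) = z ^ j" for j
    by (simp add: z_def Complex.DeMoivre algebra_simps)
  have "z = 1" if "int m dvd d"
  proof -
    from that obtain k where "d = int m * k" by auto
    then have "2 * pi * real_of_int d / real m = 2 * pi * real_of_int k" using \<open>m > 0\<close> by simp
    then show ?thesis unfolding z_def by (simp only:) simp
  qed
  moreover have "int m dvd d" if "z = 1"
  proof -
    from that have "\<exists>n::int. 2 * pi * real_of_int d / real m = real_of_int (2 * n) * pi"
      unfolding z_def cis_conv_exp exp_eq_1 by simp
    then obtain n :: int where "2 * pi * real_of_int d / real m = real_of_int (2 * n) * pi" ..
    then have "real_of_int d = real_of_int (n * int m)" using \<open>m > 0\<close> by (simp add: field_simps)
    then have "d = n * int m" by (simp only: of_int_eq_iff)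
    then show ?thesis by simp
  qed
  moreover have "z ^ m = 1"
  proof -
    have "z ^ m = cis (2 * pi * real_of_int d)" using \<open>m > 0\<close> by (simp add: z_def Complex.DeMoivre)
    then show ?thesis by simp
  qed
  ultimately show ?thesis
    by (cases "z = 1") (auto simp: pow geometric_sum)
qed

text \<open>
  The coefficient of index \<open>k\<close> of an absolutely convergent Fourier series is the limit of averages
  over the \<open>m\<close>-th roots of unity; negative \<open>k\<close> gives zero.  These averages play the role of
  contour integrals of vector-valued functions.
\<close>

lemma roots_unity_average_tendsto:
  fixes a :: "nat \<Rightarrow> 'a::complex_banach" and k :: int
  assumes a: "summable (\<lambda>n. norm (a n))"
  shows "(\<lambda>m. (1 / real m) *\<^sub>R (\<Sum>j<m. scaleC (cis (- (2 * pi * real_of_int k * real j / real m)))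
            (\<Sum>n. scaleC (cis (2 * pi * real n * real j / real m)) (a n))))
      \<longlonglongrightarrow> (if k \<ge> 0 then a (nat k) else 0)"
proof -
  define b where "b m n = (if int m dvd int n - k then a n else 0)" for m n
  have avg: "(1 / real m) *\<^sub>R (\<Sum>j<m. scaleC (cis (- (2 * pi * real_of_int k * real j / real m)))
            (\<Sum>n. scaleC (cis (2 * pi * real n * real j / real m)) (a n))) = (\<Sum>n. b m n)"
    if "m > 0" for m
  proof -
    have s: "(\<lambda>n. scaleC (cis (2 * pi * real n * real j / real m)) (a n)) sums
        (\<Sum>n. scaleC (cis (2 * pi * real n * real j / real m)) (a n))" for j
    proof (rule summable_sums, rule summable_norm_cancel)
      show "summable (\<lambda>n. norm (scaleC (cis (2 * pi * real n * real j / real m)) (a n)))"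
        using a by (simp add: norm_scaleC)
    qed
    have "(\<lambda>n. (1 / real m) *\<^sub>R (\<Sum>j<m. scaleC (cis (- (2 * pi * real_of_int k * real j / real m)))
            (scaleC (cis (2 * pi * real n * real j / real m)) (a n)))) sums
        ((1 / real m) *\<^sub>R (\<Sum>j<m. scaleC (cis (- (2 * pi * real_of_int k * real j / real m)))
            (\<Sum>n. scaleC (cis (2 * pi * real n * real j / real m)) (a n))))"
      by (intro sums_scaleR_right sums_sum bounded_linear.sums[OF bounded_linear_scaleC] s)
    moreover have "(1 / real m) *\<^sub>R (\<Sum>j<m. scaleC (cis (- (2 * pi * real_of_int k * real j / real m)))
            (scaleC (cis (2 * pi * real n * real j / real m)) (a n))) = b m n" for n
    proof -
      have "(\<Sum>j<m. scaleC (cis (- (2 * pi * real_of_int k * real j / real m)))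
            (scaleC (cis (2 * pi * real n * real j / real m)) (a n)))
          = scaleC (\<Sum>j<m. cis (2 * pi * real_of_int (int n - k) * real j / real m)) (a n)"
      proof -
        have "- (2 * pi * real_of_int k * real j / real m) + 2 * pi * real n * real j / real m
            = 2 * pi * real_of_int (int n - k) * real j / real m" for j
          by (simp add: algebra_simps diff_divide_distrib)
        then show ?thesis
          by (simp only: linear_sum[OF bounded_linear.linear[OF bounded_linear_scaleC_left]] scaleC_scaleC cis_mult)
      qed
      also have "\<dots> = (if int m dvd int n - k then scaleC (of_real (real m)) (a n) else 0)"
        unfolding sum_cis_roots_unity[OF \<open>m > 0\<close>] by simp
      finally show ?thesis using \<open>m > 0\<close> by (simp add: b_def scaleC_of_real del: of_real_of_nat_eq)
    qed
    ultimately show ?thesis by (simp add: sums_iff)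
  qed
  define c where "c n = (if int n = k then a n else 0)" for n
  have bc: "b m n = c n" if "n + nat \<bar>k\<bar> < m" for m n
  proof -
    have "int n = k" if "int m dvd int n - k"
    proof (rule ccontr)
      assume "int n \<noteq> k"
      then have "int m \<le> \<bar>int n - k\<bar>" using that by (intro zdvd_imp_le) auto
      then show False using \<open>n + nat \<bar>k\<bar> < m\<close> by linarith
    qed
    then show ?thesis by (auto simp: b_def c_def)
  qed
  have bc_le: "norm (b m n - c n) \<le> norm (a n)" for m n by (auto simp: b_def c_def)
  have sb: "summable (b m)" for m
    by (rule summable_comparison_test'[OF a, of 0]) (auto simp: b_def)
  have sc: "summable c"
    by (rule summable_comparison_test'[OF a, of 0]) (auto simp: c_def)
  have "(\<lambda>m. (\<Sum>n. b m n) - (\<Sum>n. c n)) \<longlonglongrightarrow> 0"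
  proof (rule Lim_null_comparison)
    have tail: "norm ((\<Sum>n. b m n) - (\<Sum>n. c n)) \<le> (\<Sum>n. norm (a n)) - (\<Sum>n<m - nat \<bar>k\<bar>. norm (a n))" for m
    proof -
      let ?N = "m - nat \<bar>k\<bar>"
      have "(\<Sum>n. b m n) - (\<Sum>n. c n) = (\<Sum>n. b m n - c n)" by (rule suminf_diff[OF sb sc])
      also have "\<dots> = (\<Sum>n. b m (n + ?N) - c (n + ?N)) + (\<Sum>n<?N. b m n - c n)"
        by (rule suminf_split_initial_segment[OF summable_diff[OF sb sc]])
      also have "(\<Sum>n<?N. b m n - c n) = 0" by (intro sum.neutral) (auto simp: bc)
      also have "norm ((\<Sum>n. b m (n + ?N) - c (n + ?N)) + 0) \<le> (\<Sum>n. norm (a (n + ?N)))"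
        using norm_suminf_le[OF bc_le summable_ignore_initial_segment[OF a]] by simp
      also have "\<dots> = (\<Sum>n. norm (a n)) - (\<Sum>n<?N. norm (a n))"
        by (rule suminf_minus_initial_segment[OF a])
      finally show ?thesis .
    qed
    then show "\<forall>\<^sub>F m in sequentially. norm ((\<Sum>n. b m n) - (\<Sum>n. c n))
        \<le> (\<Sum>n. norm (a n)) - (\<Sum>n<m - nat \<bar>k\<bar>. norm (a n))"
      by (simp add: always_eventually)
    have "(\<lambda>m. \<Sum>n<m - nat \<bar>k\<bar>. norm (a n)) \<longlonglongrightarrow> (\<Sum>n. norm (a n))"
      by (rule filterlim_compose[OF summable_LIMSEQ[OF a] filterlim_minus_const_nat_at_top])
    from tendsto_diff[OF tendsto_const this, of "\<Sum>n. norm (a n)"]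
    show "(\<lambda>m. (\<Sum>n. norm (a n)) - (\<Sum>n<m - nat \<bar>k\<bar>. norm (a n))) \<longlonglongrightarrow> 0" by simp
  qed
  then have "(\<lambda>m. \<Sum>n. b m n) \<longlonglongrightarrow> (\<Sum>n. c n)" by (rule LIM_zero_cancel)
  also have "(\<Sum>n. c n) = (\<Sum>n. if int n = k then a n else 0)" by (simp add: c_def)
  also have "(\<Sum>n. if int n = k then a n else 0) = (if k \<ge> 0 then a (nat k) else 0)"
  proof (cases "k \<ge> 0")
    case True
    then have "int n = k \<longleftrightarrow> n = nat k" for n by auto
    moreover have "(\<lambda>n. if n = nat k then a n else 0) sums a (nat k)"
      by (rule sums_single)
    ultimately show ?thesis using True by (simp add: sums_iff)
  qed auto
  finally show ?thesis
    by (rule Lim_transform_eventually) (use eventually_gt_at_top[of 0] in eventually_elim, simp add: avg)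
qed

text \<open>
  Cauchy's estimate for a power series with vector coefficients.
\<close>

lemma norm_coeff_le:
  fixes a :: "nat \<Rightarrow> 'a::complex_banach"
  assumes a: "summable (\<lambda>n. norm (scaleC (of_real R ^ n) (a n)))" and "0 \<le> R"
    and bound: "\<And>z. cmod z = R \<Longrightarrow> norm (\<Sum>n. scaleC (z ^ n) (a n)) \<le> B"
  shows "R ^ k * norm (a k) \<le> B"
proof -
  define c where "c n = scaleC (of_real R ^ n) (a n)" for n
  define f where "f m j = (\<Sum>n. scaleC (cis (2 * pi * real n * real j / real m)) (c n))" for m j :: nat
  have "(\<lambda>m. (1 / real m) *\<^sub>R (\<Sum>j<m. scaleC (cis (- (2 * pi * real_of_int (int k) * real j / real m))) (f m j)))
      \<longlonglongrightarrow> c k"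
    using roots_unity_average_tendsto[of c "int k"] a unfolding f_def c_def by simp
  moreover have "norm ((1 / real m) *\<^sub>R (\<Sum>j<m. scaleC (cis (- (2 * pi * real_of_int (int k) * real j / real m))) (f m j))) \<le> B"
    if "m > 0" for m
  proof -
    have "norm (f m j) \<le> B" for j
    proof -
      have "f m j = (\<Sum>n. scaleC ((of_real R * cis (2 * pi * real j / real m)) ^ n) (a n))"
        unfolding f_def c_def scaleC_scaleC power_mult_distrib Complex.DeMoivre
        by (simp add: mult_ac)
      moreover have "cmod (of_real R * cis (2 * pi * real j / real m)) = R"
        using \<open>0 \<le> R\<close> by (simp add: norm_mult)
      ultimately show ?thesis using bound by metis
    qed
    then have "norm (\<Sum>j<m. scaleC (cis (- (2 * pi * real_of_int (int k) * real j / real m))) (f m j)) \<le> (\<Sum>j<m. B)"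
      by (intro sum_norm_le) (simp add: norm_scaleC)
    then show ?thesis using that by (simp add: field_simps)
  qed
  ultimately have "norm (c k) \<le> B"
    by (intro Lim_norm_ubound[rotated 1]) (auto intro: eventually_mono[OF eventually_gt_at_top[of 0]])
  then show ?thesis using \<open>0 \<le> R\<close> by (simp add: c_def norm_scaleC norm_power)
qed

text \<open>
  Averaging over the circle against the weight \<open>1 + cos\<close>, which is nonnegative and has mean one,
  produces exactly \<open>a 0 + (R / 2) a 1\<close>.  Its norm is bounded without any loss of constant.
\<close>

lemma norm_first_coeffs_le:
  fixes a :: "nat \<Rightarrow> 'a::complex_banach"
  assumes a: "summable (\<lambda>n. norm (scaleC (of_real R ^ n) (a n)))" and "0 \<le> R"
    and bound: "\<And>z. cmod z = R \<Longrightarrow> norm (\<Sum>n. scaleC (z ^ n) (a n)) \<le> B"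
  shows "norm (a 0 + (R / 2) *\<^sub>R a 1) \<le> B"
proof -
  define c where "c n = scaleC (of_real R ^ n) (a n)" for n
  define f where "f m j = (\<Sum>n. scaleC (cis (2 * pi * real n * real j / real m)) (c n))" for m j :: nat
  define A where "A k m = (1 / real m) *\<^sub>R (\<Sum>j<m. scaleC (cis (- (2 * pi * real_of_int k * real j / real m))) (f m j))"
    for k m
  have lim: "A k \<longlonglongrightarrow> (if k \<ge> 0 then c (nat k) else 0)" for k
    using roots_unity_average_tendsto[of c k] a unfolding A_def f_def c_def by simp
  have "(\<lambda>m. A 0 m + (1/2) *\<^sub>R A 1 m + (1/2) *\<^sub>R A (- 1) m) \<longlonglongrightarrow> c 0 + (1/2) *\<^sub>R c 1 + (1/2) *\<^sub>R 0"
    using lim[of 0] lim[of 1] lim[of "- 1"] by (intro tendsto_intros) auto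
  then have "(\<lambda>m. A 0 m + (1/2) *\<^sub>R A 1 m + (1/2) *\<^sub>R A (- 1) m) \<longlonglongrightarrow> c 0 + (1/2) *\<^sub>R c 1" by simp
  moreover have "norm (A 0 m + (1/2) *\<^sub>R A 1 m + (1/2) *\<^sub>R A (- 1) m) \<le> B" if "m > 1" for m
  proof -
    define \<theta> where "\<theta> j = 2 * pi * real j / real m" for j
    have f: "norm (f m j) \<le> B" for j
    proof -
      have "f m j = (\<Sum>n. scaleC ((of_real R * cis (2 * pi * real j / real m)) ^ n) (a n))"
        unfolding f_def c_def scaleC_scaleC power_mult_distrib Complex.DeMoivre
        by (simp add: mult_ac)
      moreover have "cmod (of_real R * cis (2 * pi * real j / real m)) = R"
        using \<open>0 \<le> R\<close> by (simp add: norm_mult)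
      ultimately show ?thesis using bound by metis
    qed
    have weight: "scaleC 1 x + (1/2) *\<^sub>R scaleC (cis (- t)) x + (1/2) *\<^sub>R scaleC (cis t) x = (1 + cos t) *\<^sub>R x"
      for t and x :: 'a
    proof -
      have "1 + complex_of_real (1/2) * cis (- t) + complex_of_real (1/2) * cis t = complex_of_real (1 + cos t)"
        by (simp add: complex_eq_iff)
      then have "scaleC (1 + complex_of_real (1/2) * cis (- t) + complex_of_real (1/2) * cis t) x = (1 + cos t) *\<^sub>R x"
        by (simp only: scaleC_of_real)
      then show ?thesis
        by (simp only: scaleC_add_left scaleC_of_real flip: scaleC_scaleC)
    qed
    have "A 0 m + (1/2) *\<^sub>R A 1 m + (1/2) *\<^sub>R A (- 1) m = (1 / real m) *\<^sub>R (\<Sum>j<m. scaleC 1 (f m j)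
        + (1/2) *\<^sub>R scaleC (cis (- \<theta> j)) (f m j) + (1/2) *\<^sub>R scaleC (cis (\<theta> j)) (f m j))"
      unfolding A_def \<theta>_def
      by (simp add: sum.distrib scaleR_add_right scaleR_sum_right mult.commute)
    also have "\<dots> = (1 / real m) *\<^sub>R (\<Sum>j<m. (1 + cos (\<theta> j)) *\<^sub>R f m j)"
      by (simp only: weight)
    also have "norm \<dots> \<le> (1 / real m) * (\<Sum>j<m. (1 + cos (\<theta> j)) * B)"
    proof -
      have "norm ((1 + cos (\<theta> j)) *\<^sub>R f m j) \<le> (1 + cos (\<theta> j)) * B" for j
      proof -
        have "0 \<le> 1 + cos (\<theta> j)" using cos_ge_minus_one[of "\<theta> j"] by linarith
        then show ?thesis using f by (simp add: mult_left_mono)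
      qed
      then have "norm (\<Sum>j<m. (1 + cos (\<theta> j)) *\<^sub>R f m j) \<le> (\<Sum>j<m. (1 + cos (\<theta> j)) * B)"
        by (rule sum_norm_le)
      then show ?thesis by (simp add: divide_right_mono)
    qed
    also have "(\<Sum>j<m. (1 + cos (\<theta> j)) * B) = (real m + Re (\<Sum>j<m. cis (\<theta> j))) * B"
      by (simp add: sum.distrib flip: sum_distrib_right)
    also have "(\<Sum>j<m. cis (\<theta> j)) = 0"
      using sum_cis_roots_unity[of m 1] that unfolding \<theta>_def by simp
    finally show ?thesis using that by simp
  qed
  ultimately have "norm (c 0 + (1/2) *\<^sub>R c 1) \<le> B"
    by (intro Lim_norm_ubound[rotated 1]) (auto intro: eventually_mono[OF eventually_gt_at_top[of 1]])
  then show ?thesis by (simp add: c_def scaleC_of_real)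
qed

text \<open>
  Stirling's upper bound, up to a linear factor.
\<close>

lemma fact_le_power_exp:
  assumes "n > 0"
  shows "fact n \<le> exp 1 * real n * (real n / exp 1) ^ n"
  using assms
proof (induction n rule: nat_induct_non_zero)
  case (Suc n)
  have "real n / real (Suc n) = 1 + - (1 / real (Suc n))" by (simp add: field_simps)
  also have "\<dots> \<le> exp (- (1 / real (Suc n)))" by (rule exp_ge_add_one_self)
  finally have "(real n / real (Suc n)) ^ Suc n \<le> exp (- (1 / real (Suc n))) ^ Suc n"
    by (intro power_mono) auto
  also have "\<dots> = exp (real (Suc n) * - (1 / real (Suc n)))" by (rule exp_of_nat_mult[symmetric])
  also have "real (Suc n) * - (1 / real (Suc n)) = - 1" by simp
  finally have "real n ^ Suc n / real (Suc n) ^ Suc n \<le> exp (- 1)"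
    by (simp only: power_divide)
  then have "real n ^ Suc n \<le> exp (- 1) * real (Suc n) ^ Suc n"
    by (subst (asm) pos_divide_le_eq) auto
  then have "real n ^ Suc n / exp 1 ^ n \<le> exp (- 1) * real (Suc n) ^ Suc n / exp 1 ^ n"
    by (rule divide_right_mono) simp
  also have "exp (- 1) * real (Suc n) ^ Suc n / exp 1 ^ n = (real (Suc n) / exp 1) ^ Suc n"
    by (simp add: power_divide exp_minus field_simps)
  finally have *: "real n * (real n / exp 1) ^ n \<le> (real (Suc n) / exp 1) ^ Suc n"
    by (simp add: power_divide)
  have "fact (Suc n) = real (Suc n) * fact n" by simp
  also have "\<dots> \<le> real (Suc n) * (exp 1 * real n * (real n / exp 1) ^ n)"
    using Suc.IH by (intro mult_left_mono) auto
  also have "\<dots> = exp 1 * real (Suc n) * (real n * (real n / exp 1) ^ n)" by simp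
  also have "\<dots> \<le> exp 1 * real (Suc n) * (real (Suc n) / exp 1) ^ Suc n"
    using * by (intro mult_left_mono) auto
  finally show ?case .
qed simp

section \<open>Extreme points of the ball of a JB*-triple are tripotents\<close>

lemma le_one_if_powers_bounded:
  fixes x C :: real
  assumes "\<And>n. x ^ 3 ^ n \<le> C"
  shows "x \<le> 1"
proof (rule ccontr)
  assume "\<not> x \<le> 1"
  then have "x > 1" by simp
  then obtain m where "C < x ^ m" using real_arch_pow by blast
  also have "\<dots> \<le> x ^ 3 ^ m"
  proof (rule power_increasing)
    show "m \<le> 3 ^ m" by (rule less_imp_le[OF power_gt_expt]) simp
  qed (use \<open>x > 1\<close> in simp)
  finally show False using assms[of m] by simp
qed

context jb_triple
begin

lemma T_add: "T (a + a') b c = T a b c + T a' b c" "T a (b + b') c = T a b c + T a b' c"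
    "T a b (c + c') = T a b c + T a b c'"
  using linear_first conj_linear_second linear_third by (simp_all add: clinear_def conj_linear_def)

lemma T_scaleC: "T (scaleC s a) b c = scaleC s (T a b c)" "T a (scaleC s b) c = scaleC (cnj s) (T a b c)"
    "T a b (scaleC s c) = scaleC s (T a b c)"
  using linear_first conj_linear_second linear_third by (simp_all add: clinear_def conj_linear_def)

lemma T_scaleR: "T (r *\<^sub>R a) b c = r *\<^sub>R T a b c" "T a (r *\<^sub>R b) c = r *\<^sub>R T a b c"
    "T a b (r *\<^sub>R c) = r *\<^sub>R T a b c"
  by (simp_all add: T_scaleC flip: scaleC_of_real)

lemma T_zero: "T 0 b c = 0" "T a 0 c = 0" "T a b 0 = 0"
  using T_scaleR(1)[of 0 0 b c] T_scaleR(2)[of a 0 0 c] T_scaleR(3)[of a b 0 0] by simp_all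

lemma T_minus: "T (- a) b c = - T a b c" "T a (- b) c = - T a b c" "T a b (- c) = - T a b c"
  using T_scaleR(1)[of "- 1" a b c] T_scaleR(2)[of a "- 1" b c] T_scaleR(3)[of a b "- 1" c] by simp_all

lemma T_diff: "T (a - a') b c = T a b c - T a' b c" "T a (b - b') c = T a b c - T a b' c"
    "T a b (c - c') = T a b c - T a b c'"
  using T_add(1)[of a "- a'"] T_add(2)[of _ b "- b'"] T_add(3)[of _ _ c "- c'"] by (simp_all add: T_minus)

lemma bounded_clinear_L: "bounded_clinear (T a a)"
  using hermitian by (simp add: hermitian_op_def)

lemma norm_op_exp_L: "norm (op_exp (\<i> * complex_of_real t) (T a a) x) = norm x"
  using hermitian by (simp add: hermitian_op_def)

text \<open>
  A continuous trilinear map is bounded.  The optimal constant \<open>1\<close> is not needed.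
\<close>

lemma norm_triple_bound: "\<exists>K\<ge>0. \<forall>a b c. norm (T a b c) \<le> K * norm a * norm b * norm c"
proof -
  have "isCont (\<lambda>(a, b, c). T a b c) (0, 0, 0)"
    using continuous by (simp add: continuous_on_eq_continuous_at)
  then obtain d where "d > 0" and d: "\<And>p. dist p (0, 0, 0) < d \<Longrightarrow> dist (case p of (a, b, c) \<Rightarrow> T a b c) (T 0 0 0) < 1"
    unfolding continuous_at_eps_delta by (metis (no_types, lifting) case_prod_conv zero_less_one)
  define r where "r = d / 4"
  have "r > 0" using \<open>d > 0\<close> by (simp add: r_def)
  have small: "norm (T a b c) \<le> 1" if "norm a \<le> r" "norm b \<le> r" "norm c \<le> r" for a b c
  proof -
    have "norm (a, b, c) \<le> norm a + (norm b + norm c)"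
      by (rule order_trans[OF norm_Pair_le add_left_mono[OF norm_Pair_le]])
    also have "\<dots> < d" using that \<open>d > 0\<close> by (simp add: r_def)
    finally have "dist (a, b, c) (0, 0, 0) < d" by (simp add: dist_norm zero_prod_def[symmetric])
    from d[OF this] show ?thesis by (simp add: T_zero)
  qed
  have "norm (T a b c) \<le> 1 / r ^ 3 * norm a * norm b * norm c" for a b c
  proof (cases "a = 0 \<or> b = 0 \<or> c = 0")
    case False
    have "norm (T ((r / norm a) *\<^sub>R a) ((r / norm b) *\<^sub>R b) ((r / norm c) *\<^sub>R c)) \<le> 1"
      using False \<open>r > 0\<close> by (intro small) auto
    then have "(r / norm a) * (r / norm b) * (r / norm c) * norm (T a b c) \<le> 1"
      using \<open>r > 0\<close> by (simp add: T_scaleR abs_mult mult_ac)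
    then have "r ^ 3 * norm (T a b c) / (norm a * norm b * norm c) \<le> 1"
      by (simp add: power3_eq_cube mult_ac)
    then have "r ^ 3 * norm (T a b c) \<le> norm a * norm b * norm c"
      using False by (subst (asm) pos_divide_le_eq) auto
    then show ?thesis using \<open>r > 0\<close> by (simp add: field_simps)
  qed (auto simp: T_zero)
  then show ?thesis using \<open>r > 0\<close> by (intro exI[of _ "1 / r ^ 3"]) auto
qed

text \<open>
  The odd power \<open>u\<^bsup>2 n + 1\<^esup>\<close> in the sense of the triple product, indexed by \<open>n\<close>.
\<close>

definition odd_power :: "'a \<Rightarrow> nat \<Rightarrow> 'a"
  where "odd_power u n = (T u u ^^ n) u"

lemma odd_power_0 [simp]: "odd_power u 0 = u"
  by (simp add: odd_power_def)

lemma L_odd_power: "T u u (odd_power u n) = odd_power u (Suc n)"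
  by (simp add: odd_power_def)

text \<open>
  Power associativity.  The proof is by induction on \<open>n = a + b + c\<close>: the Jordan identity, applied to
  powers of smaller total degree, first shows that for \<open>c \<ge> 1\<close> the product depends on \<open>n\<close> and \<open>c\<close>
  only, then that it is the product \<open>X\<close> with \<open>a = b = 0\<close>.
\<close>

lemma triple_odd_power:
  "T (odd_power u a) (odd_power u b) (odd_power u c) = odd_power u (a + b + c + 1)"
proof (induction "a + b + c" arbitrary: a b c rule: less_induct)
  case less
  define n where "n = a + b + c"
  define P where "P i j k = T (odd_power u i) (odd_power u j) (odd_power u k)" for i j k
  define X where "X = odd_power u (n + 1)"
  define R where "R k = P (n - k) 0 k" for k
  have IH: "P i j k = odd_power u (i + j + k + 1)" if "i + j + k < n" for i j k
    using less that by (simp add: P_def n_def)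
  have JI: "P i j (x + y + z + 1) = P (i + j + x + 1) y z - P x (i + j + y + 1) z + P x y (i + j + z + 1)"
    if "i + j + x + y + z + 1 = n" for i j x y z
  proof -
    have "T (odd_power u i) (odd_power u j) (P x y z)
        = P x y (i + j + z + 1) + P (i + j + x + 1) y z - P x (i + j + y + 1) z"
      using jordan_identity[of "odd_power u i" "odd_power u j" "odd_power u x" "odd_power u y" "odd_power u z"]
        IH[of i j z] IH[of i j x] IH[of j i y] that by (simp add: P_def add_ac)
    then show ?thesis using IH[of x y z] that by (simp add: P_def)
  qed
  have sym: "P i j k = P k j i" for i j k unfolding P_def by (rule symmetric)
  have X: "P 0 0 n = X" by (simp add: P_def X_def L_odd_power)
  have red: "P i j k = P (n - k + 1) 0 (k - 1) - P 0 (n - k + 1) (k - 1) + X" if "k \<ge> 1" "i + j + k = n" for i j k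
  proof -
    have "i + j + 0 + 0 + (k - 1) + 1 = n" "0 + 0 + (k - 1) + 1 = k" "i + j + 0 + 1 = n - k + 1" "i + j + (k - 1) + 1 = n"
      using that by auto
    with JI[of i j 0 0 "k - 1"] show ?thesis by (simp only: X)
  qed
  have PR: "P i j k = R k" if "k \<ge> 1" "i + j + k = n" for i j k
    using red[OF that] red[of k "n - k" 0] that by (simp add: R_def)
  have PR': "P i j k = R i" if "i \<ge> 1" "i + j + k = n" for i j k
    using PR[of i k j] that sym[of i j k] by simp
  have RX: "R k = X" if "2 \<le> k" "k \<le> n" for k
    using red[of k "n - k" 0] PR[of "k - 1" "n - k + 1" 0] PR[of "k - 1" 0 "n - k + 1"] that
    by (simp add: R_def)
  have R1: "R 1 = X" if n1: "n \<ge> 1"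
  proof -
    consider "n = 1" | "n = 2" | "n \<ge> 3" using n1 by atomize_elim presburger
    then show ?thesis
    proof cases
      case 1
      then show ?thesis using X by (simp add: R_def)
    next
      case 2
      have eq1: "R 1 = X - P 0 2 0 + X"
        using red[of 1 1 0] 2 X sym[of 2 0 0] by (simp add: R_def numeral_2_eq_2)
      have eq2: "X = R 1 - P 0 2 0 + R 1"
        using JI[of 0 0 0 1 0] 2 X PR[of 1 0 1] PR'[of 1 1 0] by (simp add: numeral_2_eq_2)
      define d where "d = R 1 - X"
      have "d = (X - P 0 2 0 + X) - (R 1 - P 0 2 0 + R 1)"
        unfolding d_def by (rule arg_cong2[where f = "(-)", OF eq1 eq2])
      also have "\<dots> = - (2 *\<^sub>R d)" by (simp add: d_def algebra_simps scaleR_2)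
      finally have "d + 2 *\<^sub>R d = 0" by (simp add: eq_neg_iff_add_eq_0)
      then have "(1 + 2) *\<^sub>R d = 0" by (simp only: scaleR_add_left scaleR_one)
      then show ?thesis by (simp add: d_def)
    next
      case 3
      then show ?thesis using PR[of 2 1 "n - 3"] PR'[of 1 "n - 3" 2] RX[of 2] by simp
    qed
  qed
  have "P a b c = X"
  proof -
    consider "c \<ge> 1" | "a \<ge> 1" | "a = 0" "c = 0" "b = 0" | "a = 0" "c = 0" "b \<ge> 1"
      by atomize_elim presburger
    then show ?thesis
    proof cases
      case 1
      then show ?thesis using PR[of c a b] RX[of c] R1 by (cases "c = 1") (auto simp: n_def)
    next
      case 2
      then show ?thesis using PR'[of a b c] RX[of a] R1 by (cases "a = 1") (auto simp: n_def)
    next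
      case 3
      then show ?thesis using X by (simp add: n_def)
    next
      case 4
      then have "b = n" by (simp add: n_def)
      have "R 1 = P n 0 0 - P 0 n 0 + X" using red[of 1 "n - 1" 0] 4 \<open>b = n\<close> by (simp add: R_def)
      then have "P 0 n 0 = X" using R1 4 \<open>b = n\<close> X sym[of n 0 0] by simp
      then show ?thesis using 4 \<open>b = n\<close> by simp
    qed
  qed
  then show ?case by (simp add: P_def X_def n_def)
qed

lemma odd_power_cube: "odd_power (T u u u) n = odd_power u (3 * n + 1)"
proof (induction n)
  case 0
  then show ?case by (simp add: odd_power_def)
next
  case (Suc n)
  have *: "T u u u = odd_power u 1" by (simp add: odd_power_def)
  have "odd_power (T u u u) (Suc n) = T (T u u u) (T u u u) (odd_power (T u u u) n)" by (simp add: odd_power_def)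
  also have "\<dots> = T (odd_power u 1) (odd_power u 1) (odd_power u (3 * n + 1))" by (simp only: Suc) (simp only: *)
  also have "\<dots> = odd_power u (3 * Suc n + 1)" unfolding triple_odd_power by (simp add: eval_nat_numeral)
  finally show ?case .
qed

lemma norm_odd_power_cube: "norm (odd_power u n) ^ 3 = norm (odd_power (T u u u) n)"
proof -
  have "norm (odd_power u n) ^ 3 = norm (odd_power u (n + n + n + 1))"
    by (simp only: norm_cube[symmetric] triple_odd_power)
  also have "n + n + n + 1 = 3 * n + 1" by simp
  finally show ?thesis by (simp only: odd_power_cube)
qed

text \<open>
  Since \<open>norm (T v v v) = norm v ^ 3\<close>, the crude bound \<open>K ^ n\<close> for the odd power of index \<open>n\<close> may be
  applied to iterated cubes, and the constant disappears in the limit.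
\<close>

lemma norm_odd_power_le:
  assumes "norm u \<le> 1"
  shows "norm (odd_power u n) \<le> 1"
proof -
  obtain K where "K \<ge> 0" and K: "\<And>a b c. norm (T a b c) \<le> K * norm a * norm b * norm c"
    using norm_triple_bound by blast
  have crude: "norm (odd_power v n) \<le> K ^ n" if "norm v \<le> 1" for v
  proof (induction n)
    case (Suc n)
    have "norm (odd_power v (Suc n)) \<le> K * norm v * norm v * norm (odd_power v n)"
      using K[of v v "odd_power v n"] by (simp add: L_odd_power)
    also have "\<dots> \<le> K * 1 * 1 * K ^ n"
      using that Suc \<open>K \<ge> 0\<close> by (intro mult_mono) auto
    finally show ?case by simp
  qed (use that in simp)
  have "norm (odd_power v n) ^ 3 ^ j \<le> K ^ n" if "norm v \<le> 1" for v j
    using that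
  proof (induction j arbitrary: v)
    case 0
    then show ?case using crude by simp
  next
    case (Suc j)
    have "norm (T v v v) \<le> 1" using Suc.prems by (simp add: norm_cube power_le_one)
    from Suc.IH[OF this] show ?case
      by (simp add: power_mult norm_odd_power_cube)
  qed
  then show ?thesis using assms by (intro le_one_if_powers_bounded[of _ "K ^ n"]) blast
qed

text \<open>
  As \<open>L(u, u)\<close> is hermitian, only the real part of \<open>z\<close> matters.
\<close>

lemma norm_op_exp_le:
  assumes "norm u \<le> 1"
  shows "norm (op_exp z (T u u) u) \<le> exp \<bar>Re z\<bar>"
proof -
  have "op_exp z (T u u) u = op_exp (\<i> * of_real (Im z)) (T u u) (op_exp (of_real (Re z)) (T u u) u)"
    by (subst op_exp_add[OF bounded_clinear_L, symmetric]) (simp add: add.commute flip: complex_eq)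
  then have "norm (op_exp z (T u u) u) = norm (op_exp (of_real (Re z)) (T u u) u)"
    by (simp add: norm_op_exp_L)
  also have "\<dots> = norm (\<Sum>n. scaleC (of_real (Re z) ^ n / fact n) ((T u u ^^ n) u))"
    by (simp add: op_exp_def)
  also have "\<dots> \<le> (\<Sum>n. \<bar>Re z\<bar> ^ n /\<^sub>R fact n)"
  proof (rule norm_suminf_le)
    show "norm (scaleC (of_real (Re z) ^ n / fact n) ((T u u ^^ n) u)) \<le> \<bar>Re z\<bar> ^ n /\<^sub>R fact n" for n
    proof -
      have "norm (scaleC (of_real (Re z) ^ n / fact n) ((T u u ^^ n) u)) = \<bar>Re z\<bar> ^ n / fact n * norm (odd_power u n)"
        by (simp add: norm_scaleC norm_divide norm_power odd_power_def)
      also have "\<dots> \<le> \<bar>Re z\<bar> ^ n / fact n * 1"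
        using norm_odd_power_le[OF assms] by (intro mult_left_mono) auto
      finally show ?thesis by (simp add: field_simps)
    qed
  qed (rule summable_exp_generic)
  also have "\<dots> = exp \<bar>Re z\<bar>" by (simp add: exp_def)
  finally show ?thesis .
qed

text \<open>
  This is where the spectrum enters: for \<open>Re z < 0\<close> the trivial growth rate \<open>1\<close> improves to some
  \<open>\<theta> < 1\<close>, since \<open>- 1\<close> is not in the spectrum of \<open>L(u, u)\<close>.  Writing \<open>g = 1 + L(u, u)\<close>, Cauchy's estimate
  bounds \<open>g ^ k\<close> applied to \<open>v = exp (- y g) u\<close> by \<open>fact k / y ^ k\<close>, and the inverse of \<open>g\<close> costs a
  factor \<open>b ^ k\<close>; the choice \<open>k = y / (2 b)\<close> gives exponential decay of \<open>v\<close>.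
\<close>

lemma exp_decay:
  assumes u: "norm u \<le> 1"
  obtains \<theta> where "0 \<le> \<theta>" "\<theta> < 1"
    "\<And>z. norm (op_exp z (T u u) u) \<le> 2 * (exp (Re z) + exp (- \<theta> * Re z))"
proof -
  define H where "H = T u u"
  define g where "g x = scaleC 1 x + scaleC 1 (H x)" for x
  have H: "bounded_clinear H" unfolding H_def by (rule bounded_clinear_L)
  have g: "bounded_clinear g" unfolding g_def by (rule bounded_clinear_add_scaleC[OF H])
  have exp_g: "op_exp z g x = scaleC (exp z) (op_exp z H x)" for z x
    unfolding g_def using op_exp_add_scaleC[OF H, of z 1 1 x] by simp
  have "- 1 \<notin> op_spectrum H"
  proof
    assume "- 1 \<in> op_spectrum H"
    then obtain r :: real where "r \<ge> 0" "- 1 = complex_of_real r"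
      using nonneg_spectrum[of u] by (auto simp: H_def)
    from this(2) have "Re (- 1) = Re (complex_of_real r)" by (rule arg_cong)
    then show False using \<open>r \<ge> 0\<close> by simp
  qed
  then obtain B where B: "bounded_clinear B" "\<And>x. B (scaleC (- 1) x - H x) = x"
    unfolding op_spectrum_def by auto
  have Bg: "B (- g x) = x" for x
    using B(2)[of x] by (simp add: g_def scaleC_minus_left)
  obtain b0 where b0: "\<And>x. norm (B x) \<le> norm x * b0" using B(1) by (auto simp: bounded_clinear_def)
  define b where "b = max 1 b0"
  have "b \<ge> 1" by (simp add: b_def)
  have below: "norm x \<le> b * norm (g x)" for x
  proof -
    have "norm x \<le> norm (- g x) * b0" using b0[of "- g x"] by (simp add: Bg)
    also have "\<dots> \<le> norm (g x) * b" by (simp add: b_def mult_left_mono)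
    finally show ?thesis by (simp add: mult.commute)
  qed
  have below_pow: "norm x \<le> b ^ k * norm ((g ^^ k) x)" for x k
  proof (induction k)
    case (Suc k)
    have "norm x \<le> b ^ k * (b * norm (g ((g ^^ k) x)))"
      using order_trans[OF Suc mult_left_mono[OF below]] \<open>b \<ge> 1\<close> by simp
    then show ?case by (simp add: mult_ac)
  qed simp
  define \<theta> where "\<theta> = 1 - ln 2 / (2 * b)"
  have "0 < ln 2 / (2 * b)" "ln 2 / (2 * b) \<le> 1"
    using \<open>b \<ge> 1\<close> ln_2_less_1 by (auto simp: field_simps)
  then have \<theta>: "0 \<le> \<theta>" "\<theta> < 1" by (auto simp: \<theta>_def)
  have decay: "norm (op_exp (- of_real y) H u) \<le> 2 * exp (\<theta> * y)" if y: "y > 0" for y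
  proof -
    define v where "v = op_exp (- of_real y) g u"
    define k where "k = nat \<lfloor>y / (2 * b)\<rfloor>"
    have "0 \<le> y / (2 * b)" using y \<open>b \<ge> 1\<close> by simp
    then have k: "real k \<le> y / (2 * b)" "y / (2 * b) \<le> real k + 1" by (auto simp: k_def)
    have "y ^ k * norm (scaleC (1 / fact k) ((g ^^ k) v)) \<le> 1"
    proof (rule norm_coeff_le)
      show "summable (\<lambda>n. norm (scaleC (of_real y ^ n) (scaleC (1 / fact n) ((g ^^ n) v))))"
        using op_exp_summable[OF g g] by (simp add: scaleC_scaleC)
      fix z assume z: "cmod z = y"
      have "(\<Sum>n. scaleC (z ^ n) (scaleC (1 / fact n) ((g ^^ n) v))) = op_exp z g v"
        by (simp add: op_exp_def scaleC_scaleC)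
      also have "\<dots> = op_exp (z - of_real y) g u"
        by (simp add: v_def flip: op_exp_add[OF g])
      also have "\<dots> = scaleC (exp (z - of_real y)) (op_exp (z - of_real y) H u)" by (rule exp_g)
      also have "norm \<dots> \<le> exp (Re z - y) * exp \<bar>Re z - y\<bar>"
        using norm_op_exp_le[OF u, of "z - of_real y"] by (simp add: norm_scaleC H_def mult_left_mono)
      also have "\<dots> = 1" using complex_Re_le_cmod[of z] z by (simp flip: exp_add)
      finally show "norm (\<Sum>n. scaleC (z ^ n) (scaleC (1 / fact n) ((g ^^ n) v))) \<le> 1" .
    qed (use y in simp)
    then have "y ^ k * norm ((g ^^ k) v) \<le> fact k"
      by (simp add: norm_scaleC norm_divide field_simps)
    also have "\<dots> \<le> real (k ^ k)" using fact_le_power[of k, where ?'a = real] by simp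
    finally have gk: "y ^ k * norm ((g ^^ k) v) \<le> real k ^ k" by simp
    have "y ^ k * norm v \<le> b ^ k * (y ^ k * norm ((g ^^ k) v))"
      using mult_left_mono[OF below_pow[of v k], of "y ^ k"] y by (simp add: mult_ac)
    also have "\<dots> \<le> b ^ k * real k ^ k" using gk \<open>b \<ge> 1\<close> by (intro mult_left_mono) auto
    also have "\<dots> = (b * real k) ^ k" by (simp add: power_mult_distrib)
    also have "\<dots> \<le> (y / 2) ^ k"
      using k(1) \<open>b \<ge> 1\<close> by (intro power_mono) (auto simp: field_simps)
    finally have "norm v \<le> (1 / 2) ^ k" using y by (simp add: power_divide field_simps)
    also have "\<dots> = exp (- ln 2 * real k)"
      by (simp add: exp_of_nat2_mult exp_minus power_one_over inverse_eq_divide)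
    also have "\<dots> \<le> exp (- ln 2 * (y / (2 * b) - 1))"
      using mult_left_mono[of "y / (2 * b) - 1" "real k" "ln 2"] k(2) by simp
    also have "\<dots> = 2 * exp (- (ln 2 / (2 * b)) * y)"
    proof -
      have "- ln 2 * (y / (2 * b) - 1) = ln 2 + - (ln 2 / (2 * b)) * y" by (simp add: algebra_simps)
      then show ?thesis by (simp only: exp_add) simp
    qed
    finally have v: "norm v \<le> 2 * exp (- (ln 2 / (2 * b)) * y)" .
    have "norm v = exp (- y) * norm (op_exp (- of_real y) H u)"
      by (simp add: v_def exp_g norm_scaleC)
    then have "norm (op_exp (- of_real y) H u) = exp y * norm v"
      by (simp add: exp_minus)
    also have "\<dots> \<le> exp y * (2 * exp (- (ln 2 / (2 * b)) * y))" using v by (intro mult_left_mono) auto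
    also have "\<dots> = 2 * exp (\<theta> * y)" by (simp add: \<theta>_def algebra_simps flip: exp_add)
    finally show ?thesis .
  qed
  show ?thesis
  proof (rule that[OF \<theta>])
    fix z
    show "norm (op_exp z (T u u) u) \<le> 2 * (exp (Re z) + exp (- \<theta> * Re z))"
    proof (cases "Re z \<ge> 0")
      case True
      then have "norm (op_exp z (T u u) u) \<le> exp (Re z)" using norm_op_exp_le[OF u, of z] by simp
      also have "\<dots> \<le> 2 * (exp (Re z) + exp (- \<theta> * Re z))" by (simp add: add_increasing)
      finally show ?thesis .
    next
      case False
      have "z = \<i> * of_real (Im z) + of_real (Re z)" by (simp add: complex_eq_iff)
      then have "op_exp z (T u u) u = op_exp (\<i> * of_real (Im z)) (T u u) (op_exp (of_real (Re z)) (T u u) u)"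
        by (metis op_exp_add[OF bounded_clinear_L])
      then have "norm (op_exp z (T u u) u) = norm (op_exp (- of_real (- Re z)) H u)"
        by (simp add: norm_op_exp_L H_def)
      also have "\<dots> \<le> 2 * exp (\<theta> * - Re z)" using False by (intro decay) simp
      also have "\<dots> \<le> 2 * (exp (Re z) + exp (- \<theta> * Re z))" by simp
      finally show ?thesis .
    qed
  qed
qed

text \<open>
  The operator \<open>1 + c (1 - L(u, u))\<close>.  Applied to \<open>u\<close> it is the function \<open>t + c (t - t\<^sup>3)\<close> in the functional
  calculus of \<open>u\<close>, which stays below \<open>1\<close> on \<open>[0, 1]\<close> when \<open>c\<close> is small.
\<close>

definition push :: "real \<Rightarrow> 'a \<Rightarrow> 'a \<Rightarrow> 'a"
  where "push c u x = x + c *\<^sub>R (x - T u u x)"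

lemma push_eq: "push c u x = scaleC (of_real (1 + c)) x + scaleC (of_real (- c)) (T u u x)"
  unfolding push_def scaleC_of_real by (simp add: algebra_simps)

lemma bounded_clinear_push: "bounded_clinear (push c u)"
  unfolding push_eq by (rule bounded_clinear_add_scaleC[OF bounded_clinear_L])

lemma L_push_power: "T u u ((push c u ^^ j) x) = (push c u ^^ j) (T u u x)"
  by (induction j) (simp_all add: push_def T_add T_diff T_scaleR)

lemma op_exp_push_power:
  "op_exp w (T u u) ((push c u ^^ j) x) = (push c u ^^ j) (op_exp w (T u u) x)"
proof (induction j)
  case (Suc j)
  have "T u u (push c u x) = push c u (T u u x)" for x
    using L_push_power[of u 1 c x] by simp
  then show ?case
    using Suc by (simp add: op_exp_commute[OF bounded_clinear_L bounded_clinear_push])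
qed simp

lemma push_power_odd_power:
  "(push c u ^^ Suc i) (odd_power u a)
    = (1 + c) *\<^sub>R (push c u ^^ i) (odd_power u a) - c *\<^sub>R (push c u ^^ i) (odd_power u (Suc a))"
proof -
  note lin = bounded_clinear_funpow[OF bounded_clinear_push[of c u], of i]
  have "(push c u ^^ Suc i) (odd_power u a) = (push c u ^^ i) (push c u (odd_power u a))"
    by (simp only: funpow_Suc_right o_apply)
  also have "push c u (odd_power u a)
      = scaleC (of_real (1 + c)) (odd_power u a) + scaleC (of_real (- c)) (odd_power u (Suc a))"
    by (simp add: push_eq L_odd_power)
  also have "(push c u ^^ i) \<dots> = scaleC (of_real (1 + c)) ((push c u ^^ i) (odd_power u a))
      + scaleC (of_real (- c)) ((push c u ^^ i) (odd_power u (Suc a)))"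
    by (simp only: lin)
  also have "\<dots> = (1 + c) *\<^sub>R (push c u ^^ i) (odd_power u a) - c *\<^sub>R (push c u ^^ i) (odd_power u (Suc a))"
    by (simp only: scaleC_of_real) simp
  finally show ?thesis .
qed

text \<open>
  Power associativity extends to polynomials in \<open>L(u, u)\<close>; in particular the cube of
  \<open>(push c u ^^ j) (odd_power u a)\<close> is again of this form.
\<close>

lemma triple_push_power:
  "T ((push c u ^^ i) (odd_power u a)) ((push c u ^^ j) (odd_power u b)) ((push c u ^^ l) (odd_power u d))
    = (push c u ^^ (i + j + l)) (odd_power u (a + b + d + 1))"
proof (induction i arbitrary: a)
  case 0
  show ?case
  proof (induction j arbitrary: b)
    case 0
    show ?case
    proof (induction l arbitrary: d)
      case 0
      show ?case by (simp add: triple_odd_power)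
    next
      case (Suc l)
      show ?case
        using Suc.IH[of d] Suc.IH[of "Suc d"] by (simp add: push_power_odd_power T_diff T_scaleR del: funpow.simps)
    qed
  next
    case (Suc j)
    show ?case
      using Suc.IH[of b] Suc.IH[of "Suc b"] by (simp add: push_power_odd_power T_diff T_scaleR del: funpow.simps)
  qed
next
  case (Suc i)
  show ?case
    using Suc.IH[of a] Suc.IH[of "Suc a"] by (simp add: push_power_odd_power T_diff T_scaleR del: funpow.simps)
qed

text \<open>
  By induction on \<open>j\<close>: \<open>push c u v\<close> is the mean of \<open>exp (w (1 - L(u, u))) v\<close> over the circle
  of radius \<open>2 c\<close> with weight \<open>1 + cos\<close>, and the factor \<open>exp w\<close> exactly compensates the shift of the
  dominant term \<open>exp (Re z)\<close>.
\<close>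

lemma norm_push_power_exp_le:
  assumes u: "norm u \<le> 1" and c: "c \<ge> 0" and \<theta>: "0 \<le> \<theta>"
    and exp_bound: "\<And>z. norm (op_exp z (T u u) u) \<le> 2 * (exp (Re z) + exp (- \<theta> * Re z))"
  shows "norm ((push c u ^^ j) (op_exp z (T u u) u))
      \<le> 2 * (exp (Re z) + exp (2 * c * (1 + \<theta>)) ^ j * exp (- \<theta> * Re z))"
proof (induction j arbitrary: z)
  case 0
  show ?case using exp_bound[of z] by simp
next
  case (Suc j)
  define H where "H = T u u"
  have H: "bounded_clinear H" unfolding H_def by (rule bounded_clinear_L)
  define K where "K = exp (2 * c * (1 + \<theta>))"
  define g where "g x = scaleC 1 x + scaleC (- 1) (H x)" for x
  have g: "bounded_clinear g" unfolding g_def by (rule bounded_clinear_add_scaleC[OF H])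
  have exp_g: "op_exp w g x = scaleC (exp w) (op_exp (- w) H x)" for w x
    unfolding g_def using op_exp_add_scaleC[OF H, of w 1 "- 1" x] by simp
  have comm: "op_exp w H ((push c u ^^ j) x) = (push c u ^^ j) (op_exp w H x)" for w x j
    unfolding H_def by (rule op_exp_push_power)
  define v where "v = (push c u ^^ j) (op_exp z H u)"
  define a where "a n = scaleC (1 / fact n) ((g ^^ n) v)" for n
  define B where "B = 2 * (exp (Re z) + K ^ Suc j * exp (- \<theta> * Re z))"
  have "norm (a 0 + ((2 * c) / 2) *\<^sub>R a 1) \<le> B"
  proof (rule norm_first_coeffs_le)
    show "summable (\<lambda>n. norm (scaleC (of_real (2 * c) ^ n) (a n)))"
      unfolding a_def scaleC_scaleC using op_exp_summable[OF g g, of "of_real (2 * c)" v] by simp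
    fix w assume w: "cmod w = 2 * c"
    have "(\<Sum>n. scaleC (w ^ n) (a n)) = op_exp w g v"
      by (simp add: op_exp_def scaleC_scaleC a_def)
    also have "\<dots> = scaleC (exp w) ((push c u ^^ j) (op_exp (z - w) H u))"
      by (simp add: exp_g v_def comm flip: op_exp_add[OF H])
    also have "norm \<dots> \<le> exp (Re w) * (2 * (exp (Re (z - w)) + K ^ j * exp (- \<theta> * Re (z - w))))"
      unfolding norm_scaleC H_def K_def using Suc.IH[of "z - w"] by (simp add: mult_left_mono)
    also have "\<dots> = 2 * (exp (Re z) + K ^ j * (exp ((1 + \<theta>) * Re w) * exp (- \<theta> * Re z)))"
      by (simp add: algebra_simps flip: exp_add)
    also have "\<dots> \<le> 2 * (exp (Re z) + K ^ j * (K * exp (- \<theta> * Re z)))"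
    proof -
      have "(1 + \<theta>) * Re w \<le> (1 + \<theta>) * (2 * c)"
        using complex_Re_le_cmod[of w] w \<theta> by (intro mult_left_mono) auto
      then have "exp ((1 + \<theta>) * Re w) \<le> K" by (simp add: K_def mult_ac)
      then show ?thesis by (simp add: K_def mult_left_mono)
    qed
    also have "\<dots> = B" by (simp add: B_def mult_ac)
    finally show "norm (\<Sum>n. scaleC (w ^ n) (a n)) \<le> B" .
  qed (use c in simp)
  moreover have "a 0 + ((2 * c) / 2) *\<^sub>R a 1 = push c u v"
    by (simp add: a_def g_def push_def H_def scaleC_minus_left)
  ultimately show ?case by (simp add: v_def B_def K_def H_def)
qed

text \<open>
  Cauchy's estimate on the circle of radius \<open>k\<close> extracts the power \<open>L(u, u) ^ k\<close> from the exponential; by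
  Stirling's bound the result grows only linearly in \<open>k\<close>.
\<close>

lemma norm_push_power_odd_power_le:
  assumes u: "norm u \<le> 1" and c: "c \<ge> 0" and \<theta>: "0 \<le> \<theta>" "4 * c * (1 + \<theta>) \<le> 1 - \<theta>"
    and exp_bound: "\<And>z. norm (op_exp z (T u u) u) \<le> 2 * (exp (Re z) + exp (- \<theta> * Re z))"
    and "k > 0"
  shows "norm ((push c u ^^ (2 * k + 1)) (odd_power u k)) \<le> 2 * exp 1 * (1 + exp 1) * real k"
proof -
  define H where "H = T u u"
  define N where "N = 2 * k + 1"
  have H: "bounded_clinear H" unfolding H_def by (rule bounded_clinear_L)
  have comm: "op_exp w H ((push c u ^^ j) x) = (push c u ^^ j) (op_exp w H x)" for w x j
    unfolding H_def by (rule op_exp_push_power)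
  have commHn: "(H ^^ n) ((push c u ^^ j) x) = (push c u ^^ j) ((H ^^ n) x)" for x j n
    by (induction n) (simp_all add: H_def L_push_power)
  define a where "a n = scaleC (1 / fact n) ((H ^^ n) ((push c u ^^ N) u))" for n
  define K where "K = exp (2 * c * (1 + \<theta>))"
  have "real k ^ k * norm (a k) \<le> 2 * (exp (real k) + K ^ N * exp (\<theta> * real k))"
  proof (rule norm_coeff_le)
    show "summable (\<lambda>n. norm (scaleC (of_real (real k) ^ n) (a n)))"
      unfolding a_def scaleC_scaleC using op_exp_summable[OF H H, of "of_real (real k)" "(push c u ^^ N) u"] by simp
    fix z assume z: "cmod z = real k"
    have "(\<Sum>n. scaleC (z ^ n) (a n)) = (push c u ^^ N) (op_exp z H u)"
      unfolding comm[symmetric] by (simp add: op_exp_def scaleC_scaleC a_def)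
    also have "norm \<dots> \<le> 2 * (exp (Re z) + K ^ N * exp (- \<theta> * Re z))"
      unfolding H_def K_def by (rule norm_push_power_exp_le[OF u c \<theta>(1) exp_bound])
    also have "\<dots> \<le> 2 * (exp (real k) + K ^ N * exp (\<theta> * real k))"
    proof -
      have "- Re z \<le> real k" "Re z \<le> real k" using abs_Re_le_cmod[of z] z by auto
      then have "\<theta> * - Re z \<le> \<theta> * real k" "Re z \<le> real k" using \<theta>(1) mult_left_mono by blast+
      then show ?thesis by (intro mult_left_mono add_mono) (auto simp: K_def)
    qed
    finally show "norm (\<Sum>n. scaleC (z ^ n) (a n)) \<le> 2 * (exp (real k) + K ^ N * exp (\<theta> * real k))" .
  qed simp
  also have "K ^ N * exp (\<theta> * real k) \<le> exp 1 * exp (real k)"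
  proof -
    have "real N * (2 * c * (1 + \<theta>)) + \<theta> * real k = 2 * c * (1 + \<theta>) + real k * (4 * c * (1 + \<theta>) + \<theta>)"
      by (simp add: N_def algebra_simps)
    also have "\<dots> \<le> 1 + real k * 1"
      using \<theta> by (intro add_mono mult_left_mono) (auto simp: algebra_simps)
    finally show ?thesis
      by (simp add: K_def flip: exp_add exp_of_nat_mult)
  qed
  finally have "real k ^ k * norm (a k) \<le> 2 * (1 + exp 1) * exp (real k)"
    by (simp add: algebra_simps)
  moreover have "a k = scaleC (1 / fact k) ((push c u ^^ N) (odd_power u k))"
    unfolding a_def commHn by (simp add: odd_power_def H_def)
  ultimately have "real k ^ k * norm ((push c u ^^ N) (odd_power u k)) \<le> 2 * (1 + exp 1) * exp (real k) * fact k"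
    by (simp add: norm_scaleC norm_divide field_simps)
  also have "\<dots> \<le> 2 * (1 + exp 1) * exp (real k) * (exp 1 * real k * (real k / exp 1) ^ k)"
    using fact_le_power_exp[OF \<open>k > 0\<close>] by (intro mult_left_mono) (auto intro: add_nonneg_nonneg)
  also have "\<dots> = real k ^ k * (2 * exp 1 * (1 + exp 1) * real k)"
    by (simp add: power_divide flip: exp_of_nat_mult)
  finally show ?thesis using \<open>k > 0\<close> by (simp add: N_def)
qed

text \<open>
  Iterated cubing turns \<open>push c u u\<close> into \<open>push c u ^^ (2 k + 1)\<close> applied to the odd power of index \<open>k\<close>, where
  \<open>2 k + 1 = 3 ^ n\<close>.  A norm above one would grow exponentially in \<open>k\<close>, against the linear bound.
\<close>

lemma norm_push_le:
  assumes u: "norm u \<le> 1"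
  obtains c where "0 < c" "c \<le> 1" "norm (push c u u) \<le> 1"
proof -
  obtain \<theta> where \<theta>: "0 \<le> \<theta>" "\<theta> < 1"
    and exp_bound: "\<And>z. norm (op_exp z (T u u) u) \<le> 2 * (exp (Re z) + exp (- \<theta> * Re z))"
    using exp_decay[OF u] by metis
  \<comment> \<open>small enough for \<open>4 c (1 + \<theta>) \<le> 1 - \<theta>\<close>, since \<open>\<theta> < 1\<close>\<close>
  define c where "c = (1 - \<theta>) / 8"
  have c: "0 < c" "c \<le> 1" using \<theta> by (auto simp: c_def)
  have "4 * c * (1 + \<theta>) \<le> 4 * c * 2" using \<theta> c by (intro mult_left_mono) auto
  then have c4: "4 * c * (1 + \<theta>) \<le> 1 - \<theta>" by (simp add: c_def)
  define k where "k n = (3 ^ n - 1) div (2 :: nat)" for n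
  have k3: "2 * k n + 1 = 3 ^ n" for n
  proof -
    have "odd ((3::nat) ^ n)" by simp
    then show ?thesis by (auto simp: k_def elim!: oddE)
  qed
  have kSuc: "k n + k n + k n + 1 = k (Suc n)" for n using k3[of n] k3[of "Suc n"] by simp
  have cube: "norm ((push c u ^^ (2 * k n + 1)) (odd_power u (k n))) = norm (push c u u) ^ 3 ^ n" for n
  proof (induction n)
    case 0
    show ?case by (simp add: k_def)
  next
    case (Suc n)
    let ?x = "(push c u ^^ (2 * k n + 1)) (odd_power u (k n))"
    have "norm (push c u u) ^ 3 ^ Suc n = norm ?x ^ 3"
      unfolding Suc by (simp add: mult.commute flip: power_mult)
    also have "\<dots> = norm (T ?x ?x ?x)" by (rule norm_cube[symmetric])
    also have "T ?x ?x ?x = (push c u ^^ (2 * k (Suc n) + 1)) (odd_power u (k (Suc n)))"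
    proof -
      have "(2 * k n + 1) + (2 * k n + 1) + (2 * k n + 1) = 2 * k (Suc n) + 1" using kSuc[of n] by simp
      then show ?thesis by (simp only: triple_push_power kSuc)
    qed
    finally show ?case by simp
  qed
  have "norm (push c u u) \<le> 1"
  proof (rule ccontr)
    define s where "s = norm (push c u u) - 1"
    define C where "C = 2 * exp 1 * (1 + exp 1 :: real)"
    assume "\<not> norm (push c u u) \<le> 1"
    then have s: "s > 0" by (simp add: s_def)
    obtain n where n: "C / s\<^sup>2 < real n" using reals_Archimedean2 by blast
    have "C > 0" by (simp add: C_def add_pos_pos)
    then have "n > 0" using n s by (auto intro!: gr0I simp: divide_less_0_iff)
    have "n \<le> k n"
    proof -
      have "2 * m + 1 \<le> 3 ^ m" for m :: nat by (induction m) auto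
      then show ?thesis using k3[of n] by (metis add_le_cancel_right nat_mult_le_cancel_disj zero_less_numeral mult_le_cancel1)
    qed
    then have "k n > 0" using \<open>n > 0\<close> by simp
    have "1 + real (k n) * s \<le> (1 + s) ^ k n"
      using s by (intro Bernoulli_inequality) simp
    then have "(real (k n) * s)\<^sup>2 \<le> ((1 + s) ^ k n)\<^sup>2"
      using s by (intro power_mono) auto
    also have "\<dots> \<le> (1 + s) ^ (2 * k n + 1)"
      unfolding power_mult[symmetric] using s by (intro power_increasing) auto
    also have "\<dots> = norm ((push c u ^^ (2 * k n + 1)) (odd_power u (k n)))"
      unfolding cube unfolding k3 by (simp add: s_def)
    also have "\<dots> \<le> C * real (k n)"
      unfolding C_def using norm_push_power_odd_power_le[OF u _ \<theta>(1) c4 exp_bound \<open>k n > 0\<close>] c by simp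
    finally have "real (k n) * s\<^sup>2 \<le> C"
      using \<open>k n > 0\<close> by (simp add: power2_eq_square mult_ac)
    moreover have "real n * s\<^sup>2 \<le> real (k n) * s\<^sup>2" using \<open>n \<le> k n\<close> by (intro mult_right_mono) auto
    moreover have "C < real n * s\<^sup>2" using n s by (simp add: pos_divide_less_eq)
    ultimately show False by simp
  qed
  with c show ?thesis by (rule that)
qed

text \<open>
  Both \<open>u + d\<close> and \<open>u - d\<close> lie in the ball for \<open>d = c (u - T u u u)\<close>.
\<close>

lemma extreme_point_tripotent:
  assumes u: "u extreme_point_of cball 0 1"
  shows "T u u u = u"
proof -
  have u1: "norm u \<le> 1" using u by (auto simp: extreme_point_of_def)
  then obtain c where c: "0 < c" "c \<le> 1" "norm (push c u u) \<le> 1" by (rule norm_push_le)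
  define d where "d = c *\<^sub>R (u - T u u u)"
  have "norm (u + d) \<le> 1" using c(3) by (simp add: push_def d_def)
  moreover have "norm (u - d) \<le> 1"
  proof -
    have "u - d = (1 - c) *\<^sub>R u + c *\<^sub>R T u u u" by (simp add: d_def algebra_simps)
    also have "norm \<dots> \<le> (1 - c) * norm u + c * norm (T u u u)"
      using c by (intro order_trans[OF norm_triangle_ineq]) simp
    also have "\<dots> \<le> (1 - c) * 1 + c * 1"
      using u1 c by (intro add_mono mult_left_mono) (auto simp: norm_cube power_le_one)
    finally show ?thesis by simp
  qed
  ultimately have "d = 0" by (rule extreme_point_of_cballD[OF u])
  then show ?thesis using c by (simp add: d_def)
qed

end

section \<open>Existence of extreme points\<close>

text \<open>
  The existence part of the Krein--Milman theorem in a space of functions with the product topology.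
  Faces are ordered by inclusion, and Zorn's lemma is applied to their complements; a minimal face is
  a single point because the maximum set of a real-linear evaluation functional is again a face.
\<close>

lemma exists_extreme_function:
  fixes B :: "('p \<Rightarrow> complex) set"
  assumes "compact B" "closed B" "B \<noteq> {}"
  obtains \<phi> where "\<phi> \<in> B"
    "\<And>\<alpha> \<beta>. \<alpha> \<in> B \<Longrightarrow> \<beta> \<in> B \<Longrightarrow> \<phi> = (\<lambda>p. (\<alpha> p + \<beta> p) / 2) \<Longrightarrow> \<alpha> = \<phi>"
proof -
  define face where "face S \<longleftrightarrow> S \<subseteq> B \<and> S \<noteq> {} \<and> closed S \<and>
    (\<forall>\<alpha>\<in>B. \<forall>\<beta>\<in>B. (\<lambda>p. (\<alpha> p + \<beta> p) / 2) \<in> S \<longrightarrow> \<alpha> \<in> S \<and> \<beta> \<in> S)" for S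
  have "\<exists>M\<in>uminus ` Collect face. \<forall>X\<in>uminus ` Collect face. M \<subseteq> X \<longrightarrow> X = M"
  proof (rule subset_Zorn_nonempty)
    have "face B" using assms by (simp add: face_def)
    then show "uminus ` Collect face \<noteq> {}" by blast
    fix \<C> :: "('p \<Rightarrow> complex) set set"
    assume "\<C> \<noteq> {}" and chain: "subset.chain (uminus ` Collect face) \<C>"
    define \<D> where "\<D> = uminus ` \<C>"
    have faceD: "face S" if "S \<in> \<D>" for S
      using that chain by (auto simp: \<D>_def subset.chain_def)
    have chainD: "S \<subseteq> S' \<or> S' \<subseteq> S" if "S \<in> \<D>" "S' \<in> \<D>" for S S'
      using that chain unfolding \<D>_def subset_chain_def by blast
    have "B \<inter> \<Inter>\<D> \<noteq> {}"
    proof (rule compact_imp_fip[OF \<open>compact B\<close>])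
      show "closed S" if "S \<in> \<D>" for S using faceD[OF that] by (simp add: face_def)
      fix F assume F: "finite F" "F \<subseteq> \<D>"
      show "B \<inter> \<Inter>F \<noteq> {}"
      proof (cases "F = {}")
        case False
        have "subset.chain \<D> F" using F chainD by (auto simp: subset_chain_def)
        then have "\<Inter>F \<in> F" using F False by (intro Inter_in_chain)
        then have "face (\<Inter>F)" using F faceD by blast
        then have "\<Inter>F \<subseteq> B" "\<Inter>F \<noteq> {}" by (simp_all add: face_def)
        then show ?thesis by blast
      qed (use assms in auto)
    qed
    then have "\<Inter>\<D> \<noteq> {}" by blast
    moreover have "\<D> \<noteq> {}" using \<open>\<C> \<noteq> {}\<close> by (simp add: \<D>_def)
    moreover have "closed (\<Inter>\<D>)" using faceD by (intro closed_Inter) (simp add: face_def)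
    moreover have "\<Inter>\<D> \<subseteq> B" using \<open>\<D> \<noteq> {}\<close> faceD unfolding face_def by blast
    moreover have "\<alpha> \<in> \<Inter>\<D> \<and> \<beta> \<in> \<Inter>\<D>" if "\<alpha> \<in> B" "\<beta> \<in> B" "(\<lambda>p. (\<alpha> p + \<beta> p) / 2) \<in> \<Inter>\<D>" for \<alpha> \<beta>
      using faceD that unfolding face_def by blast
    ultimately have "face (\<Inter>\<D>)" unfolding face_def by blast
    moreover have "\<Union>\<C> = - \<Inter>\<D>" by (auto simp: \<D>_def)
    ultimately show "\<Union>\<C> \<in> uminus ` Collect face" by blast
  qed
  then obtain S where S: "face S" and minimal: "\<And>S'. face S' \<Longrightarrow> S' \<subseteq> S \<Longrightarrow> S' = S"
    by (auto simp: image_iff)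
  obtain \<phi> where "\<phi> \<in> S" using S by (auto simp: face_def)
  have single: "\<psi> = \<phi>" if "\<psi> \<in> S" for \<psi>
  proof (rule ext, rule ccontr)
    fix p assume neq: "\<psi> p \<noteq> \<phi> p"
    define h where "h \<alpha> = Re (cnj (\<psi> p - \<phi> p) * \<alpha> p)" for \<alpha> :: "'p \<Rightarrow> complex"
    have cont: "continuous_on UNIV h"
      unfolding h_def by (intro continuous_intros continuous_on_product_coordinates)
    have "compact (B \<inter> S)" using S \<open>compact B\<close> by (intro compact_Int_closed) (auto simp: face_def)
    moreover have "B \<inter> S = S" using S by (auto simp: face_def)
    ultimately have "compact S" by simp
    moreover have "S \<noteq> {}" using S by (simp add: face_def)
    ultimately obtain \<mu> where \<mu>: "\<mu> \<in> S" "\<And>\<alpha>. \<alpha> \<in> S \<Longrightarrow> h \<alpha> \<le> h \<mu>"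
      using continuous_attains_sup[of S h] continuous_on_subset[OF cont] by blast
    define S' where "S' = {\<alpha>\<in>S. h \<alpha> = h \<mu>}"
    have "face S'"
      unfolding face_def
    proof (intro conjI ballI impI)
      show "S' \<subseteq> B" "S' \<noteq> {}" using S \<mu> by (auto simp: S'_def face_def)
      have "closed (S \<inter> {\<alpha>. h \<alpha> = h \<mu>})"
        using S cont by (intro closed_Int closed_Collect_eq) (auto simp: face_def)
      then show "closed S'" by (simp add: S'_def Int_def)
      fix \<alpha> \<beta> assume ab: "\<alpha> \<in> B" "\<beta> \<in> B" and mid: "(\<lambda>p. (\<alpha> p + \<beta> p) / 2) \<in> S'"
      then have abS: "\<alpha> \<in> S" "\<beta> \<in> S" using S by (auto simp: S'_def face_def)
      have "h (\<lambda>p. (\<alpha> p + \<beta> p) / 2) = (h \<alpha> + h \<beta>) / 2"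
        by (simp add: h_def field_simps)
      then have "h \<alpha> + h \<beta> = 2 * h \<mu>" using mid by (simp add: S'_def)
      then have "h \<alpha> = h \<mu>" "h \<beta> = h \<mu>" using \<mu>(2)[OF abS(1)] \<mu>(2)[OF abS(2)] by linarith+
      then show "\<alpha> \<in> S'" "\<beta> \<in> S'" using abS by (auto simp: S'_def)
    qed
    then have "S' = S" by (rule minimal) (auto simp: S'_def)
    then have "\<psi> \<in> S'" "\<phi> \<in> S'" using that \<open>\<phi> \<in> S\<close> by simp_all
    then have "h \<psi> = h \<phi>" by (simp add: S'_def)
    then have "Re (cnj (\<psi> p - \<phi> p) * (\<psi> p - \<phi> p)) = 0"
      by (simp add: h_def algebra_simps)
    moreover have "Re (cnj (\<psi> p - \<phi> p) * (\<psi> p - \<phi> p)) = (cmod (\<psi> p - \<phi> p))\<^sup>2"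
      by (metis Re_complex_of_real complex_norm_square mult.commute)
    ultimately show False using neq by simp
  qed
  show ?thesis
  proof (rule that)
    show "\<phi> \<in> B" using S \<open>\<phi> \<in> S\<close> by (auto simp: face_def)
    fix \<alpha> \<beta> assume "\<alpha> \<in> B" "\<beta> \<in> B" "\<phi> = (\<lambda>p. (\<alpha> p + \<beta> p) / 2)"
    then have "\<alpha> \<in> S" using S \<open>\<phi> \<in> S\<close> unfolding face_def by blast
    then show "\<alpha> = \<phi>" by (rule single)
  qed
qed

text \<open>
  The unit ball of a dual space, seen as a set of functionals, is compact for pointwise convergence.
\<close>

lemma dual_ball_extreme_point:
  assumes dual: "is_dual_of TYPE('a::complex_banach) TYPE('p::complex_banach)"
  obtains u :: "'a::complex_banach" where "u extreme_point_of cball 0 1"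
proof -
  obtain J :: "'a \<Rightarrow> 'p \<Rightarrow> complex" where bij: "bij_betw J UNIV {f. bounded_clinear f}"
    and add: "\<And>x y p. J (x + y) p = J x p + J y p" and scale: "\<And>c x p. J (scaleC c x) p = c * J x p"
    and norm: "\<And>x. onorm (J x) = norm x"
    using dual unfolding is_dual_of_def by blast
  define B where "B = {\<phi> :: 'p \<Rightarrow> complex. clinear \<phi> \<and> (\<forall>p. cmod (\<phi> p) \<le> norm p)}"
  have bl: "bounded_linear (J x)" for x
    using bij by (intro bounded_clinear_bounded_linear) (auto dest: bij_betwE)
  have BJ: "J x \<in> B \<longleftrightarrow> norm x \<le> 1" for x
  proof
    assume "J x \<in> B"
    then have "onorm (J x) \<le> 1" by (intro onorm_bound) (auto simp: B_def)
    then show "norm x \<le> 1" by (simp add: norm)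
  next
    assume x: "norm x \<le> 1"
    have "cmod (J x p) \<le> norm p" for p
      using onorm[OF bl, of x p] mult_right_mono[OF x norm_ge_zero[of p]] by (simp add: norm)
    moreover have "clinear (J x)" using bij by (auto dest!: bij_betwE simp: bounded_clinear_def)
    ultimately show "J x \<in> B" by (simp add: B_def)
  qed
  have "closed B"
  proof -
    have "B = {\<phi>. (\<forall>x y. \<phi> (x + y) = \<phi> x + \<phi> y)} \<inter> {\<phi>. \<forall>c x. \<phi> (scaleC c x) = c * \<phi> x}
        \<inter> {\<phi>. \<forall>p. cmod (\<phi> p) \<le> norm p}"
      by (auto simp: B_def clinear_def scaleC_complex_def)
    also have "closed \<dots>"
      by (intro closed_Int closed_Collect_all closed_Collect_eq closed_Collect_le
          continuous_intros continuous_on_product_coordinates)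
    finally show ?thesis .
  qed
  have "compactin (product_topology (\<lambda>p. euclidean) UNIV) (PiE UNIV (\<lambda>p. cball 0 (norm (p :: 'p)) :: complex set))"
    by (simp add: compactin_PiE)
  then have "compact (PiE UNIV (\<lambda>p. cball 0 (norm (p :: 'p)) :: complex set))"
    by (simp add: euclidean_product_topology)
  then have "compact (PiE UNIV (\<lambda>p. cball 0 (norm (p :: 'p)) :: complex set) \<inter> B)"
    using \<open>closed B\<close> by (rule compact_Int_closed)
  moreover have "PiE UNIV (\<lambda>p. cball 0 (norm (p :: 'p)) :: complex set) \<inter> B = B"
    by (auto simp: B_def)
  ultimately have "compact B" by simp
  moreover have "J 0 \<in> B" by (simp add: BJ)
  ultimately obtain \<phi> where \<phi>: "\<phi> \<in> B"
    "\<And>\<alpha> \<beta>. \<alpha> \<in> B \<Longrightarrow> \<beta> \<in> B \<Longrightarrow> \<phi> = (\<lambda>p. (\<alpha> p + \<beta> p) / 2) \<Longrightarrow> \<alpha> = \<phi>"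
    using exists_extreme_function[of B] \<open>closed B\<close> by blast
  have "bounded_clinear \<phi>"
    using \<phi>(1) unfolding bounded_clinear_def B_def by (auto intro!: exI[of _ 1])
  then obtain u where u: "J u = \<phi>" using bij by (auto simp: bij_betw_def) (metis (no_types, lifting) imageE mem_Collect_eq)
  have "u extreme_point_of cball 0 1"
  proof (rule extreme_point_of_cballI)
    show "norm u \<le> 1" using \<phi>(1) u BJ by blast
    fix d assume d: "norm (u + d) \<le> 1" "norm (u - d) \<le> 1"
    have "\<phi> = (\<lambda>p. (J (u + d) p + J (u - d) p) / 2)"
    proof
      fix p
      have "J (u + d) p + J (u - d) p = J ((u + d) + (u - d)) p" by (rule add[symmetric])
      also have "(u + d) + (u - d) = u + u" by simp
      finally show "\<phi> p = (J (u + d) p + J (u - d) p) / 2" by (simp add: add u)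
    qed
    then have "J (u + d) = \<phi>" using \<phi>(2)[of "J (u + d)" "J (u - d)"] d BJ by blast
    then have "u + d = u" using bij u by (metis bij_betw_imp_inj_on injD)
    then show "d = 0" by simp
  qed
  then show ?thesis by (rule that)
qed

section \<open>Peirce theory of an extreme tripotent\<close>

context jb_triple
begin

text \<open>
  With \<open>L = L(u, u)\<close> and \<open>Q v = T u v u\<close>: \<open>L Q = Q\<close>, \<open>Q L = Q\<close> and \<open>Q Q = 2 L L - L\<close>.
\<close>

lemma tripotent_identities:
  assumes u: "T u u u = u"
  shows "T u u (T u v u) = T u v u" "T u (T u u v) u = T u v u"
    "T u (T u v u) u = 2 *\<^sub>R T u u (T u u v) - T u u v"
proof -
  have 1: "T u v u = 2 *\<^sub>R T u u (T u v u) - T u (T u u v) u"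
    using jordan_identity[of u v u u u] u symmetric[of "T u v u" u u] symmetric[of v u u]
    by (simp add: scaleR_2)
  have 2: "T u u (T u v u) = 2 *\<^sub>R T u v u - T u (T u u v) u"
    using jordan_identity[of u u u v u] u by (simp add: scaleR_2)
  have "3 *\<^sub>R (T u u (T u v u) - T u v u) = 0"
  proof -
    have "T u u (T u v u) - T u v u = (2 *\<^sub>R T u v u - T u (T u u v) u) - (2 *\<^sub>R T u u (T u v u) - T u (T u u v) u)"
      by (rule arg_cong2[where f = "(-)", OF 2 1])
    also have "\<dots> = - (2 *\<^sub>R (T u u (T u v u) - T u v u))" by (simp add: algebra_simps)
    finally have "1 *\<^sub>R (T u u (T u v u) - T u v u) + 2 *\<^sub>R (T u u (T u v u) - T u v u) = 0"
      by (simp add: eq_neg_iff_add_eq_0)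
    then show ?thesis by (simp only: flip: scaleR_add_left) simp
  qed
  then show 3: "T u u (T u v u) = T u v u" by simp
  show "T u (T u u v) u = T u v u" using 2 by (simp add: 3 scaleR_2)
  show "T u (T u v u) u = 2 *\<^sub>R T u u (T u u v) - T u u v"
    using jordan_identity[of v u u u u] u symmetric[of "T u u v" u u] symmetric[of v u u]
    by (simp add: scaleR_2 algebra_simps)
qed

text \<open>
  \<open>L(u, u)\<close> is annihilated by the polynomial \<open>X (2 X - 1) (X - 1)\<close>.
\<close>

lemma tripotent_cubic:
  assumes u: "T u u u = u"
  shows "T u u (2 *\<^sub>R T u u (T u u v) - 3 *\<^sub>R T u u v + v) = 0"
proof -
  note Q2 = tripotent_identities(3)[OF u, of v]
  have "2 *\<^sub>R T u u (T u u (T u u v)) - T u u (T u u v) = T u u (T u (T u v u) u)"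
    unfolding Q2 by (simp add: T_diff T_scaleR)
  also have "\<dots> = 2 *\<^sub>R T u u (T u u v) - T u u v"
    unfolding tripotent_identities(1)[OF u] by (rule Q2)
  finally have "2 *\<^sub>R T u u (T u u (T u u v)) = (1 *\<^sub>R T u u (T u u v) + 2 *\<^sub>R T u u (T u u v)) - T u u v"
    by (simp add: algebra_simps)
  then have "2 *\<^sub>R T u u (T u u (T u u v)) = 3 *\<^sub>R T u u (T u u v) - T u u v"
    by (simp only: flip: scaleR_add_left) simp
  then show ?thesis by (simp add: T_diff T_scaleR T_add)
qed

text \<open>
  On the kernel of \<open>L(u, u)\<close> one has \<open>Q x = 0\<close>, and two instances of the Jordan identity evaluate the
  commutator of \<open>L(u, u)\<close> with \<open>L(u, x)\<close> as \<open>L(u, x)\<close> and as \<open>0\<close>; likewise for \<open>L(x, u)\<close>.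
\<close>

lemma orthogonal_tripotent:
  assumes u: "T u u u = u" and x: "T u u x = 0"
  shows "T u x y = 0" "T x u y = 0"
proof -
  have Qx: "T u x u = 0" using tripotent_identities(2)[OF u, of x] x by (simp add: T_zero)
  have xu: "T x u u = 0" using x symmetric[of x u u] by simp
  have "T u u (T u x y) = T u x (T u u y) + T u x y"
    using jordan_identity[of u u u x y] u x by (simp add: T_zero)
  moreover have "T u x (T u u y) = T u u (T u x y)"
    using jordan_identity[of u x u u y] Qx xu by (simp add: T_zero)
  ultimately show "T u x y = 0" by simp
  have "T u u (T x u y) = T x u (T u u y) - T x u y"
    using jordan_identity[of u u x u y] u x by (simp add: T_zero)
  moreover have "T x u (T u u y) = T u u (T x u y)"
    using jordan_identity[of x u u u y] Qx xu by (simp add: T_zero)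
  ultimately show "T x u y = 0" by simp
qed

text \<open>
  The cube of \<open>u + x\<close> is \<open>u + T x x x\<close>, so all iterated cubes have norm at most \<open>2\<close>.
\<close>

lemma norm_add_orthogonal_le:
  assumes u: "T u u u = u" "norm u \<le> 1" and x: "T u u x = 0" "norm x \<le> 1"
  shows "norm (u + x) \<le> 1"
proof -
  have "norm (u + x) ^ 3 ^ n \<le> 2" if "T u u x = 0" "norm x \<le> 1" for n x
    using that
  proof (induction n arbitrary: x)
    case 0
    then show ?case using norm_triangle_ineq[of u x] u(2) by simp
  next
    case (Suc n)
    note orth = orthogonal_tripotent[OF u(1) Suc.prems(1)]
    have "T x x u = 0" using orth(1)[of x] symmetric[of x x u] by simp
    then have "T (u + x) (u + x) (u + x) = u + T x x x"
      using u Suc.prems(1) by (simp add: T_add orth)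
    then have "norm (u + x) ^ 3 = norm (u + T x x x)" by (metis norm_cube)
    moreover have "T u u (T x x x) = 0"
      using jordan_identity[of u u x x x] Suc.prems(1) by (simp add: T_zero)
    moreover have "norm (T x x x) \<le> 1" using Suc.prems(2) by (simp add: norm_cube power_le_one)
    ultimately show ?case using Suc.IH[of "T x x x"] by (simp add: power_mult)
  qed
  then show ?thesis using x by (intro le_one_if_powers_bounded[of _ 2]) blast
qed

text \<open>
  For an extreme point the kernel of \<open>L = L(u, u)\<close> is trivial, so the cubic relation
  reduces to \<open>2 L L - 3 L + 1 = 0\<close>, which makes \<open>L\<close> invertible with inverse \<open>3 - 2 L\<close>.
\<close>

lemma extreme_point_L_surj:
  assumes u: "u extreme_point_of cball 0 1"
  shows "T u u (3 *\<^sub>R v - 2 *\<^sub>R T u u v) = v"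
proof -
  have tri: "T u u u = u" using u by (rule extreme_point_tripotent)
  have u1: "norm u \<le> 1" using u by (rule extreme_point_cball_norm_le)
  define y where "y = 2 *\<^sub>R T u u (T u u v) - 3 *\<^sub>R T u u v + v"
  have y: "T u u y = 0" unfolding y_def by (rule tripotent_cubic[OF tri])
  have "y = 0"
  proof (rule ccontr)
    assume "y \<noteq> 0"
    define d where "d = (1 / norm y) *\<^sub>R y"
    have d: "T u u d = 0" "norm d \<le> 1" "T u u (- d) = 0" "norm (- d) \<le> 1"
      using y by (simp_all add: d_def T_scaleR T_minus)
    have "norm (u + d) \<le> 1" by (rule norm_add_orthogonal_le[OF tri u1 d(1,2)])
    moreover have "norm (u + - d) \<le> 1" by (rule norm_add_orthogonal_le[OF tri u1 d(3,4)])
    ultimately have "d = 0" using extreme_point_of_cballD[OF u, of d] by simp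
    then show False using \<open>y \<noteq> 0\<close> by (simp add: d_def)
  qed
  then show ?thesis by (simp add: y_def T_diff T_scaleR algebra_simps eq_neg_iff_add_eq_0)
qed

lemma extreme_point_op_exp:
  assumes u: "u extreme_point_of cball 0 1"
  shows "op_exp (\<i> * of_real t) (T c c) u extreme_point_of cball 0 1"
proof -
  let ?E = "\<lambda>t. op_exp (\<i> * of_real t) (T c c)"
  have cancel: "?E (- t) (?E t x) = x" "?E t (?E (- t) x) = x" for x
    using op_exp_minus_cancel[OF bounded_clinear_L, of "\<i> * of_real (- t)" c x]
      op_exp_minus_cancel[OF bounded_clinear_L, of "\<i> * of_real t" c x] by simp_all
  note lin = bounded_linear_op_exp[OF bounded_clinear_L, of "\<i> * of_real (- t)" c]
  show ?thesis
  proof (rule extreme_point_of_cballI)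
    show "norm (?E t u) \<le> 1" unfolding norm_op_exp_L using u by (rule extreme_point_cball_norm_le)
    fix d assume d: "norm (?E t u + d) \<le> 1" "norm (?E t u - d) \<le> 1"
    have "norm (?E (- t) (?E t u + d)) \<le> 1" "norm (?E (- t) (?E t u - d)) \<le> 1"
      unfolding norm_op_exp_L by (rule d)+
    then have "norm (u + ?E (- t) d) \<le> 1" "norm (u - ?E (- t) d) \<le> 1"
      using linear_add[OF bounded_linear.linear[OF lin]] linear_diff[OF bounded_linear.linear[OF lin]]
      by (simp_all only: cancel)
    then have "?E (- t) d = 0" by (rule extreme_point_of_cballD[OF u])
    then have "norm d = 0" using norm_op_exp_L[of "- t" c d] by simp
    then show "d = 0" by simp
  qed
qed

lemma extreme_point_scaleC:
  fixes u :: 'a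
  assumes u: "u extreme_point_of cball 0 1" and s: "cmod s = 1"
  shows "scaleC s u extreme_point_of cball (0 :: 'a) 1"
proof (rule extreme_point_of_cballI)
  show "norm (scaleC s u) \<le> 1" using extreme_point_cball_norm_le[OF u] s by (simp add: norm_scaleC)
  have "s \<noteq> 0" using s by auto
  have inv: "scaleC (inverse s) (scaleC s u) = u" "cmod (inverse s) = 1"
    using s by (auto simp: scaleC_scaleC norm_inverse left_inverse[OF \<open>s \<noteq> 0\<close>])
  fix d assume "norm (scaleC s u + d) \<le> 1" "norm (scaleC s u - d) \<le> 1"
  then have "norm (scaleC (inverse s) (scaleC s u + d)) \<le> 1" "norm (scaleC (inverse s) (scaleC s u - d)) \<le> 1"
    using inv by (simp_all add: norm_scaleC)
  then have "norm (u + scaleC (inverse s) d) \<le> 1" "norm (u - scaleC (inverse s) d) \<le> 1"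
    by (simp_all only: scaleC_add_right scaleC_diff_right inv)
  then have "scaleC (inverse s) d = 0" by (rule extreme_point_of_cballD[OF u])
  then have "scaleC s (scaleC (inverse s) d) = 0" by simp
  then show "d = 0" by (simp add: scaleC_scaleC right_inverse[OF \<open>s \<noteq> 0\<close>])
qed

text \<open>
  Thus \<open>L(u, u) v\<close> is a combination of four vectors \<open>L(c, c) u\<close>.
\<close>

lemma polarization:
  "4 *\<^sub>R T v u u = T (u + v) (u + v) u - T (u - v) (u - v) u
     - scaleC \<i> (T (u + scaleC \<i> v) (u + scaleC \<i> v) u) + scaleC \<i> (T (u - scaleC \<i> v) (u - scaleC \<i> v) u)"
proof -
  have 1: "T (u + w) (u + w) u - T (u - w) (u - w) u = 2 *\<^sub>R (T u w u + T w u u)" for w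
    by (simp add: T_add T_diff scaleR_2)
  have 2: "T u (scaleC \<i> v) u + T (scaleC \<i> v) u u = scaleC \<i> (T v u u - T u v u)"
    by (simp add: T_scaleC scaleC_minus_left scaleC_diff_right)
  have "T (u + v) (u + v) u - T (u - v) (u - v) u
     - scaleC \<i> (T (u + scaleC \<i> v) (u + scaleC \<i> v) u) + scaleC \<i> (T (u - scaleC \<i> v) (u - scaleC \<i> v) u)
    = (T (u + v) (u + v) u - T (u - v) (u - v) u)
     - scaleC \<i> (T (u + scaleC \<i> v) (u + scaleC \<i> v) u - T (u - scaleC \<i> v) (u - scaleC \<i> v) u)"
    by (simp add: scaleC_diff_right)
  also have "\<dots> = 2 *\<^sub>R (T u v u + T v u u) - scaleC \<i> (2 *\<^sub>R scaleC \<i> (T v u u - T u v u))"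
    unfolding 1 2 ..
  also have "\<dots> = 2 *\<^sub>R (T u v u + T v u u) + 2 *\<^sub>R (T v u u - T u v u)"
    by (simp add: scaleC_scaleR scaleC_scaleC scaleC_minus_left scaleR_diff_right)
  also have "\<dots> = 4 *\<^sub>R T v u u" by (simp add: algebra_simps flip: scaleR_add_left)
  finally show ?thesis by simp
qed

text \<open>
  For small \<open>t\<close> the vector \<open>L(c, c) u\<close> is close to the difference quotient \<open>(exp (i t L(c, c)) u - u) / (i t)\<close>, which is a
  multiple of a combination of extreme points; and every \<open>x\<close> is \<open>L(u, u) v\<close> with \<open>v\<close> of controlled norm.
\<close>

lemma hull_half_approximation:
  fixes u :: 'a
  assumes u: "u extreme_point_of cball 0 1"
  obtains r where "r > 0" "\<And>x. norm x \<le> 1 \<Longrightarrow>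
    \<exists>h \<in> convex hull {e. e extreme_point_of cball (0 :: 'a) 1}. norm (x - r *\<^sub>R h) \<le> 1/2"
proof -
  define S where "S = convex hull {e. e extreme_point_of cball (0 :: 'a) 1}"
  obtain K where "K \<ge> 0" and K: "\<And>a b c. norm (T a b c) \<le> K * norm a * norm b * norm c"
    using norm_triple_bound by blast
  have u1: "norm u \<le> 1" using u by (rule extreme_point_cball_norm_le)
  have SE: "e \<in> S" if "e extreme_point_of cball 0 1" for e
    unfolding S_def using that by (intro hull_inc) simp
  have Smid: "(1/2) *\<^sub>R (a + b) \<in> S" if "a \<in> S" "b \<in> S" for a b
    using convex_midpoint[OF convex_convex_hull] that unfolding S_def .
  have Sscale: "scaleC s a \<in> S" if "a \<in> S" "cmod s = 1" for a s
  proof -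
    have "scaleC s ` S = convex hull (scaleC s ` {e. e extreme_point_of cball 0 1})"
      unfolding S_def by (rule convex_hull_linear_image[OF bounded_linear.linear[OF bounded_linear_scaleC]])
    also have "\<dots> \<subseteq> S"
      unfolding S_def using extreme_point_scaleC[OF _ \<open>cmod s = 1\<close>] by (intro hull_mono) auto
    finally show ?thesis using that by auto
  qed
  \<comment> \<open>bounds the norms of \<open>u + s v\<close> with \<open>cmod s = 1\<close>, where \<open>v = 3 x - 2 T u u x\<close>\<close>
  define m where "m = 1 + (3 + 2 * K)"
  define \<kappa> where "\<kappa> = exp (K * m\<^sup>2)"
  define t where "t = 1 / (2 * \<kappa>)"
  have \<kappa>: "\<kappa> \<ge> 1" using \<open>K \<ge> 0\<close> by (simp add: \<kappa>_def)
  have t: "0 < t" "t \<le> 1" using \<kappa> by (auto simp: t_def)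
  have approx: "\<exists>h\<in>S. norm (T c c u - (2 / t) *\<^sub>R h) \<le> 1/2" if c: "norm c \<le> m" for c
  proof -
    define g where "g = op_exp (\<i> * of_real t) (T c c) u"
    define h where "h = scaleC (- \<i>) ((1/2) *\<^sub>R (g + scaleC (- 1) u))"
    have "h \<in> S"
      unfolding h_def g_def using u extreme_point_op_exp[OF u]
      by (intro Sscale Smid SE extreme_point_scaleC) auto
    have L: "norm (T c c x) \<le> K * m\<^sup>2 * norm x" for x
    proof -
      have "norm (T c c x) \<le> K * (norm c)\<^sup>2 * norm x" using K[of c c x] by (simp add: power2_eq_square mult.assoc)
      also have "\<dots> \<le> K * m\<^sup>2 * norm x"
        using c \<open>K \<ge> 0\<close> by (intro mult_right_mono mult_left_mono power_mono) auto
      finally show ?thesis .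
    qed
    have "norm (g - u - scaleC (\<i> * of_real t) (T c c u)) \<le> (cmod (\<i> * of_real t))\<^sup>2 * exp (K * m\<^sup>2) * norm u"
      unfolding g_def using t \<open>K \<ge> 0\<close>
      by (intro norm_op_exp_remainder_le[OF bounded_clinear_L L]) (auto simp: norm_mult)
    also have "\<dots> \<le> t\<^sup>2 * \<kappa> * 1"
      using u1 t \<kappa> by (intro mult_mono) (auto simp: norm_mult \<kappa>_def)
    finally have rem: "norm (g - u - scaleC (\<i> * of_real t) (T c c u)) \<le> t\<^sup>2 * \<kappa>" by simp
    have "T c c u - (2 / t) *\<^sub>R h = (1 / t) *\<^sub>R scaleC \<i> (g - u - scaleC (\<i> * of_real t) (T c c u))"
    proof -
      have "(1 / t) *\<^sub>R scaleC \<i> (scaleC (\<i> * of_real t) (T c c u)) = - T c c u"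
      proof -
        have "scaleC \<i> (scaleC (\<i> * of_real t) (T c c u)) = scaleC (of_real (- t)) (T c c u)"
          by (simp add: scaleC_scaleC flip: mult.assoc)
        also have "\<dots> = - (t *\<^sub>R T c c u)" unfolding scaleC_of_real by simp
        finally show ?thesis using t by simp
      qed
      moreover have "(2 / t) *\<^sub>R h = - ((1 / t) *\<^sub>R scaleC \<i> (g - u))"
        by (simp add: h_def scaleC_minus_left scaleC_scaleR)
      ultimately show ?thesis by (simp add: scaleC_diff_right scaleR_diff_right)
    qed
    then have "norm (T c c u - (2 / t) *\<^sub>R h) = 1 / t * norm (g - u - scaleC (\<i> * of_real t) (T c c u))"
      using t by (simp add: norm_scaleC)
    also have "\<dots> \<le> 1 / t * (t\<^sup>2 * \<kappa>)" using rem t by (intro mult_left_mono) auto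
    also have "\<dots> = 1 / 2" using t \<kappa> by (simp add: t_def power2_eq_square)
    finally show ?thesis using \<open>h \<in> S\<close> by blast
  qed
  have "\<exists>h\<in>S. norm (x - (2 / t) *\<^sub>R h) \<le> 1/2" if x: "norm x \<le> 1" for x
  proof -
    define v where "v = 3 *\<^sub>R x - 2 *\<^sub>R T u u x"
    have "norm (T u u x) \<le> K"
    proof -
      have "K * norm u * norm u * norm x \<le> K * 1 * 1 * 1"
        using u1 x \<open>K \<ge> 0\<close> by (intro mult_mono) auto
      then show ?thesis using K[of u u x] by simp
    qed
    then have v: "norm v \<le> 3 + 2 * K"
      using norm_triangle_ineq4[of "3 *\<^sub>R x" "2 *\<^sub>R T u u x"] x by (simp add: v_def)
    have "T v u u = x"
      using extreme_point_L_surj[OF u, of x] symmetric[of v u u] by (simp add: v_def)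
    have m: "norm (u + v) \<le> m" "norm (u - v) \<le> m" "norm (u + scaleC \<i> v) \<le> m" "norm (u - scaleC \<i> v) \<le> m"
      using u1 v norm_triangle_ineq[of u v] norm_triangle_ineq4[of u v]
        norm_triangle_ineq[of u "scaleC \<i> v"] norm_triangle_ineq4[of u "scaleC \<i> v"]
      by (auto simp: m_def norm_scaleC)
    obtain h1 h2 h3 h4 where h: "h1 \<in> S" "h2 \<in> S" "h3 \<in> S" "h4 \<in> S"
      and e: "norm (T (u + v) (u + v) u - (2 / t) *\<^sub>R h1) \<le> 1/2" "norm (T (u - v) (u - v) u - (2 / t) *\<^sub>R h2) \<le> 1/2"
      "norm (T (u + scaleC \<i> v) (u + scaleC \<i> v) u - (2 / t) *\<^sub>R h3) \<le> 1/2"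
      "norm (T (u - scaleC \<i> v) (u - scaleC \<i> v) u - (2 / t) *\<^sub>R h4) \<le> 1/2"
      using approx m by metis
    define w where "w = (1/2) *\<^sub>R ((1/2) *\<^sub>R (h1 + scaleC (- 1) h2) + (1/2) *\<^sub>R (scaleC (- \<i>) h3 + scaleC \<i> h4))"
    have "w \<in> S" unfolding w_def by (intro Smid Sscale h) auto
    let ?d1 = "T (u + v) (u + v) u - (2 / t) *\<^sub>R h1" and ?d2 = "T (u - v) (u - v) u - (2 / t) *\<^sub>R h2"
      and ?d3 = "T (u + scaleC \<i> v) (u + scaleC \<i> v) u - (2 / t) *\<^sub>R h3"
      and ?d4 = "T (u - scaleC \<i> v) (u - scaleC \<i> v) u - (2 / t) *\<^sub>R h4"
    have "4 *\<^sub>R w = h1 - h2 - scaleC \<i> h3 + scaleC \<i> h4"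
      by (simp add: w_def scaleC_minus_left algebra_simps)
    then have E1: "(2 / t) *\<^sub>R (4 *\<^sub>R w) = (2 / t) *\<^sub>R (h1 - h2 - scaleC \<i> h3 + scaleC \<i> h4)" by (simp only:)
    have E2: "4 *\<^sub>R x = T (u + v) (u + v) u - T (u - v) (u - v) u
        - scaleC \<i> (T (u + scaleC \<i> v) (u + scaleC \<i> v) u) + scaleC \<i> (T (u - scaleC \<i> v) (u - scaleC \<i> v) u)"
      using polarization[of v u] by (simp only: \<open>T v u u = x\<close>)
    have "4 *\<^sub>R (x - (2 / t) *\<^sub>R w) = 4 *\<^sub>R x - (2 / t) *\<^sub>R (4 *\<^sub>R w)" by (simp add: algebra_simps)
    also have "\<dots> = ?d1 - ?d2 - scaleC \<i> ?d3 + scaleC \<i> ?d4"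
      unfolding E1 E2 by (simp add: algebra_simps scaleC_diff_right scaleC_scaleR)
    finally have "4 * norm (x - (2 / t) *\<^sub>R w) = norm (?d1 - ?d2 - scaleC \<i> ?d3 + scaleC \<i> ?d4)"
      by (metis norm_scaleR abs_numeral)
    also have "\<dots> \<le> norm ?d1 + norm ?d2 + norm (scaleC \<i> ?d3) + norm (scaleC \<i> ?d4)"
      by (intro order_trans[OF norm_triangle_ineq] order_trans[OF norm_triangle_ineq4] add_mono order_refl norm_triangle_ineq4)
    also have "\<dots> \<le> 1/2 + 1/2 + 1/2 + 1/2"
      unfolding norm_scaleC using e by (intro add_mono) auto
    finally show ?thesis using \<open>w \<in> S\<close> by (intro bexI[of _ w]) auto
  qed
  then show ?thesis using t unfolding S_def by (intro that[of "2 / t"]) auto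
qed

text \<open>
  The error of the approximation is rescaled and approximated again.
\<close>

lemma extreme_hull_contains_ball:
  fixes u :: 'a
  assumes u: "u extreme_point_of cball 0 1"
  obtains \<rho> where "\<rho> > 0" "cball 0 \<rho> \<subseteq> closure (convex hull {e. e extreme_point_of cball (0 :: 'a) 1})"
proof -
  define S where "S = convex hull {e. e extreme_point_of cball (0 :: 'a) 1}"
  obtain r where "r > 0" and r: "\<And>x. norm x \<le> 1 \<Longrightarrow> \<exists>h\<in>S. norm (x - r *\<^sub>R h) \<le> 1/2"
    using hull_half_approximation[OF u] unfolding S_def by metis
  have Smid: "(1/2) *\<^sub>R (a + b) \<in> S" if "a \<in> S" "b \<in> S" for a b
    using convex_midpoint[OF convex_convex_hull] that unfolding S_def .
  have "0 \<in> S"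
  proof -
    have "u \<in> S" "- u \<in> S"
      using u extreme_point_scaleC[OF u, of "- 1"] by (auto simp: S_def scaleC_minus_left intro!: hull_inc)
    from Smid[OF this] show ?thesis by simp
  qed
  have approx: "\<exists>h\<in>S. norm (x - (2 * r) *\<^sub>R h) \<le> (1/2) ^ n" if "norm x \<le> 1" for x n
    using that
  proof (induction n arbitrary: x)
    case 0
    then show ?case using \<open>0 \<in> S\<close> by (intro bexI[of _ 0]) auto
  next
    case (Suc n)
    obtain h0 where h0: "h0 \<in> S" "norm (x - r *\<^sub>R h0) \<le> 1/2" using r[OF Suc.prems] by blast
    then have "norm (2 *\<^sub>R (x - r *\<^sub>R h0)) \<le> 1" by simp
    then obtain h where h: "h \<in> S" "norm (2 *\<^sub>R (x - r *\<^sub>R h0) - (2 * r) *\<^sub>R h) \<le> (1/2) ^ n"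
      using Suc.IH by blast
    have "2 *\<^sub>R (x - (2 * r) *\<^sub>R ((1/2) *\<^sub>R (h0 + h))) = 2 *\<^sub>R (x - r *\<^sub>R h0) - (2 * r) *\<^sub>R h"
      by (simp add: algebra_simps)
    then have "2 * norm (x - (2 * r) *\<^sub>R ((1/2) *\<^sub>R (h0 + h))) \<le> (1/2) ^ n"
      using h(2) by (metis norm_scaleR abs_numeral)
    then show ?case using Smid[OF h0(1) h(1)] by (intro bexI[of _ "(1/2) *\<^sub>R (h0 + h)"]) auto
  qed
  show ?thesis
  proof (rule that[of "1 / (2 * r)"])
    show "1 / (2 * r) > 0" using \<open>r > 0\<close> by simp
    show "cball 0 (1 / (2 * r)) \<subseteq> closure (convex hull {e. e extreme_point_of cball (0 :: 'a) 1})"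
      unfolding S_def[symmetric]
    proof
      fix y :: 'a assume "y \<in> cball 0 (1 / (2 * r))"
      then have x: "norm ((2 * r) *\<^sub>R y) \<le> 1" using \<open>r > 0\<close> by (simp add: field_simps)
      show "y \<in> closure S"
        unfolding closure_approachable
      proof (intro allI impI)
        fix \<epsilon> :: real assume "\<epsilon> > 0"
        then obtain n where n: "(1/2) ^ n < 2 * r * \<epsilon>"
          using real_arch_pow_inv[of "2 * r * \<epsilon>" "1/2"] \<open>r > 0\<close> by auto
        obtain h where h: "h \<in> S" "norm ((2 * r) *\<^sub>R y - (2 * r) *\<^sub>R h) \<le> (1/2) ^ n"
          using approx[OF x] by blast
        have "(2 * r) * norm (y - h) = norm ((2 * r) *\<^sub>R (y - h))" using \<open>r > 0\<close> by simp
        also have "\<dots> < 2 * r * \<epsilon>" using h(2) n by (simp only: scaleR_diff_right)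
        finally have "norm (y - h) < \<epsilon>" using \<open>r > 0\<close> by simp
        then show "\<exists>h\<in>S. dist h y < \<epsilon>" using h(1) by (auto simp: dist_norm norm_minus_commute)
      qed
    qed
  qed
qed

end

section \<open>The strong Mankiewicz property of JBW*-triples\<close>

theorem corollary2p2:
  fixes T :: "'a::complex_banach \<Rightarrow> 'a \<Rightarrow> 'a \<Rightarrow> 'a"
  assumes "jbw_triple T TYPE('p::complex_banach)"
  shows "strong_mankiewicz TYPE('b::real_normed_vector) (cball (0::'a) 1) \<and>
    (\<forall>K :: 'a set. convex_body K \<longrightarrow> strong_mankiewicz TYPE('b) K) \<and>
    (\<forall>(L :: 'b set) \<Delta>. convex L \<longrightarrow> surj_isometry (cball (0::'a) 1) L \<Delta> \<longrightarrow>
      (\<exists>!F :: 'a \<Rightarrow> 'b.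
        affine_map_on UNIV F \<and>
        (\<exists>S. affine S \<and> closed S \<and> surj_isometry UNIV S F) \<and>
        (\<forall>x \<in> cball 0 1. F x = \<Delta> x)))"
proof -
  interpret jbw_triple T "TYPE('p)" by (rule assms)
  obtain u :: 'a where "u extreme_point_of cball 0 1"
    using dual_ball_extreme_point[OF dual] .
  then obtain \<rho> where \<rho>: "\<rho> > 0" "cball 0 \<rho> \<subseteq> closure (convex hull {e::'a. e extreme_point_of cball 0 1})"
    by (rule extreme_hull_contains_ball)
  have body: "strong_mankiewicz TYPE('b) K" if "convex_body K" for K :: "'a set"
    using \<rho>(2,1) that by (rule strong_mankiewicz_if_hull)
  have "ball (0::'a) 1 \<subseteq> interior (cball 0 1)" by (rule interior_maximal) auto
  then have "convex_body (cball (0::'a) 1)"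
    unfolding convex_body_def by (metis centre_in_ball convex_cball empty_iff subsetD zero_less_one)
  then have ball: "strong_mankiewicz TYPE('b) (cball (0::'a) 1)" by (rule body)
  moreover have "\<exists>!F :: 'a \<Rightarrow> 'b. affine_map_on UNIV F \<and>
        (\<exists>S. affine S \<and> closed S \<and> surj_isometry UNIV S F) \<and> (\<forall>x \<in> cball 0 1. F x = \<Delta> x)"
    if "convex L" "surj_isometry (cball (0::'a) 1) L \<Delta>" for L :: "'b set" and \<Delta>
  proof (rule affine_isometry_extension)
    show "affine_map_on (cball 0 1) \<Delta>" using ball that unfolding strong_mankiewicz_def by blast
    show "dist (\<Delta> x) (\<Delta> y) = dist x y" if "x \<in> cball 0 1" "y \<in> cball 0 1" for x y
      using \<open>surj_isometry _ _ _\<close> that by (simp add: surj_isometry_def)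
  qed
  ultimately show ?thesis using body by blast
qed

end
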